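(* \textsc{Dilation $3$-Augmentation} is W[1]-hard parameterized by $k$ when $G$ is a star forest (and $\Gamma$ is an arbitrary unweighted graph).
   Context: Let $\Gamma$ be a finite undirected unweighted graph with vertex set $V$, and let $d_\Gamma(u,v)$ denote the shortest-path (hop) distance in $\Gamma$. A graph $G$ on the same vertex set $V$ is viewed as edge-weighted: each edge $(u,v)$ of $G$ has weight $d_\Gamma(u,v)$, and $d_G(u,v)$ denotes the weighted shortest-path distance in $G$. For a set $S$ of non-edges of $G$, $G+S=(V,E(G)\cup S)$ with the same weighting rule. $G+S$ has dilation at most $t$ if $d_{G+S}(u,v)\le t\cdot d_\Gamma(u,v)$ for all $u,v\in V$. \textsc{Dilation $t$-Augmentation}: given $(G,\Gamma,k)$, decide whether there is a set $S$ of at most $k$ non-edges of $G$ such that $G+S$ has dilation at most $t$. A star is a graph with a vertex $c$ (the center) whose edge set is exactly $\{(u,c): u\neq c\}$ (a single vertex is a star); a star forest is a graph each of whose connected components is a star. *)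

theory Defs
  imports "HOL-Library.Extended_Nat"
begin

section \<open>Machine model\<close>

text \<open>
  A random access machine with unit cost and the operations addition and truncated subtraction,
  given as structured programs. The memory consists of registers and of arrays; a program mentions
  only finitely many of either. In \<open>T\<close> steps numbers grow at most by a factor of \<open>2 ^ T\<close>, so this
  machine and Turing machines simulate each other with polynomial overhead.
\<close>

datatype prog =
    Set_Const nat nat      \<comment> \<open>\<open>R x := c\<close>\<close>
  | Add nat nat nat        \<comment> \<open>\<open>R x := R y + R z\<close>\<close>
  | Sub nat nat nat        \<comment> \<open>\<open>R x := R y - R z\<close>\<close>
  | Load nat nat nat       \<comment> \<open>\<open>R x := A a (R y)\<close>\<close>
  | Store nat nat nat      \<comment> \<open>\<open>A a (R x) := R y\<close>\<close>
  | Seq prog prog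
  | Cond nat prog prog     \<comment> \<open>tests \<open>R x \<noteq> 0\<close>\<close>
  | While nat prog         \<comment> \<open>tests \<open>R x \<noteq> 0\<close>\<close>

type_synonym state = "(nat \<Rightarrow> nat) \<times> (nat \<Rightarrow> nat \<Rightarrow> nat)"

text \<open>\<open>exec p s T s'\<close>: started in \<open>s\<close>, the program \<open>p\<close> halts in \<open>s'\<close> after \<open>T\<close> steps.\<close>

inductive exec :: "prog \<Rightarrow> state \<Rightarrow> nat \<Rightarrow> state \<Rightarrow> bool" where
  exec_Const: "exec (Set_Const x c) (R, A) 1 (R(x := c), A)"
| exec_Add: "exec (Add x y z) (R, A) 1 (R(x := R y + R z), A)"
| exec_Sub: "exec (Sub x y z) (R, A) 1 (R(x := R y - R z), A)"
| exec_Load: "exec (Load x a y) (R, A) 1 (R(x := A a (R y)), A)"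
| exec_Store: "exec (Store a x y) (R, A) 1 (R, A(a := (A a)(R x := R y)))"
| exec_Seq: "exec p s T s' \<Longrightarrow> exec q s' T' s'' \<Longrightarrow> exec (Seq p q) s (T + T') s''"
| exec_Cond_true: "R x \<noteq> 0 \<Longrightarrow> exec p (R, A) T s' \<Longrightarrow> exec (Cond x p q) (R, A) (T + 1) s'"
| exec_Cond_false: "R x = 0 \<Longrightarrow> exec q (R, A) T s' \<Longrightarrow> exec (Cond x p q) (R, A) (T + 1) s'"
| exec_While_false: "R x = 0 \<Longrightarrow> exec (While x p) (R, A) 1 (R, A)"
| exec_While_true: "R x \<noteq> 0 \<Longrightarrow> exec p (R, A) T s' \<Longrightarrow> exec (While x p) s' T' s'' \<Longrightarrow>
    exec (While x p) (R, A) (T + T' + 1) s''"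

text \<open>
  A pair of a word and a parameter is stored with the length of the word in register 0, the
  parameter in register 1, and the bits of the word in array 0.
\<close>

definition input_state :: "bool list \<times> nat \<Rightarrow> state" where
  "input_state = (\<lambda>(w, k).
     ((\<lambda>_. 0)(0 := length w, 1 := k),
      (\<lambda>_ _. 0)(0 := (\<lambda>i. if i < length w \<and> w ! i then 1 else 0))))"

definition output_of :: "state \<Rightarrow> bool list \<times> nat" where
  "output_of = (\<lambda>(R, A). (map (\<lambda>i. A 0 i \<noteq> 0) [0..<R 0], R 1))"

definition computable :: "(nat \<Rightarrow> nat) \<Rightarrow> bool" where
  "computable f \<longleftrightarrow> (\<exists>p. \<forall>k. \<exists>T s. exec p (input_state ([], k)) T s \<and> snd (output_of s) = f k)"


section \<open>Parameterized problems and the W-hierarchy\<close>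

type_synonym param_problem = "(bool list \<times> nat) set"

text \<open>
  The length of the produced word is charged as well: register 0 could be set to an exponentially
  large value in polynomially many steps, without the cells of the array being written.
\<close>

definition fpt_reducible :: "param_problem \<Rightarrow> param_problem \<Rightarrow> bool" (infix "\<le>\<^sub>f\<^sub>p\<^sub>t" 50) where
  "P \<le>\<^sub>f\<^sub>p\<^sub>t Q \<longleftrightarrow> (\<exists>p f g c. computable f \<and> computable g \<and>
     (\<forall>w k. \<exists>T s w' k'.
        exec p (input_state (w, k)) T s \<and> output_of s = (w', k') \<and>
        T + length w' \<le> f k * (length w + 1) ^ c \<and>
        k' \<le> g k \<and>
        ((w, k) \<in> P \<longleftrightarrow> (w', k') \<in> Q)))"

text \<open>Words coding a number in unary, and the matrix of a binary relation on \<open>{..<n}\<close>.\<close>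

definition unary :: "nat \<Rightarrow> bool list" where
  "unary n = replicate n True @ [False]"

definition matrix :: "nat \<Rightarrow> (nat \<Rightarrow> nat \<Rightarrow> bool) \<Rightarrow> bool list" where
  "matrix n r = [r i j. i \<leftarrow> [0..<n], j \<leftarrow> [0..<n]]"

text \<open>
  A Boolean circuit is a directed acyclic graph with nodes \<open>{..<n}\<close> and wires \<open>E\<close>. Nodes of
  indegree 0 are the inputs, nodes of indegree 1 are negations, and a node of indegree at least 2
  is a conjunction if it is in \<open>C\<close> and a disjunction otherwise. The nodes are numbered in
  topological order such that the output (which has outdegree 0) is the last one.
\<close>

definition circuit :: "nat \<Rightarrow> nat set \<Rightarrow> (nat \<times> nat) set \<Rightarrow> bool" where
  "circuit n C E \<longleftrightarrow> 0 < n \<and> C \<subseteq> {..<n} \<and> E \<subseteq> {(i, j). i < j \<and> j < n}"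

definition preds :: "(nat \<times> nat) set \<Rightarrow> nat \<Rightarrow> nat set" where
  "preds E i = {j. (j, i) \<in> E}"

definition inputs :: "nat \<Rightarrow> (nat \<times> nat) set \<Rightarrow> nat set" where
  "inputs n E = {i. i < n \<and> preds E i = {}}"

definition valuation :: "nat \<Rightarrow> nat set \<Rightarrow> (nat \<times> nat) set \<Rightarrow> (nat \<Rightarrow> bool) \<Rightarrow> bool" where
  "valuation n C E v \<longleftrightarrow> (\<forall>i<n.
     (card (preds E i) = 1 \<longrightarrow> (v i \<longleftrightarrow> (\<forall>j\<in>preds E i. \<not> v j))) \<and>
     (card (preds E i) \<ge> 2 \<longrightarrow>
        (v i \<longleftrightarrow> (if i \<in> C then \<forall>j\<in>preds E i. v j else \<exists>j\<in>preds E i. v j))))"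

definition circuit_path :: "nat \<Rightarrow> (nat \<times> nat) set \<Rightarrow> nat list \<Rightarrow> bool" where
  "circuit_path n E p \<longleftrightarrow>
     p \<noteq> [] \<and> hd p \<in> inputs n E \<and> last p = n - 1 \<and> successively (\<lambda>i j. (i, j) \<in> E) p"

definition depth_at_most :: "nat \<Rightarrow> (nat \<times> nat) set \<Rightarrow> nat \<Rightarrow> bool" where
  "depth_at_most n E d \<longleftrightarrow> (\<forall>p. circuit_path n E p \<longrightarrow> length p - 1 \<le> d)"

definition weft_at_most :: "nat \<Rightarrow> (nat \<times> nat) set \<Rightarrow> nat \<Rightarrow> bool" where
  "weft_at_most n E t \<longleftrightarrow>
     (\<forall>p. circuit_path n E p \<longrightarrow> length (filter (\<lambda>i. card (preds E i) > 2) p) \<le> t)"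

definition circuit_code :: "nat \<Rightarrow> nat set \<Rightarrow> (nat \<times> nat) set \<Rightarrow> bool list" where
  "circuit_code n C E = unary n @ map (\<lambda>i. i \<in> C) [0..<n] @ matrix n (\<lambda>i j. (i, j) \<in> E)"

text \<open>
  Weighted circuit satisfiability for circuits of weft at most \<open>t\<close> and depth at most \<open>d\<close>. As the
  circuit is acyclic, an assignment to the inputs extends to exactly one valuation on \<open>{..<n}\<close>.
\<close>

definition WCS :: "nat \<Rightarrow> nat \<Rightarrow> param_problem" where
  "WCS t d = {(circuit_code n C E, k) | n C E k.
     circuit n C E \<and> weft_at_most n E t \<and> depth_at_most n E d \<and>
     (\<exists>v. valuation n C E v \<and> v (n - 1) \<and> card {i \<in> inputs n E. v i} = k)}"

definition W :: "nat \<Rightarrow> param_problem set" where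
  "W t = {P. \<exists>d\<ge>1. P \<le>\<^sub>f\<^sub>p\<^sub>t WCS t d}"

definition W_hard :: "nat \<Rightarrow> param_problem \<Rightarrow> bool" where
  "W_hard t Q \<longleftrightarrow> (\<forall>P\<in>W t. P \<le>\<^sub>f\<^sub>p\<^sub>t Q)"


section \<open>Dilation augmentation\<close>

text \<open>Finite simple undirected graphs on \<open>{..<n}\<close> are given by their sets of edges.\<close>

type_synonym edges = "nat set set"

definition all_edges :: "nat \<Rightarrow> edges" where
  "all_edges n = {e. e \<subseteq> {..<n} \<and> card e = 2}"

definition walks :: "edges \<Rightarrow> nat \<Rightarrow> nat \<Rightarrow> nat list set" where
  "walks E u v = {p. p \<noteq> [] \<and> hd p = u \<and> last p = v \<and> successively (\<lambda>x y. {x, y} \<in> E) p}"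

text \<open>The distances are infinite for vertices in different connected components.\<close>

definition weighted_dist :: "(nat \<Rightarrow> nat \<Rightarrow> enat) \<Rightarrow> edges \<Rightarrow> nat \<Rightarrow> nat \<Rightarrow> enat" where
  "weighted_dist w E u v = (INF p\<in>walks E u v. \<Sum>i<length p - 1. w (p ! i) (p ! Suc i))"

definition hop_dist :: "edges \<Rightarrow> nat \<Rightarrow> nat \<Rightarrow> enat" where
  "hop_dist E u v = (INF p\<in>walks E u v. enat (length p - 1))"

definition dilation_at_most :: "nat \<Rightarrow> nat \<Rightarrow> edges \<Rightarrow> edges \<Rightarrow> bool" where
  "dilation_at_most t n G \<Gamma> \<longleftrightarrow>
     (\<forall>u<n. \<forall>v<n. weighted_dist (hop_dist \<Gamma>) G u v \<le> enat t * hop_dist \<Gamma> u v)"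

definition components :: "nat \<Rightarrow> edges \<Rightarrow> nat set set" where
  "components n E = {..<n} // {(u, v). u < n \<and> v < n \<and> walks E u v \<noteq> {}}"

definition star_forest :: "nat \<Rightarrow> edges \<Rightarrow> bool" where
  "star_forest n E \<longleftrightarrow>
     (\<forall>K\<in>components n E. \<exists>c\<in>K. {e \<in> E. e \<subseteq> K} = {{u, c} | u. u \<in> K \<and> u \<noteq> c})"

definition graph_pair_code :: "nat \<Rightarrow> edges \<Rightarrow> edges \<Rightarrow> bool list" where
  "graph_pair_code n G \<Gamma> =
     unary n @ matrix n (\<lambda>i j. {i, j} \<in> G) @ matrix n (\<lambda>i j. {i, j} \<in> \<Gamma>)"

text \<open>Dilation \<open>t\<close>-augmentation for graphs \<open>G\<close> in the class \<open>X\<close>, parameterized by \<open>k\<close>.\<close>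

definition dilation_augmentation :: "(nat \<Rightarrow> edges \<Rightarrow> bool) \<Rightarrow> nat \<Rightarrow> param_problem" where
  "dilation_augmentation X t = {(graph_pair_code n G \<Gamma>, k) | n G \<Gamma> k.
     G \<subseteq> all_edges n \<and> \<Gamma> \<subseteq> all_edges n \<and> X n G \<and>
     (\<exists>S \<subseteq> all_edges n - G. card S \<le> k \<and> dilation_at_most t n (G \<union> S) \<Gamma>)}"

end

theory Submission
  imports Defs
begin

text \<open>
  Only boundedly many large gates of a circuit of weft 1 reach the output, and below them every node
  depends on boundedly many inputs. Fix for each such gate either a predecessor deciding its value or
  the claim that there is none, and describe the set of the \<open>k\<close> true inputs by the \<open>k + 1\<close> gaps
  between its elements. Then every condition to be checked involves boundedly many gaps. Taking
  tuples of gaps as colors and their possible values as vertices turns satisfiability into the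
  existence of a colored clique.

  A colored clique is found by augmentation as follows. The center \<open>c\<close> of a star is joined to all
  vertices of the clique instance, and each color \<open>i\<close> gets many isolated vertices \<open>p\<close> that have to be
  close to all vertices of color \<open>i\<close>, so that each \<open>p\<close> needs an edge to such a vertex or to \<open>c\<close>.
  The rest of the budget is too small to touch all copies of \<open>p\<close>. For untouched copies
  \<open>p\<close> and \<open>p'\<close> of different colors, only a path \<open>p - u - u' - p'\<close> with an edge \<open>u u'\<close> of the clique
  instance is short enough.

  The output word is described by expressions with bounded sums, which can be evaluated in
  polynomial time.
\<close>

section \<open>From colored cliques to dilation\<close>

text \<open>The true inputs are described by gaps because absence has to be certified, too: that
  \<open>x\<close> is false would involve all \<open>k\<close> elements of the set, whereas the
  single gap around \<open>x + 1\<close> witnesses it. Hence the number of entries of a vertex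
  depends on \<open>d\<close> only and there are \<open>(n + 2) ^ (4 * 2 ^ Suc d)\<close> tuples of
  entries, while \<open>k\<close> enters only the number of colors and, through it, the budget. Each
  vertex repeats all claims, as the evaluation of the output may meet any of them. Whether a view is
  valid concerns one vertex; what relates two vertices is merely that their gaps and claims fit
  together, and this is why a clique suffices. The depth is fixed by the problem, so every recursion
  over it unfolds into an expression of fixed size.\<close>

definition walk_weight :: "(nat \<Rightarrow> nat \<Rightarrow> enat) \<Rightarrow> nat list \<Rightarrow> enat" where
  "walk_weight w p = (\<Sum>i<length p - 1. w (p ! i) (p ! Suc i))"

lemma walk_weight_simps [simp]:
  "walk_weight w [] = 0" "walk_weight w [x] = 0"
  "walk_weight w (x # y # p) = w x y + walk_weight w (y # p)"
  by (simp_all add: walk_weight_def sum.lessThan_Suc_shift del: sum.lessThan_Suc)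

lemma walk_weight_join:
  "p \<noteq> [] \<Longrightarrow> q \<noteq> [] \<Longrightarrow> last p = hd q \<Longrightarrow>
     walk_weight w (p @ tl q) = walk_weight w p + walk_weight w q"
proof (induction p rule: induct_list012)
  case (2 x)
  then show ?case by (cases q) auto
next
  case (3 x y zs)
  then show ?case by (simp add: add.assoc)
qed simp

lemma walks_join:
  assumes "p \<in> walks E u v" "q \<in> walks E v x"
  shows "p @ tl q \<in> walks E u x"
proof (cases "tl q = []")
  case True
  then have "q = [v]" "x = v" using assms(2) unfolding walks_def by (cases q; auto)+
  then show ?thesis using assms(1) by (auto simp: walks_def)
next
  case False
  then obtain y q' where q: "q = v # y # q'"
    using assms(2) unfolding walks_def by (cases q; cases "tl q"; auto)
  then show ?thesis using assms by (auto simp: walks_def successively_append_iff)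
qed

lemma weighted_dist_le:
  "p \<in> walks E u v \<Longrightarrow> weighted_dist w E u v \<le> walk_weight w p"
  unfolding weighted_dist_def walk_weight_def by (rule INF_lower)

text \<open>\<open>enat\<close> is well-ordered, so the infimum of a nonempty set of weights is a
  minimum, although there are infinitely many walks.\<close>

lemma weighted_dist_attained:
  assumes "walks E u v \<noteq> {}"
  obtains p where "p \<in> walks E u v" "weighted_dist w E u v = walk_weight w p"
proof -
  obtain p where "p \<in> walks E u v" using assms by blast
  then have "walk_weight w p \<in> walk_weight w ` walks E u v" by (rule imageI)
  then have "Inf (walk_weight w ` walks E u v) \<in> walk_weight w ` walks E u v"
    by (rule wellorder_InfI)
  then show ?thesis using that unfolding weighted_dist_def walk_weight_def by auto
qed

lemma weighted_dist_triangle: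
  "weighted_dist w E u v \<le> weighted_dist w E u x + weighted_dist w E x v"
proof (cases "walks E u x = {} \<or> walks E x v = {}")
  case True
  then show ?thesis by (auto simp: weighted_dist_def top_enat_def)
next
  case False
  then obtain p where p: "p \<in> walks E u x" "weighted_dist w E u x = walk_weight w p"
    using weighted_dist_attained by metis
  from False obtain q where q: "q \<in> walks E x v" "weighted_dist w E x v = walk_weight w q"
    using weighted_dist_attained by metis
  have "weighted_dist w E u v \<le> walk_weight w (p @ tl q)"
    using walks_join[OF p(1) q(1)] by (rule weighted_dist_le)
  also have "\<dots> = walk_weight w p + walk_weight w q"
    using p q by (intro walk_weight_join) (auto simp: walks_def)
  finally show ?thesis using p q by simp
qed

lemma hop_dist_attained:
  assumes "walks E u v \<noteq> {}"
  obtains p where "p \<in> walks E u v" "hop_dist E u v = enat (length p - 1)"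
proof -
  let ?f = "\<lambda>p::nat list. enat (length p - 1)"
  obtain p where "p \<in> walks E u v" using assms by blast
  then have "?f p \<in> ?f ` walks E u v" by (rule imageI)
  then have "Inf (?f ` walks E u v) \<in> ?f ` walks E u v" by (rule wellorder_InfI)
  then show ?thesis using that unfolding hop_dist_def by auto
qed

lemma hop_dist_le:
  "p \<in> walks E u v \<Longrightarrow> hop_dist E u v \<le> enat (length p - 1)"
  unfolding hop_dist_def by (rule INF_lower)

text \<open>Each edge of a shortest walk in \<open>\<Gamma>\<close> is replaced by a detour of
  weight at most \<open>t\<close>, so only edges have to be checked. Between different components
  the right-hand side is infinite because of \<open>0 < t\<close>.\<close>

lemma dilation_atI:
  assumes "0 < t"
    and edge: "\<And>x y. {x, y} \<in> \<Gamma> \<Longrightarrow> weighted_dist (hop_dist \<Gamma>) G x y \<le> enat t"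
  shows "dilation_at_most t n G \<Gamma>"
proof -
  have walk: "p \<noteq> [] \<Longrightarrow> successively (\<lambda>x y. {x, y} \<in> \<Gamma>) p \<Longrightarrow>
      weighted_dist (hop_dist \<Gamma>) G (hd p) (last p) \<le> enat (t * (length p - 1))" for p
  proof (induction p rule: induct_list012)
    case (2 x)
    then show ?case using weighted_dist_le[of "[x]" G x x "hop_dist \<Gamma>"] by (simp add: walks_def)
  next
    case (3 x y zs)
    have "weighted_dist (hop_dist \<Gamma>) G x (last (y # zs)) \<le>
        weighted_dist (hop_dist \<Gamma>) G x y + weighted_dist (hop_dist \<Gamma>) G y (last (y # zs))"
      by (rule weighted_dist_triangle)
    also have "\<dots> \<le> enat t + enat (t * length zs)"
      using 3 edge[of x y] by (intro add_mono) auto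
    finally show ?case by (simp add: algebra_simps)
  qed simp
  have "weighted_dist (hop_dist \<Gamma>) G u v \<le> enat t * hop_dist \<Gamma> u v" for u v
  proof (cases "walks \<Gamma> u v = {}")
    case True
    then show ?thesis using \<open>0 < t\<close> by (simp add: hop_dist_def top_enat_def imult_is_infinity)
  next
    case False
    then obtain p where "p \<in> walks \<Gamma> u v" "hop_dist \<Gamma> u v = enat (length p - 1)"
      using hop_dist_attained by metis
    then show ?thesis using walk[of p] by (auto simp: walks_def)
  qed
  then show ?thesis unfolding dilation_at_most_def by blast
qed


section \<open>Hop distances of single steps and walks of weight at most 3\<close>

lemma hop_dist_edge: "{x, y} \<in> E \<Longrightarrow> hop_dist E x y \<le> 1"
  using hop_dist_le[of "[x, y]" E x y] by (simp add: walks_def one_enat_def)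

lemma hop_dist_ge1:
  assumes "x \<noteq> y" shows "1 \<le> hop_dist E x y"
  unfolding hop_dist_def
proof (rule INF_greatest)
  fix p assume "p \<in> walks E x y"
  then show "1 \<le> enat (length p - 1)"
    using assms by (cases p; cases "tl p") (auto simp: walks_def one_enat_def)
qed

lemma hop_dist_ge2:
  assumes "x \<noteq> y" "{x, y} \<notin> E" shows "2 \<le> hop_dist E x y"
  unfolding hop_dist_def
proof (rule INF_greatest)
  fix p assume p: "p \<in> walks E x y"
  obtain a b d q where "p = a # b # d # q"
    using assms p by (cases p; cases "tl p"; cases "tl (tl p)") (auto simp: walks_def)
  then show "2 \<le> enat (length p - 1)" by (simp add: numeral_eq_enat)
qed

lemma walk_hd: "p \<in> walks E x y \<Longrightarrow> \<exists>q. p = x # q"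
  by (cases p) (auto simp: walks_def)

text \<open>Every step has weight at least 1, so walks of weight at most 3 have at most three steps.\<close>

lemma short_walk_cases:
  assumes "weighted_dist (hop_dist \<Gamma>) G x y \<le> 3" "x \<noteq> y" "\<And>v. {v} \<notin> G"
  obtains (one) "{x, y} \<in> G" "hop_dist \<Gamma> x y \<le> 3"
    | (two) a where "{x, a} \<in> G" "{a, y} \<in> G" "hop_dist \<Gamma> x a + hop_dist \<Gamma> a y \<le> 3"
    | (three) a b where "{x, a} \<in> G" "{a, b} \<in> G" "{b, y} \<in> G"
        "hop_dist \<Gamma> x a = 1" "hop_dist \<Gamma> a b = 1" "hop_dist \<Gamma> b y = 1"
proof -
  let ?w = "hop_dist \<Gamma>"
  have ge: "1 \<le> ?w a b" if "{a, b} \<in> G" for a b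
    using that assms(3)[of a] by (intro hop_dist_ge1) auto
  have "walks G x y \<noteq> {}"
    using assms(1) by (auto simp: weighted_dist_def top_enat_def)
  then obtain p where p: "p \<in> walks G x y" "walk_weight ?w p \<le> 3"
    using assms(1) weighted_dist_attained by metis
  have le: "enat (length q - 1) \<le> walk_weight ?w q"
    if "successively (\<lambda>a b. {a, b} \<in> G) q" for q
    using that
  proof (induction q rule: induct_list012)
    case (3 a b q)
    have "1 + enat (length q) \<le> ?w a b + walk_weight ?w (b # q)"
      using 3 ge[of a b] by (intro add_mono) auto
    then show ?case by (simp add: one_enat_def)
  qed (auto simp: zero_enat_def)
  have "length p \<le> 4"
    using le[of p] p by (auto simp: walks_def numeral_eq_enat dest: order_trans)
  moreover obtain q where q: "p = x # q" using walk_hd p by blast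
  moreover obtain a q' where q': "q = a # q'"
    using p q assms(2) by (cases q) (auto simp: walks_def)
  ultimately consider "q' = []" | b where "q' = [b]" | b d where "q' = [b, d]"
    by (cases q'; cases "tl q'"; cases "tl (tl q')") auto
  then show ?thesis
  proof cases
    case 1
    then show ?thesis using p q q' one by (auto simp: walks_def)
  next
    case 2
    then show ?thesis using p q q' two[of a] by (auto simp: walks_def)
  next
    case 3
    then have *: "{x, a} \<in> G" "{a, b} \<in> G" "{b, y} \<in> G"
      "?w x a + (?w a b + ?w b y) \<le> 3"
      using p q q' by (auto simp: walks_def)
    \<comment> \<open>Three weights that are at least 1 and add up to at most 3 all equal 1.\<close>
    obtain i j k where "?w x a = enat i" "?w a b = enat j" "?w b y = enat k"
      using *(4) by (cases "?w x a"; cases "?w a b"; cases "?w b y") auto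
    then show ?thesis
      using three[of a b] * ge[OF *(1)] ge[OF *(2)] ge[OF *(3)]
      by (auto simp: numeral_eq_enat one_enat_def)
  qed
qed

text \<open>Leaves are the numbers below \<open>s\<close>, copies those from \<open>s\<close> to
  \<open>c - 1\<close>, and \<open>c\<close> is the center. Decoded, the last condition says: a leaf
  and a copy are adjacent iff their colors agree, two copies iff their colors differ, two leaves iff
  their colors differ and \<open>A\<close> holds.\<close>

definition gadget_adj :: "nat \<Rightarrow> nat \<Rightarrow> (nat \<Rightarrow> nat \<Rightarrow> bool) \<Rightarrow> (nat \<Rightarrow> nat) \<Rightarrow> nat \<Rightarrow> nat \<Rightarrow> bool" where
  "gadget_adj s c A col x y \<longleftrightarrow> x \<noteq> y \<and> x \<le> c \<and> y \<le> c \<and>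
     (if x = c then y < s else if y = c then x < s
      else (col x = col y \<longleftrightarrow> (x < s) \<noteq> (y < s)) \<and> (x < s \<and> y < s \<longrightarrow> A x y))"

text \<open>If each of the \<open>m * (2 * (m * m) + 1)\<close> copies consumes an edge of its own,
  the budget leaves \<open>m * m\<close> edges for the pairs of colors. These touch at most
  \<open>2 * (m * m)\<close> vertices, so one copy of each color escapes them. A domain exceeds
  twice the budget, so some leaf of each color escapes all new edges.\<close>

locale clique_gadget =
  fixes s c m :: nat and A :: "nat \<Rightarrow> nat \<Rightarrow> bool" and col :: "nat \<Rightarrow> nat"
  assumes s_le_c: "s \<le> c"
    and col_less: "\<And>x. x < c \<Longrightarrow> col x < m"
    and A_sym: "\<And>x y. A x y \<Longrightarrow> A y x"
    and two_colors: "2 \<le> m"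
    and copies: "\<And>i. i < m \<Longrightarrow> card {p. s \<le> p \<and> p < c \<and> col p = i} = 2 * (m * m) + 1"
    and domains: "\<And>i. i < m \<Longrightarrow>
      2 * (m * (2 * (m * m) + 1) + m * m) < card {x. x < s \<and> col x = i}"
begin

abbreviation adj :: "nat \<Rightarrow> nat \<Rightarrow> bool" where "adj \<equiv> gadget_adj s c A col"

definition \<Gamma> :: edges where "\<Gamma> = {{x, y} | x y. adj x y}"

definition G :: edges where "G = {{x, c} | x. x < s}"

definition budget :: nat where "budget = m * (2 * (m * m) + 1) + m * m"

section \<open>The gadget graph and its star forest\<close>

lemma adj_sym: "adj x y \<Longrightarrow> adj y x"
  using A_sym unfolding gadget_adj_def by (auto split: if_splits)

lemma edge_\<Gamma> [simp]: "{x, y} \<in> \<Gamma> \<longleftrightarrow> adj x y"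
  unfolding \<Gamma>_def by (auto simp: doubleton_eq_iff intro: adj_sym)

lemma edge_G [simp]: "{x, y} \<in> G \<longleftrightarrow> (x < s \<and> y = c) \<or> (y < s \<and> x = c)"
  unfolding G_def by (auto simp: doubleton_eq_iff)

lemma \<Gamma>_edges: "\<Gamma> \<subseteq> all_edges (c + 1)"
  unfolding \<Gamma>_def all_edges_def by (auto simp: gadget_adj_def)

lemma G_edges: "G \<subseteq> all_edges (c + 1)"
  using s_le_c unfolding G_def all_edges_def by (auto simp: card_insert_if)

lemma card_P: "card {s..<c} = m * (2 * (m * m) + 1)"
proof -
  have "{s..<c} = (\<Union>i<m. {p. s \<le> p \<and> p < c \<and> col p = i})"
    using col_less by auto
  also have "card \<dots> = (\<Sum>i<m. card {p. s \<le> p \<and> p < c \<and> col p = i})"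
    by (rule card_UN_disjoint) auto
  finally show ?thesis by (simp add: copies)
qed

lemma star_forest_G: "star_forest (c + 1) G"
proof -
  let ?r = "{(u, v). u < c + 1 \<and> v < c + 1 \<and> walks G u v \<noteq> {}}"
  have from_P: "v = u" if "p \<in> walks G u v" "s \<le> u" "u < c" for p u v
    using that by (cases p; cases "tl p") (auto simp: walks_def)
  have to_P: "u = v" if "p \<in> walks G u v" "s \<le> v" "v < c" for p u v
  proof -
    have "rev p \<in> walks G v u"
      using that(1) by (auto simp: walks_def hd_rev last_rev elim!: successively_mono)
    then show ?thesis using from_P that by blast
  qed
  have refl: "walks G u u \<noteq> {}" for u
  proof -
    have "[u] \<in> walks G u u" by (simp add: walks_def)
    then show ?thesis by blast
  qed
  have star: "walks G u v \<noteq> {}" if "u < s \<or> u = c" "v < s \<or> v = c" for u v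
  proof -
    have "(if u = v then [u] else if u = c \<or> v = c then [u, v] else [u, c, v]) \<in> walks G u v"
      using that by (auto simp: walks_def)
    then show ?thesis by blast
  qed
  show ?thesis unfolding star_forest_def components_def
  proof
    fix K assume "K \<in> {..<c + 1} // ?r"
    then obtain u where "u \<in> {..<c + 1}" and K: "K = ?r `` {u}"
      by (rule quotientE)
    then have u: "u \<le> c" by simp
    show "\<exists>x\<in>K. {e \<in> G. e \<subseteq> K} = {{v, x} | v. v \<in> K \<and> v \<noteq> x}"
    proof (cases "s \<le> u \<and> u < c")
      case True
      \<comment> \<open>A copy is isolated in \<open>G\<close> and forms a star without
        edges.\<close>
      then have "K = {u}" using K refl from_P by auto
      then show ?thesis using True unfolding G_def by (intro bexI[of _ u]) auto
    next
      case False
      then have "u < s \<or> u = c" using u by linarith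
      have "v \<in> K \<longleftrightarrow> v < s \<or> v = c" for v
      proof
        assume "v \<in> K"
        then have "v \<le> c" "walks G u v \<noteq> {}" using K by auto
        then show "v < s \<or> v = c" using to_P[of _ u v] False by fastforce
      next
        assume v: "v < s \<or> v = c"
        then show "v \<in> K" using K s_le_c u star[OF \<open>u < s \<or> u = c\<close> v] by auto
      qed
      then have "K = {..<s} \<union> {c}" by blast
      moreover have "{e \<in> G. e \<subseteq> {..<s} \<union> {c}} = G" by (auto simp: G_def)
      moreover have "{{v, c} | v. v \<in> {..<s} \<union> {c} \<and> v \<noteq> c} = G"
        unfolding G_def using s_le_c by (intro Collect_cong ex_cong1) auto
      ultimately show ?thesis by (intro bexI[of _ c]) simp_all
    qed
  qed
qed

lemma hop_adj: "adj x y \<Longrightarrow> hop_dist \<Gamma> x y \<le> 1"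
  by (intro hop_dist_edge) simp

text \<open>Every copy is joined to the clique vertex of its color, and the clique vertices are
  joined to each other. An edge of \<open>\<Gamma>\<close> is then bridged by at most three edges of
  weight 1: two leaves through \<open>c\<close>, a leaf and a copy through \<open>c\<close> and a
  clique vertex, two copies through two clique vertices.\<close>

lemma clique_imp_augmentation:
  assumes u: "\<And>i. i < m \<Longrightarrow> u i < s \<and> col (u i) = i"
    and A: "\<And>i j. i < m \<Longrightarrow> j < m \<Longrightarrow> i \<noteq> j \<Longrightarrow> A (u i) (u j)"
  shows "\<exists>S \<subseteq> all_edges (c + 1) - G. card S \<le> budget \<and> dilation_at_most 3 (c + 1) (G \<union> S) \<Gamma>"
proof -
  let ?w = "hop_dist \<Gamma>"
  define S where "S = (\<lambda>p. {p, u (col p)}) ` {s..<c} \<union>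
    (\<lambda>(i, j). {u i, u j}) ` {(i, j). i < m \<and> j < m \<and> i \<noteq> j}"
  have fin: "finite {(i, j). i < m \<and> j < m \<and> i \<noteq> j}" 
    by (rule finite_subset[of _ "{..<m} \<times> {..<m}"]) auto
  have "card {(i, j). i < m \<and> j < m \<and> i \<noteq> j} \<le> card ({..<m} \<times> {..<m})"
    by (intro card_mono) auto
  then have "card S \<le> budget"
    unfolding S_def budget_def
    by (intro order_trans[OF card_Un_le] add_mono order_trans[OF card_image_le])
      (use card_P in \<open>auto simp: fin\<close>)
  moreover have "S \<subseteq> all_edges (c + 1) - G"
  proof
    fix e assume "e \<in> S"
    then consider p where "s \<le> p" "p < c" "e = {p, u (col p)}"
      | i j where "i < m" "j < m" "i \<noteq> j" "e = {u i, u j}"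
      unfolding S_def by auto
    then show "e \<in> all_edges (c + 1) - G"
    proof cases
      case 1
      then show ?thesis using u[OF col_less[of p]] by (auto simp: all_edges_def card_insert_if)
    next
      case 2
      then show ?thesis using u[of i] u[of j] s_le_c
        by (auto simp: all_edges_def card_insert_if)
    qed
  qed
  moreover have "dilation_at_most 3 (c + 1) (G \<union> S) \<Gamma>"
  proof (rule dilation_atI)
    have SP: "{p, u (col p)} \<in> S" "{u (col p), p} \<in> S" "adj p (u (col p))" "adj (u (col p)) p"
      if "s \<le> p" "p < c" for p
      using that u[OF col_less[of p]] unfolding S_def
      by (auto simp: gadget_adj_def insert_commute)
    have cadj: "adj x c" "adj c x" if "x < s" for x
      using that s_le_c by (auto simp: gadget_adj_def)
    have path1: "weighted_dist ?w (G \<union> S) x y \<le> 3" if "{x, y} \<in> G \<union> S" "adj x y" for x y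
    proof -
      have "weighted_dist ?w (G \<union> S) x y \<le> walk_weight ?w [x, y]"
        using that by (intro weighted_dist_le) (auto simp: walks_def)
      also have "\<dots> \<le> 1" using that hop_adj by simp
      finally show ?thesis by (rule order_trans) (simp add: one_enat_def numeral_eq_enat)
    qed
    have path2: "weighted_dist ?w (G \<union> S) x y \<le> 3"
      if "{x, a} \<in> G \<union> S" "{a, y} \<in> G \<union> S" "adj x a" "adj a y" for x a y
    proof -
      have "weighted_dist ?w (G \<union> S) x y \<le> walk_weight ?w [x, a, y]"
        using that by (intro weighted_dist_le) (auto simp: walks_def)
      also have "\<dots> \<le> 1 + 1"
        unfolding walk_weight_simps add_0_right using that hop_adj by (intro add_mono) auto
      finally show ?thesis by (rule order_trans) (simp add: one_enat_def numeral_eq_enat)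
    qed
    have path3: "weighted_dist ?w (G \<union> S) x y \<le> 3"
      if "{x, a} \<in> G \<union> S" "{a, b} \<in> G \<union> S" "{b, y} \<in> G \<union> S" "adj x a" "adj a b" "adj b y"
      for x a b y
    proof -
      have "weighted_dist ?w (G \<union> S) x y \<le> walk_weight ?w [x, a, b, y]"
        using that by (intro weighted_dist_le) (auto simp: walks_def)
      also have "\<dots> \<le> 1 + (1 + 1)"
        unfolding walk_weight_simps add_0_right using that hop_adj by (intro add_mono) auto
      finally show ?thesis by (simp add: one_enat_def numeral_eq_enat numeral_3_eq_3)
    qed
    fix x y assume "{x, y} \<in> \<Gamma>"
    then have xy: "adj x y" by simp
    have lt: "x \<le> c" "y \<le> c" using xy by (auto simp: gadget_adj_def)
    consider "x = c" | "y = c" | "x < s" "y < s" | "x < s" "s \<le> y" "y < c"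
      | "s \<le> x" "x < c" "y < s" | "s \<le> x" "x < c" "s \<le> y" "y < c"
      using lt by linarith
    then have "weighted_dist ?w (G \<union> S) x y \<le> 3"
    proof cases
      case 1
      then show ?thesis using xy s_le_c by (intro path1) (auto simp: gadget_adj_def)
    next
      case 2
      then show ?thesis using xy s_le_c by (intro path1) (auto simp: gadget_adj_def)
    next
      case 3
      then show ?thesis using cadj by (intro path2[of x c]) auto
    next
      case 4
      then have "col x = col y" using xy s_le_c by (auto simp: gadget_adj_def)
      then show ?thesis using 4 cadj SP[of y] u[OF col_less[of y]]
        by (intro path3[of x c "u (col y)"]) auto
    next
      case 5
      then have "col x = col y" using xy s_le_c by (auto simp: gadget_adj_def)
      then show ?thesis using 5 cadj SP[of x] u[OF col_less[of x]]
        by (intro path3[of x "u (col x)" c]) auto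
    next
      case 6
      then have ne: "col x \<noteq> col y" using xy s_le_c by (auto simp: gadget_adj_def)
      have less: "col x < m" "col y < m" using 6 col_less by auto
      have "{u (col x), u (col y)} \<in> S" 
        using ne less unfolding S_def by auto
      moreover have "adj (u (col x)) (u (col y))"
        using u[OF less(1)] u[OF less(2)] ne s_le_c A[OF less ne] unfolding gadget_adj_def by auto
      ultimately show ?thesis using 6 SP[of x] SP[of y]
        by (intro path3[of x "u (col x)" "u (col y)"]) auto
    qed
    then show "weighted_dist ?w (G \<union> S) x y \<le> enat 3" by (simp add: numeral_eq_enat)
  qed simp
  ultimately show ?thesis by blast
qed


text \<open>A step that is no edge of \<open>\<Gamma>\<close> costs at least 2. So a walk of weight
  3 has three steps only if all of them are edges of \<open>\<Gamma>\<close>, which is how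
  \<open>A\<close> gets tested, and it cannot pass between two copies through \<open>c\<close>
  alone.\<close>

lemma augmentation_imp_clique:
  assumes S: "S \<subseteq> all_edges (c + 1) - G" "card S \<le> budget"
    and dil: "dilation_at_most 3 (c + 1) (G \<union> S) \<Gamma>"
  obtains u where "\<And>i. i < m \<Longrightarrow> u i < s \<and> col (u i) = i"
    "\<And>i j. i < m \<Longrightarrow> j < m \<Longrightarrow> i \<noteq> j \<Longrightarrow> A (u i) (u j)"
proof -
  let ?w = "hop_dist \<Gamma>"
  have fin_all: "finite (all_edges n)" for n
    by (rule finite_subset[of _ "Pow {..<n}"]) (auto simp: all_edges_def)
  have finS: "finite S" using S(1) fin_all finite_subset by blast
  have cardS: "card e = 2" if "e \<in> S" for e using that S by (auto simp: all_edges_def)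
  have touched: "finite (\<Union>F)" "card (\<Union>F) \<le> 2 * card F" if "F \<subseteq> S" for F
  proof -
    have "card (\<Union>F) \<le> (\<Sum>e\<in>F. card e)"
      by (rule card_Union_le_sum_card)
    also have "\<dots> = 2 * card F" using that cardS by (simp add: subset_iff)
    finally show "card (\<Union>F) \<le> 2 * card F" .
    have "finite e" if "e \<in> F" for e
      using cardS[of e] that \<open>F \<subseteq> S\<close> by (intro card_ge_0_finite) auto
    then show "finite (\<Union>F)"
      using finite_subset[OF that finS] by blast
  qed
  have no_loop: "{v} \<notin> G \<union> S" for v
    using cardS[of "{v}"] edge_G[of v v] s_le_c by auto
  have edge: "weighted_dist ?w (G \<union> S) x y \<le> 3" if "adj x y" for x y
  proof -
    have "weighted_dist ?w (G \<union> S) x y \<le> enat 3 * ?w x y"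
      using dil that by (auto simp: dilation_at_most_def gadget_adj_def)
    also have "\<dots> \<le> enat 3 * 1" using hop_adj[OF that] by (intro mult_left_mono) auto
    finally show ?thesis by (simp add: numeral_eq_enat)
  qed
  have w_nonadj: "2 \<le> ?w x y" if "\<not> adj x y" "x \<noteq> y" for x y
    using that by (intro hop_dist_ge2) auto
  have w_one: "adj x y" if "?w x y = 1" for x y
  proof (rule ccontr)
    assume "\<not> adj x y"
    moreover have "x \<noteq> y"
    proof
      assume "x = y"
      then have "?w x y \<le> 0"
        using hop_dist_le[of "[x]" \<Gamma> x x] by (simp add: walks_def zero_enat_def)
      then show False using that by simp
    qed
    ultimately show False using w_nonadj[of x y] that
      by (simp add: one_enat_def numeral_eq_enat)
  qed
  have not_adj_c: "\<not> adj p c" "\<not> adj c p" if "s \<le> p" for p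
    using that s_le_c by (auto simp: gadget_adj_def)

  text \<open>A leaf untouched by \<open>S\<close> is entered through the center, so \<open>p\<close> is within distance 2 of it.\<close>
  have "\<exists>z. {p, z} \<in> S \<and> (z = c \<or> z < s \<and> adj p z)" if p: "s \<le> p" "p < c" for p
  proof -
    have i: "col p < m" using p col_less by auto
    \<comment> \<open>All edges of \<open>S\<close> together touch fewer vertices than there are
      leaves of this color.\<close>
    have "2 * card S < card {x. x < s \<and> col x = col p}"
      using domains[OF i] mult_le_mono2[OF S(2), of 2] unfolding budget_def by (rule le_less_trans[rotated])
    then have "\<not> {x. x < s \<and> col x = col p} \<subseteq> \<Union>S"
      using touched[of S] card_mono[of "\<Union>S"] by (meson leD le_trans order_refl)
    then obtain x where x: "x < s" "col x = col p" "x \<notin> \<Union>S" by blast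
    have nb: "a = c" if "{a, x} \<in> G \<union> S" for a
      using that x s_le_c by auto
    have "adj p x" "p \<noteq> x" using p x s_le_c by (auto simp: gadget_adj_def)
    from edge[OF this(1)] this(2) no_loop show ?thesis
    proof (cases rule: short_walk_cases)
      case one
      then show ?thesis using nb[of p] p x by auto
    next
      case (two a)
      then show ?thesis using nb[of a] p s_le_c by auto
    next
      case (three a b)
      have b: "b = c" using nb three(3) by blast
      have "adj p a" "adj a c" using three(4,5) w_one b by auto
      moreover have "{p, a} \<in> S" using three(1) p \<open>adj a c\<close> not_adj_c by auto
      moreover have "a < s" using \<open>adj a c\<close> by (simp add: gadget_adj_def split: if_splits)
      ultimately show ?thesis by blast
    qed
  qed
  then obtain z where z: "\<And>p. s \<le> p \<Longrightarrow> p < c \<Longrightarrow>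
      {p, z p} \<in> S \<and> (z p = c \<or> z p < s \<and> adj p (z p))" by metis
  define F where "F = (\<lambda>p. {p, z p}) ` {s..<c}"
  \<comment> \<open>The partner of a copy is the center or a leaf. Thus different copies use
    different edges of \<open>S\<close>, and at most \<open>m * m\<close> edges of \<open>S\<close>
    are left over.\<close>
  have z_notin: "\<not> (s \<le> z p \<and> z p < c)" if "s \<le> p" "p < c" for p
    using z[OF that] by auto
  have "inj_on (\<lambda>p. {p, z p}) {s..<c}"
    using z_notin unfolding inj_on_def by (auto simp: doubleton_eq_iff)
  then have "card F = m * (2 * (m * m) + 1)"
    unfolding F_def using card_P by (simp add: card_image)
  moreover have "F \<subseteq> S" unfolding F_def using z by auto
  ultimately have "card (S - F) \<le> m * m"
    using S(2) finS unfolding budget_def by (simp add: card_Diff_subset finite_subset)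
  then have extra: "card (\<Union>(S - F)) \<le> 2 * (m * m)" "finite (\<Union>(S - F))"
    using touched[of "S - F"] by auto
  \<comment> \<open>The left-over edges touch at most \<open>2 * (m * m)\<close> vertices, one less
    than the number of copies of a color.\<close>
  have "\<exists>p. s \<le> p \<and> p < c \<and> col p = i \<and> p \<notin> \<Union>(S - F)" if "i < m" for i
  proof (rule ccontr)
    assume "\<not> ?thesis"
    then have "{p. s \<le> p \<and> p < c \<and> col p = i} \<subseteq> \<Union>(S - F)" by blast
    then have "card {p. s \<le> p \<and> p < c \<and> col p = i} \<le> 2 * (m * m)"
      using extra card_mono order_trans by metis
    then show False using copies[OF that] by simp
  qed
  then obtain P where P: "\<And>i. i < m \<Longrightarrow> s \<le> P i \<and> P i < c \<and> col (P i) = i \<and> P i \<notin> \<Union>(S - F)"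
    by metis
  \<comment> \<open>An edge of \<open>F\<close> at \<open>P i\<close> belongs to the copy
    \<open>P i\<close> itself, as partners are never copies. So an untouched copy has exactly one
    neighbor.\<close>
  have nb: "a = z (P i)" if "i < m" "{P i, a} \<in> G \<union> S" for i a
  proof -
    have "{P i, a} \<notin> G" using P[OF that(1)] by auto
    then have "{P i, a} \<in> S" using that(2) by blast
    then have "{P i, a} \<in> F" using P[OF that(1)] by blast
    then obtain p where "s \<le> p" "p < c" "{P i, a} = {p, z p}" unfolding F_def by auto
    then show ?thesis using P[OF that(1)] z_notin[of p] by (auto simp: doubleton_eq_iff)
  qed
  have main: "z (P i) < s \<and> col (z (P i)) = i \<and> A (z (P i)) (z (P j))"
    if ij: "i < m" "j < m" "i \<noteq> j" for i j
  proof -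
    note Pi = P[OF ij(1)] and Pj = P[OF ij(2)]
    have ne: "P i \<noteq> P j" using Pi Pj ij by auto
    have "adj (P i) (P j)" using Pi Pj ij ne by (auto simp: gadget_adj_def)
    from edge[OF this] ne no_loop show ?thesis
    proof (cases rule: short_walk_cases)
      case one
      then show ?thesis using nb[of i "P j"] ij z_notin[of "P i"] Pi Pj by auto
    next
      case (two a)
      then have a: "a = z (P i)" "a = z (P j)"
        using nb[of i a] nb[of j a] ij by (auto simp: insert_commute)
      consider "a = c" | "a < s" "adj (P i) a" "adj (P j) a"
        using z[of "P i"] z[of "P j"] a Pi Pj s_le_c by fastforce
      then show ?thesis
      proof cases
        case 1
        \<comment> \<open>Copies are not adjacent to the center, so both steps cost at least
          2.\<close>
        then have "2 + 2 \<le> ?w (P i) a + ?w a (P j)"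
          using not_adj_c Pi Pj by (intro add_mono w_nonadj) auto
        then have "(2 + 2 :: enat) \<le> 3" using two(3) order_trans by blast
        then show ?thesis by (simp add: numeral_eq_enat)
      next
        case 2
        \<comment> \<open>A common leaf would have the colors of both copies.\<close>
        then show ?thesis using Pi Pj ij by (auto simp: gadget_adj_def split: if_splits)
      qed
    next
      case (three a b)
      then have ab: "a = z (P i)" "b = z (P j)"
        using nb[of i a] nb[of j b] ij by (auto simp: insert_commute)
      have adj: "adj (P i) a" "adj a b" "adj b (P j)" using three w_one by auto
      have "a < s" "b < s" 
        using z[of "P i"] z[of "P j"] ab Pi Pj adj not_adj_c by auto
      then show ?thesis using adj Pi Pj ab s_le_c by (auto simp: gadget_adj_def split: if_splits)
    qed
  qed
  show ?thesis
  proof (rule that[of "\<lambda>i. z (P i)"])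
    fix i assume "i < m"
    \<comment> \<open>\<open>main\<close> speaks of a pair of colors, so a single color needs a
      partner.\<close>
    moreover obtain j where "j < m" "i \<noteq> j"
      using two_colors by (metis less_le_trans one_less_numeral_iff pos2 semiring_norm(76) zero_neq_one)
    ultimately show "z (P i) < s \<and> col (z (P i)) = i" using main by blast
  next
    fix i j assume "i < m" "j < m" "i \<noteq> j"
    then show "A (z (P i)) (z (P j))" using main by blast
  qed
qed

lemma augmentation_iff_clique:
  "(\<exists>S \<subseteq> all_edges (c + 1) - G. card S \<le> budget \<and> dilation_at_most 3 (c + 1) (G \<union> S) \<Gamma>) \<longleftrightarrow>
   (\<exists>u. (\<forall>i<m. u i < s \<and> col (u i) = i) \<and> (\<forall>i<m. \<forall>j<m. i \<noteq> j \<longrightarrow> A (u i) (u j)))"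
proof
  assume "\<exists>S \<subseteq> all_edges (c + 1) - G. card S \<le> budget \<and> dilation_at_most 3 (c + 1) (G \<union> S) \<Gamma>"
  then obtain u where "\<And>i. i < m \<Longrightarrow> u i < s \<and> col (u i) = i"
    "\<And>i j. i < m \<Longrightarrow> j < m \<Longrightarrow> i \<noteq> j \<Longrightarrow> A (u i) (u j)"
    using augmentation_imp_clique by metis
  then show "\<exists>u. (\<forall>i<m. u i < s \<and> col (u i) = i) \<and> (\<forall>i<m. \<forall>j<m. i \<noteq> j \<longrightarrow> A (u i) (u j))"
    by blast
next
  assume "\<exists>u. (\<forall>i<m. u i < s \<and> col (u i) = i) \<and> (\<forall>i<m. \<forall>j<m. i \<noteq> j \<longrightarrow> A (u i) (u j))"
  then obtain u where "\<And>i. i < m \<Longrightarrow> u i < s \<and> col (u i) = i"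
    "\<And>i j. i < m \<Longrightarrow> j < m \<Longrightarrow> i \<noteq> j \<Longrightarrow> A (u i) (u j)"
    by blast
  then show "\<exists>S \<subseteq> all_edges (c + 1) - G. card S \<le> budget \<and> dilation_at_most 3 (c + 1) (G \<union> S) \<Gamma>"
    by (rule clique_imp_augmentation)
qed

end

section \<open>Circuits of weft 1\<close>

definition indeg :: "nat \<Rightarrow> (nat \<Rightarrow> nat \<Rightarrow> bool) \<Rightarrow> nat \<Rightarrow> nat" where
  "indeg n e i = card {j. j < n \<and> e j i}"

text \<open>Paths with exactly \<open>r\<close> edges, as a recursion on \<open>r\<close> with
  bounded quantifiers: for a fixed \<open>r\<close> it becomes an expression.\<close>

primrec steps :: "nat \<Rightarrow> (nat \<Rightarrow> nat \<Rightarrow> bool) \<Rightarrow> nat \<Rightarrow> nat \<Rightarrow> nat \<Rightarrow> bool" where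
  "steps n e 0 i j \<longleftrightarrow> i = j"
| "steps n e (Suc r) i j \<longleftrightarrow> (\<exists>h<n. e i h \<and> steps n e r h j)"

text \<open>
  Evaluation of a circuit in which the values of the large gates are claimed: \<open>w i j\<close> claims that
  the predecessor \<open>j\<close> decides the gate \<open>i\<close>; without a claim the gate is supposed to be undecided by
  every single predecessor.
\<close>

primrec teval :: "nat \<Rightarrow> (nat \<Rightarrow> bool) \<Rightarrow> (nat \<Rightarrow> nat \<Rightarrow> bool) \<Rightarrow> (nat \<Rightarrow> bool) \<Rightarrow>
    (nat \<Rightarrow> nat \<Rightarrow> bool) \<Rightarrow> nat \<Rightarrow> nat \<Rightarrow> bool" where
  "teval n c e \<alpha> w 0 i \<longleftrightarrow> False"
| "teval n c e \<alpha> w (Suc l) i \<longleftrightarrow>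
     (if indeg n e i = 0 then \<alpha> i
      else if indeg n e i = 1 then \<forall>j<n. e j i \<longrightarrow> \<not> teval n c e \<alpha> w l j
      else if indeg n e i = 2 then
        (if c i then \<forall>j<n. e j i \<longrightarrow> teval n c e \<alpha> w l j
         else \<exists>j<n. e j i \<and> teval n c e \<alpha> w l j)
      else (c i \<longleftrightarrow> \<not> (\<exists>j<n. e j i \<and> w i j)))"

text \<open>The inputs that \<open>teval\<close> reads with the same fuel. It never looks below a
  large gate, whose value comes from the claims, so it branches at most twice per level and there
  are at most \<open>2 ^ l\<close> of them.\<close>

primrec cone :: "nat \<Rightarrow> (nat \<Rightarrow> nat \<Rightarrow> bool) \<Rightarrow> nat \<Rightarrow> nat \<Rightarrow> nat set" where
  "cone n e 0 i = {}"
| "cone n e (Suc l) i =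
     (if indeg n e i = 0 then {i}
      else if indeg n e i \<le> 2 then \<Union>j\<in>{j. j < n \<and> e j i}. cone n e l j else {})"

text \<open>Only these gates can influence the output when the depth is at most
  \<open>d\<close>.\<close>

definition live :: "nat \<Rightarrow> (nat \<Rightarrow> nat \<Rightarrow> bool) \<Rightarrow> nat \<Rightarrow> nat \<Rightarrow> bool" where
  "live n e d g \<longleftrightarrow> 2 < indeg n e g \<and> (\<exists>r\<in>{..d}. steps n e r g (n - 1))"

text \<open>\<open>P\<close> marks the inputs at which \<open>\<alpha>\<close> is trusted; a
  condition is imposed only if the cone it reads is trusted. The value that decides a gate
  \<open>g\<close> is \<open>\<not> c g\<close>: false for a conjunction, true for a disjunction. A
  claimed predecessor must have it, and at a gate without a claim no predecessor may have
  it.\<close>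

definition claims_ok :: "nat \<Rightarrow> (nat \<Rightarrow> bool) \<Rightarrow> (nat \<Rightarrow> nat \<Rightarrow> bool) \<Rightarrow> nat \<Rightarrow>
    (nat \<Rightarrow> bool) \<Rightarrow> (nat \<Rightarrow> bool) \<Rightarrow> (nat \<Rightarrow> nat \<Rightarrow> bool) \<Rightarrow> bool" where
  "claims_ok n c e d P \<alpha> w \<longleftrightarrow>
     ((\<forall>x\<in>cone n e (Suc d) (n - 1). P x) \<longrightarrow> teval n c e \<alpha> w (Suc d) (n - 1)) \<and>
     (\<forall>g<n. \<forall>j<n. live n e d g \<and> e j g \<and> (\<forall>x\<in>cone n e (Suc d) j. P x) \<longrightarrow>
        (w g j \<longrightarrow> (teval n c e \<alpha> w (Suc d) j \<longleftrightarrow> \<not> c g)) \<and>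
        (\<not> (\<exists>i<n. e i g \<and> w g i) \<longrightarrow> (teval n c e \<alpha> w (Suc d) j \<longleftrightarrow> c g)))"

lemma teval_cong:
  "(\<And>x. x \<in> cone n e l i \<Longrightarrow> \<alpha> x = \<alpha>' x) \<Longrightarrow> teval n c e \<alpha> w l i = teval n c e \<alpha>' w l i"
proof (induction l arbitrary: i)
  case (Suc l)
  consider "indeg n e i = 0" | "indeg n e i \<in> {1, 2}" | "indeg n e i > 2" by force
  then show ?case
  proof cases
    case 2
    have "teval n c e \<alpha> w l j = teval n c e \<alpha>' w l j" if "j < n" "e j i" for j
    proof (rule Suc.IH)
      fix x assume "x \<in> cone n e l j"
      then have "x \<in> cone n e (Suc l) i" using that 2 by auto
      then show "\<alpha> x = \<alpha>' x" by (rule Suc.prems)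
    qed
    then show ?thesis using 2 by auto
  qed (use Suc.prems in auto)
qed simp

lemma cone_bound: "finite (cone n e l i) \<and> card (cone n e l i) \<le> 2 ^ l"
proof (induction l arbitrary: i)
  case (Suc l)
  let ?J = "{j. j < n \<and> e j i}"
  have "card (\<Union>j\<in>?J. cone n e l j) \<le> 2 ^ Suc l" if "card ?J \<le> 2"
  proof -
    have "card (\<Union>j\<in>?J. cone n e l j) \<le> (\<Sum>j\<in>?J. card (cone n e l j))"
      by (rule card_UN_le) simp
    also have "\<dots> \<le> (\<Sum>j\<in>?J. 2 ^ l)" by (intro sum_mono) (use Suc in blast)
    also have "\<dots> = card ?J * 2 ^ l" by simp
    also have "\<dots> \<le> 2 * 2 ^ l" using that by (rule mult_right_mono) simp
    finally show ?thesis by simp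
  qed
  then show ?case using Suc by (auto simp: indeg_def)
qed simp

lemma cone_subset: "i < n \<Longrightarrow> cone n e l i \<subseteq> {x. x < n \<and> indeg n e x = 0}"
  by (induction l arbitrary: i) (auto split: if_splits)

text \<open>Two different large gates on one path to the output, that is, weft above 1. If the depth
  is at most \<open>d\<close>, the bounds on \<open>r\<close> and \<open>r'\<close> lose
  nothing.\<close>

definition deep :: "nat \<Rightarrow> (nat \<Rightarrow> nat \<Rightarrow> bool) \<Rightarrow> nat \<Rightarrow> bool" where
  "deep n e d \<longleftrightarrow> (\<exists>r\<in>{..d}. \<exists>r'\<in>{..d}. \<exists>i<n. \<exists>j<n. 2 < indeg n e i \<and> 2 < indeg n e j \<and>
     steps n e (Suc r) i j \<and> steps n e r' j (n - 1))"

section \<open>Depth, weft and live gates of a circuit\<close>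

locale graded_circuit =
  fixes n :: nat and c :: "nat \<Rightarrow> bool" and e :: "nat \<Rightarrow> nat \<Rightarrow> bool"
  assumes pos: "0 < n" and edge: "\<And>i j. e i j \<Longrightarrow> i < j \<and> j < n"
begin

abbreviation E :: "(nat \<times> nat) set" where "E \<equiv> {(i, j). e i j}"
abbreviation C :: "nat set" where "C \<equiv> {i. i < n \<and> c i}"

lemma circuit: "circuit n C E"
  using pos edge by (auto simp: circuit_def)

lemma preds_eq: "preds E i = {j. j < n \<and> e j i}"
  using edge by (auto simp: preds_def dest: less_trans)

lemma card_preds: "card (preds E i) = indeg n e i"
  by (simp add: preds_eq indeg_def)

lemma finite_preds: "finite (preds E i)"
  by (simp add: preds_eq)

lemma inputs_eq: "inputs n E = {i. i < n \<and> indeg n e i = 0}"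
  using finite_preds by (auto simp: inputs_def card_preds[symmetric])

lemma steps_iff_relpow: "steps n e r i j \<longleftrightarrow> (i, j) \<in> E ^^ r"
proof (induction r arbitrary: i)
  case (Suc r)
  show ?case
  proof
    assume "steps n e (Suc r) i j"
    then obtain h where "(i, h) \<in> E" "(h, j) \<in> E ^^ r" using Suc by auto
    then show "(i, j) \<in> E ^^ Suc r" by (rule relpow_Suc_I2)
  next
    assume "(i, j) \<in> E ^^ Suc r"
    then obtain h where "(i, h) \<in> E" "(h, j) \<in> E ^^ r" by (rule relpow_Suc_E2)
    then show "steps n e (Suc r) i j" using Suc edge by auto
  qed
qed auto

lemma relpow_less: "(i, j) \<in> E ^^ r \<Longrightarrow> j < n \<Longrightarrow> i < n"
proof (induction r arbitrary: i)
  case (Suc r)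
  from Suc.prems(1) obtain h where "(i, h) \<in> E" "(h, j) \<in> E ^^ r" by (rule relpow_Suc_E2)
  then show ?case using Suc.IH[of h] Suc.prems(2) edge[of i h] by force
qed simp

lemma relpow_iff_path:
  "(i, j) \<in> E ^^ r \<longleftrightarrow>
     (\<exists>p. length p = Suc r \<and> hd p = i \<and> last p = j \<and> successively (\<lambda>i j. (i, j) \<in> E) p)"
proof (induction r arbitrary: i)
  case 0
  show ?case
  proof
    assume "(i, j) \<in> E ^^ 0"
    then show "\<exists>p. length p = Suc 0 \<and> hd p = i \<and> last p = j \<and> successively (\<lambda>i j. (i, j) \<in> E) p"
      by (intro exI[of _ "[i]"]) auto
  next
    assume "\<exists>p. length p = Suc 0 \<and> hd p = i \<and> last p = j \<and> successively (\<lambda>i j. (i, j) \<in> E) p"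
    then show "(i, j) \<in> E ^^ 0" by (auto simp: length_Suc_conv)
  qed
next
  case (Suc r)
  show ?case
  proof
    assume "(i, j) \<in> E ^^ Suc r"
    then obtain h where h: "(i, h) \<in> E" "(h, j) \<in> E ^^ r" by (rule relpow_Suc_E2)
    then obtain p where "length p = Suc r" "hd p = h" "last p = j"
      "successively (\<lambda>i j. (i, j) \<in> E) p" using Suc by blast
    then show "\<exists>p. length p = Suc (Suc r) \<and> hd p = i \<and> last p = j \<and>
        successively (\<lambda>i j. (i, j) \<in> E) p"
      using h(1) by (intro exI[of _ "i # p"]) (auto simp: successively_Cons)
  next
    assume "\<exists>p. length p = Suc (Suc r) \<and> hd p = i \<and> last p = j \<and>
        successively (\<lambda>i j. (i, j) \<in> E) p"
    then obtain h p where "length (h # p) = Suc r" "last (h # p) = j" "(i, h) \<in> E"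
      "successively (\<lambda>i j. (i, j) \<in> E) (h # p)"
      by (auto simp: length_Suc_conv)
    moreover from this have "(h, j) \<in> E ^^ r" using Suc[of h] by (metis list.sel(1))
    ultimately show "(i, j) \<in> E ^^ Suc r" by (metis relpow_Suc_I2)
  qed
qed

text \<open>Wires lead to larger numbers, so going back along them ends in an input. Any path to the
  output therefore extends backwards to one that \<open>circuit_path\<close> admits.\<close>

lemma path_from_input:
  assumes "i < n"
  obtains p where "p \<noteq> []" "hd p \<in> inputs n E" "last p = i" "successively (\<lambda>i j. (i, j) \<in> E) p"
  using assms
proof (induction i arbitrary: thesis rule: less_induct)
  case (less i)
  show thesis
  proof (cases "preds E i = {}")
    case True
    then show ?thesis using less(2)[of "[i]"] less(3) by (auto simp: inputs_def)
  next
    case False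
    then obtain j where j: "e j i" by (auto simp: preds_def)
    then have "j < i" "j < n" using edge[OF j] by auto
    from less(1)[OF this(1) _ this(2)] obtain p where p: "p \<noteq> []" "hd p \<in> inputs n E"
      "last p = j" "successively (\<lambda>i j. (i, j) \<in> E) p" by blast
    then show ?thesis using j by (intro less(2)[of "p @ [i]"]) (auto simp: successively_append_iff)
  qed
qed

text \<open>A path that is too long contains one with exactly \<open>Suc d\<close> edges to the
  output, and conversely such a path extends back to an input. This removes the quantifier over
  paths of unbounded length.\<close>

lemma depth_iff:
  "depth_at_most n E d \<longleftrightarrow> \<not> (\<exists>i<n. steps n e (Suc d) i (n - 1))"
proof
  assume depth: "depth_at_most n E d"
  show "\<not> (\<exists>i<n. steps n e (Suc d) i (n - 1))"
  proof
    assume "\<exists>i<n. steps n e (Suc d) i (n - 1)"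
    then obtain i p where i: "i < n" and p: "length p = Suc (Suc d)" "hd p = i" "last p = n - 1"
      "successively (\<lambda>i j. (i, j) \<in> E) p"
      unfolding steps_iff_relpow relpow_iff_path by blast
    obtain q where q: "q \<noteq> []" "hd q \<in> inputs n E" "last q = i"
      "successively (\<lambda>i j. (i, j) \<in> E) q" using path_from_input[OF i] by blast
    obtain r where r: "p = i # r" "r \<noteq> []" using p by (cases p; cases "tl p") auto
    have "circuit_path n E (q @ r)"
      using p q r by (auto simp: circuit_path_def successively_append_iff successively_Cons)
    then have "length (q @ r) - 1 \<le> d" using depth by (auto simp: depth_at_most_def)
    then show False using q(1) r p(1) by (cases q) auto
  qed
next
  assume no: "\<not> (\<exists>i<n. steps n e (Suc d) i (n - 1))"
  show "depth_at_most n E d"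
    unfolding depth_at_most_def
  proof (intro allI impI, rule ccontr)
    fix p assume p: "circuit_path n E p" "\<not> length p - 1 \<le> d"
    \<comment> \<open>The last \<open>Suc d\<close> edges of the path.\<close>
    define q where "q = drop (length p - Suc (Suc d)) p"
    have len: "length q = Suc (Suc d)" using p by (auto simp: q_def)
    have "last q = n - 1" using p len by (auto simp: circuit_path_def q_def)
    moreover have "successively (\<lambda>i j. (i, j) \<in> E) (take (length p - Suc (Suc d)) p @ q)"
      using p by (simp add: circuit_path_def q_def)
    then have succ: "successively (\<lambda>i j. (i, j) \<in> E) q"
      by (simp add: successively_append_iff)
    ultimately have "steps n e (Suc d) (hd q) (n - 1)"
      unfolding steps_iff_relpow relpow_iff_path using len by blast
    moreover have "hd q < n"
      using succ len edge by (cases q; cases "tl q") (auto dest: less_trans)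
    ultimately show False using no by blast
  qed
qed

lemma steps_le_depth:
  assumes "depth_at_most n E d" "(i, n - 1) \<in> E ^^ r"
  shows "r \<le> d"
proof (rule ccontr)
  assume "\<not> r \<le> d"
  then obtain r' where r': "r = r' + Suc d" by (metis add.commute le_add_diff_inverse not_less_eq_eq)
  then obtain h where h: "(h, n - 1) \<in> E ^^ Suc d"
    using assms(2) unfolding r' relpow_add by blast
  then have "h < n" by (rule relpow_less) (use pos in simp)
  then show False using h assms(1) unfolding depth_iff steps_iff_relpow by blast
qed

text \<open>Two large gates on a path cut out the two segments that \<open>deep\<close> asks for;
  conversely, a path from an input is put in front of these segments.\<close>

lemma weft_iff:
  assumes depth: "depth_at_most n E d"
  shows "weft_at_most n E 1 \<longleftrightarrow> \<not> deep n e d"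
proof
  assume weft: "weft_at_most n E 1"
  show "\<not> deep n e d"
  proof
    assume "deep n e d"
    then obtain r r' i j where *: "i < n" "2 < indeg n e i" "2 < indeg n e j"
      "(i, j) \<in> E ^^ Suc r" "(j, n - 1) \<in> E ^^ r'"
      unfolding deep_def steps_iff_relpow by blast
    obtain p where p: "length p = Suc (Suc r)" "hd p = i" "last p = j"
      "successively (\<lambda>i j. (i, j) \<in> E) p" using *(4) unfolding relpow_iff_path by blast
    obtain p' where p': "length p' = Suc r'" "hd p' = j" "last p' = n - 1"
      "successively (\<lambda>i j. (i, j) \<in> E) p'" using *(5) unfolding relpow_iff_path by blast
    obtain q where q: "q \<noteq> []" "hd q \<in> inputs n E" "last q = i"
      "successively (\<lambda>i j. (i, j) \<in> E) q" using path_from_input[OF *(1)] by blast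
    obtain s where s: "p = i # s" "s \<noteq> []" using p by (cases p; cases "tl p") auto
    obtain s' where s': "p' = j # s'" using p' by (cases p') auto
    have "circuit_path n E (q @ s @ s')"
      using p p' q s s' by (cases s') (auto simp: circuit_path_def successively_append_iff successively_Cons)
    then have "length (filter (\<lambda>i. card (preds E i) > 2) (q @ s @ s')) \<le> 1"
      using weft by (auto simp: weft_at_most_def)
    moreover have "i \<in> set (filter (\<lambda>i. card (preds E i) > 2) q)"
      using q * last_in_set[of q] by (auto simp: card_preds)
    moreover have "j \<in> set (filter (\<lambda>i. card (preds E i) > 2) s)"
      using s p * last_in_set[of s] by (auto simp: card_preds)
    ultimately show False
      by (cases "filter (\<lambda>i. card (preds E i) > 2) q"; cases "filter (\<lambda>i. card (preds E i) > 2) s") auto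
  qed
next
  assume no: "\<not> deep n e d"
  show "weft_at_most n E 1"
    unfolding weft_at_most_def
  proof (intro allI impI, rule ccontr)
    let ?L = "\<lambda>i. card (preds E i) > 2"
    fix p assume p: "circuit_path n E p" "\<not> length (filter ?L p) \<le> 1"
    then obtain i j rest where f: "filter ?L p = i # j # rest"
      by (cases "filter ?L p"; cases "tl (filter ?L p)") auto
    from filter_eq_ConsD[OF f] obtain us vs where p1: "p = us @ i # vs" "?L i" "j # rest = filter ?L vs"
      by auto
    from filter_eq_ConsD[OF p1(3)[symmetric]] obtain us' vs' where
      p2: "vs = us' @ j # vs'" "?L j" by auto
    have succ: "successively (\<lambda>i j. (i, j) \<in> E) (us @ (i # us') @ j # vs')"
      and last: "last (j # vs') = n - 1"
      using p(1) p1 p2 by (auto simp: circuit_path_def)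
    have "successively (\<lambda>i j. (i, j) \<in> E) ((us @ i # us') @ (j # vs'))"
      "successively (\<lambda>i j. (i, j) \<in> E) (us @ ((i # us' @ [j]) @ vs'))"
      using succ by simp_all
    then have succ1: "successively (\<lambda>i j. (i, j) \<in> E) ((i # us' @ [j]) @ vs')"
      "successively (\<lambda>i j. (i, j) \<in> E) (j # vs')"
      unfolding successively_append_iff by blast+
    have "successively (\<lambda>i j. (i, j) \<in> E) (i # us' @ [j])"
      using succ1(1) unfolding successively_append_iff by blast
    then have 1: "(i, j) \<in> E ^^ Suc (length us')"
      unfolding relpow_iff_path by (intro exI[of _ "i # us' @ [j]"]) auto
    have 2: "(j, n - 1) \<in> E ^^ length vs'"
      unfolding relpow_iff_path using succ1 last by (intro exI[of _ "j # vs'"]) auto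
    \<comment> \<open>Both segments lie on one path to the output, so the depth bounds both lengths
      by \<open>d\<close>.\<close>
    have "(i, n - 1) \<in> E ^^ (Suc (length us') + length vs')"
      using 1 2 unfolding relpow_add by blast
    from steps_le_depth[OF depth this] have "length us' \<le> d" "length vs' \<le> d" by auto
    moreover have "i < n" "j < n"
      using relpow_less[OF 1] relpow_less[OF 2] pos by auto
    ultimately show False using no 1 2 p1(2) p2(2)
      unfolding deep_def steps_iff_relpow card_preds by (metis atMost_iff)
  qed
qed


text \<open>Nodes from which \<open>l\<close> wires lead to the output such that every later node
  has indegree at most 2. Going backwards from the output, such a search at most doubles per
  level.\<close>

primrec level :: "nat \<Rightarrow> nat set" where
  "level 0 = {n - 1}"
| "level (Suc l) = {g. g < n \<and> (\<exists>h\<in>level l. e g h \<and> indeg n e h \<le> 2)}"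

lemma level_bound: "finite (level l) \<and> card (level l) \<le> 2 ^ l"
proof (induction l)
  case (Suc l)
  let ?H = "{h \<in> level l. indeg n e h \<le> 2}"
  have fin: "finite ?H" using Suc by simp
  have eq: "level (Suc l) = (\<Union>h\<in>?H. {g. g < n \<and> e g h})" by auto
  have "card (level (Suc l)) \<le> (\<Sum>h\<in>?H. card {g. g < n \<and> e g h})"
    unfolding eq by (rule card_UN_le[OF fin])
  also have "\<dots> \<le> (\<Sum>h\<in>?H. 2)" by (rule sum_mono) (simp add: indeg_def)
  also have "\<dots> \<le> 2 * card (level l)" using Suc by (simp add: card_mono)
  also have "\<dots> \<le> 2 ^ Suc l" using Suc by simp
  finally show ?case by simp
qed simp

lemma in_level:
  assumes "steps n e l g (n - 1)" "g < n"
    and "\<And>r r' h. Suc r + r' = l \<Longrightarrow> h < n \<Longrightarrow> steps n e (Suc r) g h \<Longrightarrow> steps n e r' h (n - 1) \<Longrightarrow>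
      indeg n e h \<le> 2"
  shows "g \<in> level l"
  using assms
proof (induction l arbitrary: g)
  case (Suc l)
  then obtain h where h: "h < n" "e g h" "steps n e l h (n - 1)" by auto
  have "h \<in> level l"
  proof (rule Suc.IH)
    fix r r' h' assume *: "Suc r + r' = l" "h' < n" "steps n e (Suc r) h h'" "steps n e r' h' (n - 1)"
    have "steps n e (Suc (Suc r)) g h'"
      unfolding steps.simps(2)[of n e "Suc r"] using h *(3) by blast
    then show "indeg n e h' \<le> 2" using Suc.prems(3)[of "Suc r" r' h'] * by simp
  qed (use h in auto)
  moreover have "indeg n e h \<le> 2" using Suc.prems(3)[of 0 l h] h by auto
  ultimately show ?case using h Suc.prems by auto
qed auto

text \<open>Weft 1 forbids a second large gate between a live gate and the output, so live gates lie
  in the levels up to \<open>d\<close>, which have at most \<open>1 + 2 + ... + 2 ^ d\<close>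
  elements.\<close>

lemma card_live:
  assumes "\<not> deep n e d"
  shows "card {g. g < n \<and> live n e d g} \<le> 2 ^ Suc d"
proof -
  have "{g. g < n \<and> live n e d g} \<subseteq> (\<Union>l\<in>{..d}. level l)"
  proof
    fix g assume "g \<in> {g. g < n \<and> live n e d g}"
    then obtain r where g: "g < n" "2 < indeg n e g" "r \<le> d" "steps n e r g (n - 1)"
      by (auto simp: live_def)
    have "g \<in> level r"
    proof (rule in_level[OF g(4,1)])
      fix s s' h assume "Suc s + s' = r" "h < n" "steps n e (Suc s) g h" "steps n e s' h (n - 1)"
      moreover from this have "s \<in> {..d}" "s' \<in> {..d}" using g(3) by auto
      ultimately show "indeg n e h \<le> 2" using assms g(1,2) unfolding deep_def by (meson not_le)
    qed
    then show "g \<in> (\<Union>l\<in>{..d}. level l)" using g by auto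
  qed
  then have "card {g. g < n \<and> live n e d g} \<le> card (\<Union>l\<in>{..d}. level l)"
    by (rule card_mono[rotated]) (use level_bound in auto)
  also have "\<dots> \<le> (\<Sum>l\<in>{..d}. card (level l))" by (rule card_UN_le) simp
  also have "\<dots> \<le> (\<Sum>l\<in>{..d}. 2 ^ l)" by (rule sum_mono) (use level_bound in blast)
  also have "\<dots> \<le> 2 ^ Suc d" by (induction d) auto
  finally show ?thesis .
qed

section \<open>Valuations versus claims\<close>

lemma valuation_iff:
  "valuation n C E v \<longleftrightarrow> (\<forall>i<n.
     (indeg n e i = 1 \<longrightarrow> (v i \<longleftrightarrow> (\<forall>j<n. e j i \<longrightarrow> \<not> v j))) \<and>
     (2 \<le> indeg n e i \<longrightarrow>
       (v i \<longleftrightarrow> (if c i then \<forall>j<n. e j i \<longrightarrow> v j else \<exists>j<n. e j i \<and> v j))))"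
  unfolding valuation_def card_preds unfolding preds_eq by (intro all_cong) auto

lemma valuation_exists:
  "\<exists>v. valuation n C E v \<and> (\<forall>i<n. indeg n e i = 0 \<longrightarrow> (v i \<longleftrightarrow> i \<in> X))"
proof -
  let ?spec = "\<lambda>v i. (indeg n e i = 0 \<longrightarrow> (v i \<longleftrightarrow> i \<in> X)) \<and>
     (indeg n e i = 1 \<longrightarrow> (v i \<longleftrightarrow> (\<forall>j<n. e j i \<longrightarrow> \<not> v j))) \<and>
     (2 \<le> indeg n e i \<longrightarrow>
       (v i \<longleftrightarrow> (if c i then \<forall>j<n. e j i \<longrightarrow> v j else \<exists>j<n. e j i \<and> v j)))"
  have "\<exists>v. \<forall>i<k. ?spec v i" for k
  proof (induction k)
    case (Suc k)
    then obtain v where v: "\<forall>i<k. ?spec v i" by blast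
    define b where "b \<longleftrightarrow> (if indeg n e k = 0 then k \<in> X
      else if indeg n e k = 1 then \<forall>j<n. e j k \<longrightarrow> \<not> v j
      else if c k then \<forall>j<n. e j k \<longrightarrow> v j else \<exists>j<n. e j k \<and> v j)"
    \<comment> \<open>Predecessors of nodes up to \<open>k\<close> are below \<open>k\<close>, so
      the new value disturbs none of the conditions met so far.\<close>
    have upd: "(v(k := b)) j = v j" if "e j i" "i \<le> k" for i j
      using edge[OF that(1)] that(2) by auto
    have preds: "(\<forall>j<n. e j i \<longrightarrow> \<not> (v(k := b)) j) \<longleftrightarrow> (\<forall>j<n. e j i \<longrightarrow> \<not> v j)"
      "(\<forall>j<n. e j i \<longrightarrow> (v(k := b)) j) \<longleftrightarrow> (\<forall>j<n. e j i \<longrightarrow> v j)"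
      "(\<exists>j<n. e j i \<and> (v(k := b)) j) \<longleftrightarrow> (\<exists>j<n. e j i \<and> v j)" if "i \<le> k" for i
      using upd[OF _ that] by metis+
    have "?spec (v(k := b)) i" if "i < Suc k" for i
    proof (cases "i = k")
      case True
      have "(v(k := b)) i = b" using True by simp
      then show ?thesis unfolding preds[OF that[unfolded less_Suc_eq_le]]
        using b_def True by simp
    next
      case False
      then have "?spec v i" "(v(k := b)) i = v i" using that v by auto
      then show ?thesis unfolding preds[OF that[unfolded less_Suc_eq_le]] by simp
    qed
    then show ?case by (intro exI[of _ "v(k := b)"] allI impI)
  qed simp
  from this[of n] obtain v where v: "\<forall>i<n. ?spec v i" by (elim exE)
  show ?thesis unfolding valuation_iff
    by (intro exI[of _ v] conjI allI impI; use v in \<open>blast\<close>)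
qed

text \<open>At distance \<open>r\<close> from the output the fuel is at least
  \<open>Suc d - r\<close>. Each descent lowers the fuel and raises \<open>r\<close> by 1, and
  \<open>r \<le> d\<close>, so the fuel never runs out. The premise on a gate \<open>g\<close> may
  assume that its predecessors are evaluated correctly, so that checking claims against
  \<open>teval\<close> is enough to verify them.\<close>

lemma teval_eq_valuation:
  assumes depth: "depth_at_most n E d" and v: "valuation n C E v"
    and inp: "\<And>i. i < n \<Longrightarrow> indeg n e i = 0 \<Longrightarrow> \<alpha> i = v i"
    and claims: "\<And>g. g < n \<Longrightarrow> live n e d g \<Longrightarrow>
      (\<And>j. j < n \<Longrightarrow> e j g \<Longrightarrow> teval n c e \<alpha> w (Suc d) j = v j) \<Longrightarrow>
      (\<exists>j<n. e j g \<and> w g j) \<longleftrightarrow> (v g \<longleftrightarrow> \<not> c g)"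
    and "(i, n - 1) \<in> E ^^ r" "Suc d \<le> l + r"
  shows "teval n c e \<alpha> w l i = v i"
  using assms(5,6)
proof (induction i arbitrary: l r rule: less_induct)
  case (less i)
  have r: "r \<le> d" using steps_le_depth[OF depth less.prems(1)] .
  then obtain l' where l: "l = Suc l'" using less.prems(2) by (cases l) auto
  have i: "i < n" using relpow_less[OF less.prems(1)] pos by simp
  have IH: "teval n c e \<alpha> w l'' j = v j" if "e j i" "Suc d \<le> l'' + Suc r" for j l''
    using that edge[OF that(1)] less.prems(1)
    by (intro less.IH[of _ "Suc r"]) (auto intro: relpow_Suc_I2 simp del: relpow.simps)
  note vi = v[unfolded valuation_iff, rule_format, OF i]
  consider "indeg n e i = 0" | "indeg n e i = 1" | "indeg n e i = 2" | "2 < indeg n e i" by linarith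
  then show ?case
  proof cases
    case 1
    then show ?thesis using inp i l by simp
  next
    case 2
    have "teval n c e \<alpha> w l' j = v j" if "e j i" for j
      using IH[OF that, of l'] less.prems(2) l by simp
    then show ?thesis using vi 2 l by auto
  next
    case 3
    have "teval n c e \<alpha> w l' j = v j" if "e j i" for j
      using IH[OF that, of l'] less.prems(2) l by simp
    then show ?thesis using vi 3 l by auto
  next
    case 4
    then have "live n e d i"
      using r less.prems(1) by (auto simp: live_def steps_iff_relpow)
    then have "(\<exists>j<n. e j i \<and> w i j) \<longleftrightarrow> (v i \<longleftrightarrow> \<not> c i)"
      using IH[of _ "Suc d"] by (intro claims[OF i]) auto
    then show ?thesis using l 4 by auto
  qed
qed

text \<open>By \<open>card_live\<close>, \<open>2 ^ Suc d\<close> slots suffice for all claims.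
  Listing them by slots rather than as a relation allows a view to store them as finitely many
  numbers; \<open>n + 2\<close> is the common bound for all entries of a view.\<close>

lemma satisfiable_iff_claims:
  assumes depth: "depth_at_most n E d" and weft: "weft_at_most n E 1"
  shows "(\<exists>v. valuation n C E v \<and> v (n - 1) \<and> card {i \<in> inputs n E. v i} = k) \<longleftrightarrow>
    (\<exists>X g h. X \<subseteq> {x. x < n \<and> indeg n e x = 0} \<and> card X = k \<and>
       (\<forall>s. g s < n + 2 \<and> h s < n + 2) \<and>
       claims_ok n c e d (\<lambda>_. True) (\<lambda>x. x \<in> X) (\<lambda>i j. \<exists>s<(2::nat) ^ Suc d. g s = i \<and> h s = j))"
    (is "?L \<longleftrightarrow> ?R")
proof
  assume ?L
  then obtain v where v: "valuation n C E v" "v (n - 1)" "card {i \<in> inputs n E. v i} = k" by blast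
  define X where "X = {i \<in> inputs n E. v i}"
  have X: "X \<subseteq> {x. x < n \<and> indeg n e x = 0}" by (auto simp: X_def inputs_eq)
  define D where "D = {g. g < n \<and> live n e d g \<and> (v g \<longleftrightarrow> \<not> c g)}"
  have large: "2 < indeg n e g" if "live n e d g" for g using that by (simp add: live_def)
  \<comment> \<open>A gate in \<open>D\<close> has its deciding value, so some predecessor has that
    value as well.\<close>
  have "\<exists>j. j < n \<and> e j g \<and> (v j \<longleftrightarrow> \<not> c g)" if "g \<in> D" for g
    using that v(1)[unfolded valuation_iff, rule_format, of g] large[of g]
    by (auto simp: D_def split: if_splits)
  then obtain wit where wit: "\<And>g. g \<in> D \<Longrightarrow> wit g < n \<and> e (wit g) g \<and> (v (wit g) \<longleftrightarrow> \<not> c g)"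
    by metis
  have "card D \<le> card {g. g < n \<and> live n e d g}"
    by (intro card_mono) (auto simp: D_def)
  also have "\<dots> \<le> 2 ^ Suc d" using card_live weft weft_iff[OF depth] by blast
  finally have cardD: "card D \<le> 2 ^ Suc d" .
  have "finite D" by (simp add: D_def)
  then obtain en where en: "bij_betw en {0..<card D} D" using ex_bij_betw_nat_finite by blast
  define g where "g s = (if s < card D then en s else n)" for s
  define h where "h s = (if s < card D then wit (en s) else 0)" for s
  let ?w = "\<lambda>i j. \<exists>s<(2::nat) ^ Suc d. g s = i \<and> h s = j"
  have w: "?w i j \<longleftrightarrow> i \<in> D \<and> j = wit i" if "i < n" for i j
  proof
    assume "?w i j"
    then obtain s where "g s = i" "h s = j" by blast
    then show "i \<in> D \<and> j = wit i"
      using that bij_betwE[OF en] by (auto simp: g_def h_def split: if_splits)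
  next
    assume i: "i \<in> D \<and> j = wit i"
    then have "i \<in> en ` {0..<card D}" using en by (simp add: bij_betw_def)
    then obtain s where "s < card D" "en s = i" by auto
    then show "?w i j" using i cardD by (intro exI[of _ s]) (auto simp: g_def h_def)
  qed
  have enD: "en s \<in> D" if "s < card D" for s using bij_betwE[OF en] that by auto
  have bound: "g s < n + 2 \<and> h s < n + 2" for s
    using enD[of s] wit[of "en s"] by (auto simp: g_def h_def D_def)
  have ev: "teval n c e (\<lambda>x. x \<in> X) ?w l i = v i"
    if "(i, n - 1) \<in> E ^^ r" "Suc d \<le> l + r" for l i r
  proof (rule teval_eq_valuation[OF depth v(1) _ _ that])
    fix i assume "i < n" "indeg n e i = 0"
    then show "(i \<in> X) = v i" by (simp add: X_def inputs_eq)
  next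
    fix g assume "g < n" "live n e d g"
    then show "(\<exists>j<n. e j g \<and> ?w g j) \<longleftrightarrow> (v g \<longleftrightarrow> \<not> c g)"
      using wit[of g] unfolding w[OF \<open>g < n\<close>] by (auto simp: D_def)
  qed
  have "claims_ok n c e d (\<lambda>_. True) (\<lambda>x. x \<in> X) ?w"
    unfolding claims_ok_def
  proof (intro conjI impI allI)
    show "teval n c e (\<lambda>x. x \<in> X) ?w (Suc d) (n - 1)"
      using v(2) by (subst ev[of _ 0]) auto
  next
    fix g j assume gj: "g < n" "j < n" and *: "live n e d g \<and> e j g \<and> (\<forall>x\<in>cone n e (Suc d) j. True)"
    obtain r where r: "(g, n - 1) \<in> E ^^ r" using * by (auto simp: live_def steps_iff_relpow)
    have "(j, n - 1) \<in> E ^^ Suc r" using * r by (intro relpow_Suc_I2[of j g]) auto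
    then have evj: "teval n c e (\<lambda>x. x \<in> X) ?w (Suc d) j = v j" by (rule ev) simp
    show "teval n c e (\<lambda>x. x \<in> X) ?w (Suc d) j \<longleftrightarrow> \<not> c g" if "?w g j"
      using that wit[of g] unfolding w[OF gj(1)] evj by auto
    show "teval n c e (\<lambda>x. x \<in> X) ?w (Suc d) j \<longleftrightarrow> c g" if no: "\<not> (\<exists>i<n. e i g \<and> ?w g i)"
    proof -
      have "g \<notin> D" using no wit[of g] unfolding w[OF gj(1)] by auto
      then have "v g = c g" using gj * by (auto simp: D_def)
      moreover have "v g \<longleftrightarrow> (if c g then \<forall>j<n. e j g \<longrightarrow> v j else \<exists>j<n. e j g \<and> v j)"
        using v(1)[unfolded valuation_iff, rule_format, OF gj(1)] large[of g] * by linarith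
      ultimately show ?thesis using * gj unfolding evj by (metis (full_types))
    qed
  qed
  moreover have "card X = k" using v(3) by (simp add: X_def)
  moreover have "\<forall>s. g s < n + 2 \<and> h s < n + 2" using bound by blast
  ultimately show ?R using X by (intro exI[of _ X] exI[of _ g] exI[of _ h] conjI)
next
  assume ?R
  then obtain X g h where X: "X \<subseteq> {x. x < n \<and> indeg n e x = 0}" "card X = k" and
    ok: "claims_ok n c e d (\<lambda>_. True) (\<lambda>x. x \<in> X) (\<lambda>i j. \<exists>s<(2::nat) ^ Suc d. g s = i \<and> h s = j)" by blast
  define w where "w = (\<lambda>i j. \<exists>s<(2::nat) ^ Suc d. g s = i \<and> h s = j)"
  note ok = ok[folded w_def]
  obtain v where v: "valuation n C E v" "\<forall>i<n. indeg n e i = 0 \<longrightarrow> (v i \<longleftrightarrow> i \<in> X)"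
    using valuation_exists by blast
  have "teval n c e (\<lambda>x. x \<in> X) w (Suc d) (n - 1) = v (n - 1)"
  proof (rule teval_eq_valuation[OF depth v(1), where r = 0])
    fix i assume "i < n" "indeg n e i = 0"
    then show "(i \<in> X) = v i" using v by blast
  next
    fix g assume g: "g < n" "live n e d g"
      and ev: "\<And>j. j < n \<Longrightarrow> e j g \<Longrightarrow> teval n c e (\<lambda>x. x \<in> X) w (Suc d) j = v j"
    have large: "2 < indeg n e g" using g by (simp add: live_def)
    note vg = v(1)[unfolded valuation_iff, rule_format, OF g(1)]
    have chk: "(w g j \<longrightarrow> (v j \<longleftrightarrow> \<not> c g)) \<and> (\<not> (\<exists>i<n. e i g \<and> w g i) \<longrightarrow> (v j \<longleftrightarrow> c g))"
      if "j < n" "e j g" for j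
      using ok[unfolded claims_ok_def] g that ev[OF that] by auto
    show "(\<exists>j<n. e j g \<and> w g j) \<longleftrightarrow> (v g \<longleftrightarrow> \<not> c g)"
    proof
      assume "\<exists>j<n. e j g \<and> w g j"
      then show "v g \<longleftrightarrow> \<not> c g" using chk vg large by auto
    next
      assume "v g \<longleftrightarrow> \<not> c g"
      then show "\<exists>j<n. e j g \<and> w g j" using chk vg large by (auto split: if_splits)
    qed
  qed auto
  then have "v (n - 1)" using ok by (simp add: claims_ok_def)
  moreover have "{i \<in> inputs n E. v i} = X" using X v(2) by (auto simp: inputs_eq)
  ultimately show ?L using v(1) X(2) by blast
qed

end

text \<open>
  A set \<open>X\<close> of \<open>k\<close> numbers below \<open>n\<close> cuts \<open>{0..n}\<close> into the gaps \<open>{a \<tau>..<b \<tau>}\<close> for \<open>\<tau> \<le> k\<close>, where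
  \<open>a\<close> enumerates \<open>0\<close> and the successors of the elements of \<open>X\<close>. Whoever knows the gap around \<open>x + 1\<close>
  knows whether \<open>x \<in> X\<close>.
\<close>

definition gaps :: "nat \<Rightarrow> nat \<Rightarrow> (nat \<Rightarrow> nat) \<Rightarrow> (nat \<Rightarrow> nat) \<Rightarrow> nat set \<Rightarrow> bool" where
  "gaps n k a b X \<longleftrightarrow> a 0 = 0 \<and> b k = n + 1 \<and> (\<forall>\<tau>\<le>k. a \<tau> < b \<tau>) \<and>
     (\<forall>\<tau><k. b \<tau> = a (Suc \<tau>)) \<and> X = {x. \<exists>\<tau>. 1 \<le> \<tau> \<and> \<tau> \<le> k \<and> a \<tau> = Suc x}"

lemma gapsD:
  assumes "gaps n k a b X"
  shows "a 0 = 0" "b k = n + 1" "\<tau> \<le> k \<Longrightarrow> a \<tau> < b \<tau>" "\<tau> < k \<Longrightarrow> b \<tau> = a (Suc \<tau>)"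
  using assms by (simp_all add: gaps_def)

lemma gaps_mono:
  assumes "gaps n k a b X" "\<tau> < \<tau>'" "\<tau>' \<le> k"
  shows "b \<tau> \<le> a \<tau>'"
  using assms(2,3)
proof (induction \<tau>')
  case (Suc \<tau>')
  have *: "b \<tau>' = a (Suc \<tau>')" using Suc.prems by (intro gapsD(4)[OF assms(1)]) simp
  have **: "a \<tau>' < b \<tau>'" using Suc.prems by (intro gapsD(3)[OF assms(1)]) simp
  show ?case
  proof (cases "\<tau> = \<tau>'")
    case False
    then have "b \<tau> \<le> a \<tau>'" using Suc by auto
    then show ?thesis using * ** by simp
  qed (use * in simp)
qed simp

lemma gaps_unique:
  assumes "gaps n k a b X" "\<tau> \<le> k" "\<tau>' \<le> k" "a \<tau> \<le> y" "y < b \<tau>" "a \<tau>' \<le> y" "y < b \<tau>'"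
  shows "\<tau> = \<tau>'"
  using gaps_mono[OF assms(1), of \<tau> \<tau>'] gaps_mono[OF assms(1), of \<tau>' \<tau>] assms
  by (cases \<tau> \<tau>' rule: linorder_cases) auto

text \<open>If \<open>x \<in> X\<close>, some gap starts at \<open>Suc x\<close>, and gaps are
  disjoint, so it is the gap at hand.\<close>

lemma gaps_member:
  assumes "gaps n k a b X" "\<tau> \<le> k" "a \<tau> \<le> Suc x" "Suc x < b \<tau>"
  shows "x \<in> X \<longleftrightarrow> a \<tau> = Suc x"
proof
  assume "x \<in> X"
  then obtain \<tau>' where t: "1 \<le> \<tau>'" "\<tau>' \<le> k" "a \<tau>' = Suc x" using assms(1) by (auto simp: gaps_def)
  then have "Suc x < b \<tau>'" using assms(1) by (auto simp: gaps_def)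
  then have "\<tau> = \<tau>'" using assms t by (intro gaps_unique[OF assms(1), of _ _ "Suc x"]) auto
  then show "a \<tau> = Suc x" using t by simp
next
  assume a: "a \<tau> = Suc x"
  then have "\<tau> \<noteq> 0" using assms(1) by (auto simp: gaps_def intro: ccontr)
  then show "x \<in> X" using assms(1,2) a by (auto simp: gaps_def intro!: exI[of _ \<tau>])
qed

lemma gaps_cover:
  assumes "gaps n k a b X" "x < n"
  obtains \<tau> where "\<tau> \<le> k" "a \<tau> \<le> Suc x" "Suc x < b \<tau>"
proof -
  \<comment> \<open>The last gap that starts at or before \<open>Suc x\<close>; the next one starts
    later, so this one extends beyond \<open>Suc x\<close>.\<close>
  define \<tau> where "\<tau> = (GREATEST \<tau>. \<tau> \<le> k \<and> a \<tau> \<le> Suc x)"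
  have ex: "0 \<le> k \<and> a 0 \<le> Suc x" using assms by (auto simp: gaps_def)
  have t: "\<tau> \<le> k \<and> a \<tau> \<le> Suc x"
    unfolding \<tau>_def using ex by (rule GreatestI_nat[where b = k]) auto
  have "\<not> (Suc \<tau> \<le> k \<and> a (Suc \<tau>) \<le> Suc x)"
  proof
    assume "Suc \<tau> \<le> k \<and> a (Suc \<tau>) \<le> Suc x"
    then have "Suc \<tau> \<le> \<tau>" unfolding \<tau>_def by (rule Greatest_le_nat[where b = k]) auto
    then show False by simp
  qed
  then have "Suc x < b \<tau>" using t assms(2) gapsD(2,4)[OF assms(1)] by (cases "\<tau> = k") auto
  then show ?thesis using t that by blast
qed

lemma gaps_card:
  assumes "gaps n k a b X"
  shows "card X = k"
proof -
  have pos: "0 < a \<tau>" if "1 \<le> \<tau>" "\<tau> \<le> k" for \<tau>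
    using gaps_mono[OF assms, of 0 \<tau>] gapsD(1)[OF assms] gapsD(3)[OF assms, of 0] that by auto
  have "inj_on (\<lambda>\<tau>. a \<tau> - 1) {1..k}"
  proof (rule inj_onI)
    fix \<tau> \<tau>' assume *: "\<tau> \<in> {1..k}" "\<tau>' \<in> {1..k}" "a \<tau> - 1 = a \<tau>' - 1"
    then have "a \<tau> = a \<tau>'" using pos[of \<tau>] pos[of \<tau>'] by auto
    then show "\<tau> = \<tau>'"
      using * gapsD(3)[OF assms, of \<tau>] gapsD(3)[OF assms, of \<tau>'] by (intro gaps_unique[OF assms, of _ _ "a \<tau>"]) auto
  qed
  moreover have "X = (\<lambda>\<tau>. a \<tau> - 1) ` {1..k}"
  proof (rule set_eqI)
    fix x
    have "(\<exists>\<tau>. 1 \<le> \<tau> \<and> \<tau> \<le> k \<and> a \<tau> = Suc x) \<longleftrightarrow> x \<in> (\<lambda>\<tau>. a \<tau> - 1) ` {1..k}"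
      using pos by force
    then show "x \<in> X \<longleftrightarrow> x \<in> (\<lambda>\<tau>. a \<tau> - 1) ` {1..k}" using assms by (simp add: gaps_def)
  qed
  ultimately show ?thesis by (simp add: card_image)
qed

lemma gaps_exist:
  assumes "X \<subseteq> {..<n}" "card X = k"
  obtains a b where "gaps n k a b X"
proof -
  define xs where "xs = sorted_list_of_set X"
  have fin: "finite X" using assms(1) finite_subset by blast
  have len: "length xs = k" using assms(2) by (simp add: xs_def)
  have set: "set xs = X" using fin by (simp add: xs_def)
  have sorted: "xs ! i < xs ! j" if "i < j" "j < k" for i j
    using sorted_wrt_nth_less[of "(<)" xs i j] that len by (simp add: xs_def)
  have bound: "xs ! i < n" if "i < k" for i using that len set assms(1) nth_mem by blast
  define a where "a \<tau> = (if \<tau> = 0 then 0 else Suc (xs ! (\<tau> - 1)))" for \<tau>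
  define b where "b \<tau> = (if \<tau> = k then n + 1 else Suc (xs ! \<tau>))" for \<tau>
  have "a \<tau> < b \<tau>" if "\<tau> \<le> k" for \<tau>
    using that bound[of "\<tau> - 1"] sorted[of "\<tau> - 1" \<tau>] by (auto simp: a_def b_def)
  moreover have "X = {x. \<exists>\<tau>. 1 \<le> \<tau> \<and> \<tau> \<le> k \<and> a \<tau> = Suc x}"
  proof (rule set_eqI)
    fix x
    have "x \<in> X \<longleftrightarrow> (\<exists>i<k. xs ! i = x)" using set len by (auto simp: in_set_conv_nth)
    also have "\<dots> \<longleftrightarrow> (\<exists>\<tau>. 1 \<le> \<tau> \<and> \<tau> \<le> k \<and> a \<tau> = Suc x)"
    proof
      assume "\<exists>i<k. xs ! i = x"
      then obtain i where "i < k" "xs ! i = x" by blast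
      then show "\<exists>\<tau>. 1 \<le> \<tau> \<and> \<tau> \<le> k \<and> a \<tau> = Suc x"
        by (intro exI[of _ "Suc i"]) (auto simp: a_def)
    next
      assume "\<exists>\<tau>. 1 \<le> \<tau> \<and> \<tau> \<le> k \<and> a \<tau> = Suc x"
      then obtain \<tau> where "1 \<le> \<tau>" "\<tau> \<le> k" "a \<tau> = Suc x" by blast
      then show "\<exists>i<k. xs ! i = x" by (intro exI[of _ "\<tau> - 1"]) (auto simp: a_def)
    qed
    finally show "x \<in> X \<longleftrightarrow> x \<in> {x. \<exists>\<tau>. 1 \<le> \<tau> \<and> \<tau> \<le> k \<and> a \<tau> = Suc x}" by simp
  qed
  ultimately have "gaps n k a b X" unfolding gaps_def by (auto simp: a_def b_def)
  then show ?thesis by (rule that)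
qed

text \<open>
  A local view consists of the gaps with the indices \<open>t l\<close> for \<open>l < 2 ^ Suc d\<close> and of all claims
  \<open>(g s, h s)\<close>.
\<close>

definition view_ok :: "nat \<Rightarrow> (nat \<Rightarrow> bool) \<Rightarrow> (nat \<Rightarrow> nat \<Rightarrow> bool) \<Rightarrow> nat \<Rightarrow> nat \<Rightarrow> (nat \<Rightarrow> nat) \<Rightarrow>
    (nat \<Rightarrow> nat) \<Rightarrow> (nat \<Rightarrow> nat) \<Rightarrow> (nat \<Rightarrow> nat) \<Rightarrow> (nat \<Rightarrow> nat) \<Rightarrow> bool" where
  "view_ok n c e d k t a b g h \<longleftrightarrow>
     (\<forall>l\<in>{..<2 ^ Suc d}. a l < b l \<and> (t l = 0 \<longrightarrow> a l = 0) \<and>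
        (t l \<noteq> 0 \<longrightarrow> a l \<noteq> 0 \<and> a l \<le> n \<and> indeg n e (a l - 1) = 0) \<and> (t l = k \<longrightarrow> b l = n + 1)) \<and>
     claims_ok n c e d (\<lambda>x. \<exists>l\<in>{..<2 ^ Suc d}. a l \<le> Suc x \<and> Suc x < b l)
       (\<lambda>x. \<exists>l\<in>{..<2 ^ Suc d}. a l = Suc x) (\<lambda>i j. \<exists>s\<in>{..<2 ^ Suc d}. g s = i \<and> h s = j)"

text \<open>That consecutive gaps touch relates only two indices, so it can be checked between two
  views even if no single view contains both indices.\<close>

definition views_agree :: "nat \<Rightarrow> (nat \<Rightarrow> nat) \<Rightarrow> (nat \<Rightarrow> nat) \<Rightarrow> (nat \<Rightarrow> nat) \<Rightarrow> (nat \<Rightarrow> nat) \<Rightarrow>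
    (nat \<Rightarrow> nat) \<Rightarrow> (nat \<Rightarrow> nat) \<Rightarrow> (nat \<Rightarrow> nat) \<Rightarrow> (nat \<Rightarrow> nat) \<Rightarrow> (nat \<Rightarrow> nat) \<Rightarrow> (nat \<Rightarrow> nat) \<Rightarrow> bool" where
  "views_agree d t a b g h t' a' b' g' h' \<longleftrightarrow>
     (\<forall>s\<in>{..<2 ^ Suc d}. g s = g' s \<and> h s = h' s) \<and>
     (\<forall>l\<in>{..<2 ^ Suc d}. \<forall>l'\<in>{..<2 ^ Suc d}. (t l = t' l' \<longrightarrow> a l = a' l' \<and> b l = b' l') \<and>
        (t' l' = Suc (t l) \<longrightarrow> b l = a' l'))"

text \<open>The adjacency of the clique instance. A clique tests nothing but pairs, so the
  conditions on each single vertex are included; \<open>views_agree\<close> appears in both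
  directions because its condition on successive indices is directed.\<close>

definition compatible :: "nat \<Rightarrow> (nat \<Rightarrow> bool) \<Rightarrow> (nat \<Rightarrow> nat \<Rightarrow> bool) \<Rightarrow> nat \<Rightarrow> nat \<Rightarrow>
    (nat \<Rightarrow> nat \<Rightarrow> nat) \<Rightarrow> (nat \<Rightarrow> nat \<Rightarrow> nat) \<Rightarrow> (nat \<Rightarrow> nat \<Rightarrow> nat) \<Rightarrow> (nat \<Rightarrow> nat \<Rightarrow> nat) \<Rightarrow>
    (nat \<Rightarrow> nat \<Rightarrow> nat) \<Rightarrow> nat \<Rightarrow> nat \<Rightarrow> nat \<Rightarrow> nat \<Rightarrow> bool" where
  "compatible n c e d k t a b g h T v T' v' \<longleftrightarrow>
     view_ok n c e d k (t T) (a v) (b v) (g v) (h v) \<and>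
     view_ok n c e d k (t T') (a v') (b v') (g v') (h v') \<and>
     views_agree d (t T) (a v) (b v) (g v) (h v) (t T) (a v) (b v) (g v) (h v) \<and>
     views_agree d (t T') (a v') (b v') (g v') (h v') (t T') (a v') (b v') (g v') (h v') \<and>
     views_agree d (t T) (a v) (b v) (g v) (h v) (t T') (a v') (b v') (g v') (h v') \<and>
     views_agree d (t T') (a v') (b v') (g v') (h v') (t T) (a v) (b v) (g v) (h v)"

text \<open>Trusting fewer inputs imposes fewer conditions, and each remaining one reads
  \<open>\<alpha>\<close> only on a trusted cone, where the two assignments coincide.\<close>

lemma claims_ok_local:
  assumes ok: "claims_ok n c e d Q \<alpha> w"
    and PQ: "\<And>x. P x \<Longrightarrow> Q x" and eq: "\<And>x. P x \<Longrightarrow> x < n \<Longrightarrow> \<alpha> x = \<alpha>' x"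
    and n: "0 < n"
  shows "claims_ok n c e d P \<alpha>' w"
proof -
  have ev: "teval n c e \<alpha>' w (Suc d) j = teval n c e \<alpha> w (Suc d) j"
    if "\<forall>x\<in>cone n e (Suc d) j. P x" "j < n" for j
    using that eq cone_subset[of j n e "Suc d"] by (intro teval_cong) (auto simp del: cone.simps)
  show ?thesis
    unfolding claims_ok_def
  proof (intro conjI impI allI)
    assume P: "\<forall>x\<in>cone n e (Suc d) (n - 1). P x"
    then show "teval n c e \<alpha>' w (Suc d) (n - 1)"
      using ok PQ n by (subst ev) (auto simp: claims_ok_def simp del: cone.simps teval.simps)
  next
    fix g j assume gj: "g < n" "j < n" and *: "live n e d g \<and> e j g \<and> (\<forall>x\<in>cone n e (Suc d) j. P x)"
    have "\<forall>x\<in>cone n e (Suc d) j. Q x" using * PQ by blast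
    then have "(w g j \<longrightarrow> (teval n c e \<alpha> w (Suc d) j \<longleftrightarrow> \<not> c g)) \<and>
        (\<not> (\<exists>i<n. e i g \<and> w g i) \<longrightarrow> (teval n c e \<alpha> w (Suc d) j \<longleftrightarrow> c g))"
      using ok gj * unfolding claims_ok_def by blast
    note chk = this
    have evj: "teval n c e \<alpha>' w (Suc d) j = teval n c e \<alpha> w (Suc d) j"
      using * gj by (intro ev) auto
    show "teval n c e \<alpha>' w (Suc d) j \<longleftrightarrow> \<not> c g" if "w g j"
      using that chk evj by (simp del: teval.simps)
    show "teval n c e \<alpha>' w (Suc d) j \<longleftrightarrow> c g" if "\<not> (\<exists>i<n. e i g \<and> w g i)"
      using that chk evj by (simp del: teval.simps)
  qed
qed

text \<open>Every single condition reads one cone, which has at most \<open>2 ^ Suc d\<close>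
  inputs. So it is enough that each set of this size is trusted by some valid view.\<close>

lemma claims_ok_cover:
  assumes ok: "\<And>A. finite A \<Longrightarrow> card A \<le> 2 ^ Suc d \<Longrightarrow> A \<subseteq> {..<n} \<Longrightarrow>
      \<exists>P. (\<forall>x\<in>A. P x) \<and> claims_ok n c e d P \<alpha> w"
    and n: "0 < n"
  shows "claims_ok n c e d (\<lambda>_. True) \<alpha> w"
proof -
  have cone: "finite (cone n e (Suc d) j)" "card (cone n e (Suc d) j) \<le> 2 ^ Suc d"
    "cone n e (Suc d) j \<subseteq> {..<n}" if "j < n" for j
    using cone_bound[of n e "Suc d" j] cone_subset[OF that, of e "Suc d"]
    by (auto simp del: cone.simps)
  show ?thesis
    unfolding claims_ok_def
  proof (intro conjI impI allI)
    obtain P where "\<forall>x\<in>cone n e (Suc d) (n - 1). P x" "claims_ok n c e d P \<alpha> w"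
      using ok[OF cone] n by (metis diff_less zero_less_one)
    then show "teval n c e \<alpha> w (Suc d) (n - 1)"
      by (simp add: claims_ok_def del: cone.simps teval.simps)
  next
    fix g j assume gj: "g < n" "j < n" and *: "live n e d g \<and> e j g \<and> (\<forall>x\<in>cone n e (Suc d) j. True)"
    obtain P where P: "\<forall>x\<in>cone n e (Suc d) j. P x" "claims_ok n c e d P \<alpha> w"
      using ok[OF cone] gj by blast
    have "(w g j \<longrightarrow> (teval n c e \<alpha> w (Suc d) j \<longleftrightarrow> \<not> c g)) \<and>
        (\<not> (\<exists>i<n. e i g \<and> w g i) \<longrightarrow> (teval n c e \<alpha> w (Suc d) j \<longleftrightarrow> c g))"
      using P gj * unfolding claims_ok_def by blast
    note chk = this
    show "teval n c e \<alpha> w (Suc d) j \<longleftrightarrow> \<not> c g" if "w g j"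
      using that chk by blast
    show "teval n c e \<alpha> w (Suc d) j \<longleftrightarrow> c g" if "\<not> (\<exists>i<n. e i g \<and> w g i)"
      using that chk by blast
  qed
qed

text \<open>Turns the at most \<open>q\<close> gap indices needed for a cone into a tuple of exactly
  \<open>q\<close> slots; spare slots get the index 0, which is always legal.\<close>

lemma enumerate_upto:
  assumes "finite A" "card A \<le> q" "f ` A \<subseteq> {..k::nat}"
  obtains h where "\<And>l::nat. h l \<le> k" "f ` A \<subseteq> h ` {..<q}"
proof -
  obtain en where en: "bij_betw en {0..<card A} A" using assms(1) ex_bij_betw_nat_finite by blast
  define h where "h l = (if l < card A then f (en l) else 0)" for l
  have "h l \<le> k" for l
    using assms(3)[unfolded image_subset_iff] bij_betwE[OF en] by (auto simp: h_def)
  moreover have "f ` A \<subseteq> h ` {..<q}"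
  proof
    fix y assume "y \<in> f ` A"
    then obtain x where "x \<in> A" "y = f x" by blast
    then have "x \<in> en ` {0..<card A}" using en by (simp add: bij_betw_def)
    then obtain l where "l < card A" "x = en l" by auto
    then show "y \<in> h ` {..<q}" using \<open>y = f x\<close> assms(2) by (intro image_eqI[of _ _ l]) (auto simp: h_def)
  qed
  ultimately show ?thesis by (rule that)
qed

text \<open>Abstracts from the coding by digits: \<open>t T\<close> lists the gap indices of color
  \<open>T\<close>, and \<open>a v\<close>, \<open>b v\<close>, \<open>g v\<close>,
  \<open>h v\<close> decode a value. Surjectivity provides a color for each tuple of indices and a
  value for each tuple of entries; it concerns only the slots below \<open>2 ^ Suc d\<close>, and
  codes may repeat.\<close>

locale views =
  fixes n d k m N :: nat and c :: "nat \<Rightarrow> bool" and e :: "nat \<Rightarrow> nat \<Rightarrow> bool"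
    and t :: "nat \<Rightarrow> nat \<Rightarrow> nat" and a b g h :: "nat \<Rightarrow> nat \<Rightarrow> nat"
  assumes n: "0 < n" and m: "2 \<le> m"
    and t_le: "\<And>T l. t T l \<le> k"
    and t_surj: "\<And>f. (\<And>l. f l \<le> k) \<Longrightarrow> \<exists>T<m. \<forall>l<2 ^ Suc d. t T l = f l"
    and dec_surj: "\<And>f f' f'' f'''. (\<And>l. f l < n + 2 \<and> f' l < n + 2 \<and> f'' l < n + 2 \<and> f''' l < n + 2) \<Longrightarrow>
      \<exists>v<N. \<forall>l<2 ^ Suc d. a v l = f l \<and> b v l = f' l \<and> g v l = f'' l \<and> h v l = f''' l"
    and gh_less: "\<And>v l. g v l < n + 2 \<and> h v l < n + 2"
begin

definition ok :: "nat \<Rightarrow> nat \<Rightarrow> bool" where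
  "ok T v \<longleftrightarrow> view_ok n c e d k (t T) (a v) (b v) (g v) (h v)"

definition agree :: "nat \<Rightarrow> nat \<Rightarrow> nat \<Rightarrow> nat \<Rightarrow> bool" where
  "agree T v T' v' \<longleftrightarrow>
     views_agree d (t T) (a v) (b v) (g v) (h v) (t T') (a v') (b v') (g v') (h v')"

abbreviation compat :: "nat \<Rightarrow> nat \<Rightarrow> nat \<Rightarrow> nat \<Rightarrow> bool" where
  "compat \<equiv> compatible n c e d k t a b g h"

lemma compat_iff:
  "compat T v T' v' \<longleftrightarrow> ok T v \<and> ok T' v' \<and> agree T v T v \<and> agree T' v' T' v' \<and>
     agree T v T' v' \<and> agree T' v' T v"
  by (simp add: compatible_def ok_def agree_def)

lemma views_imp_claims:
  assumes comp: "\<And>T T'. T < m \<Longrightarrow> T' < m \<Longrightarrow> T \<noteq> T' \<Longrightarrow> compat T (f T) T' (f T')"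
  shows "\<exists>X G H. X \<subseteq> {x. x < n \<and> indeg n e x = 0} \<and> card X = k \<and> (\<forall>s. G s < n + 2 \<and> H s < n + 2) \<and>
    claims_ok n c e d (\<lambda>_. True) (\<lambda>x. x \<in> X) (\<lambda>i j. \<exists>s<(2::nat) ^ Suc d. G s = i \<and> H s = j)"
proof -
  let ?q = "2 ^ Suc d :: nat"
  \<comment> \<open>A vertex is tested only as an end of an edge, so each color needs another
    one.\<close>
  have other: "\<exists>T'<m. T' \<noteq> T" for T
    using m by (intro exI[of _ "if T = 0 then 1 else 0"]) auto
  have comp': "compat T (f T) T' (f T')" if "T < m" "T' < m" for T T'
    using comp that other[of T] unfolding compat_iff by metis
  have ok: "ok T (f T)" if "T < m" for T using comp'[OF that that] by (simp add: compat_iff)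
  have agree: "agree T (f T) T' (f T')" if "T < m" "T' < m" for T T'
    using comp'[OF that] by (simp add: compat_iff)
  have gh: "g (f T) s = g (f T') s \<and> h (f T) s = h (f T') s" if "T < m" "T' < m" "s < ?q" for T T' s
    using agree[OF that(1,2)] that(3) by (auto simp: agree_def views_agree_def)
  have ab: "a (f T) l = a (f T') l'" "b (f T) l = b (f T') l'"
    if "T < m" "T' < m" "l < ?q" "l' < ?q" "t T l = t T' l'" for T T' l l'
    using agree[OF that(1,2)] that(3-) by (auto simp: agree_def views_agree_def)
  have next_gap: "b (f T) l = a (f T') l'"
    if "T < m" "T' < m" "l < ?q" "l' < ?q" "t T' l' = Suc (t T l)" for T T' l l'
    using agree[OF that(1,2)] that(3-) by (auto simp: agree_def views_agree_def)
  have view: "a (f T) l < b (f T) l" "t T l = 0 \<Longrightarrow> a (f T) l = 0"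
    "t T l \<noteq> 0 \<Longrightarrow> a (f T) l \<noteq> 0 \<and> a (f T) l \<le> n \<and> indeg n e (a (f T) l - 1) = 0"
    "t T l = k \<Longrightarrow> b (f T) l = n + 1" if "T < m" "l < ?q" for T l
    using ok[OF that(1)] that(2) by (auto simp: ok_def view_ok_def)
  \<comment> \<open>The color all of whose indices are \<open>\<tau>\<close> serves to define the
    gap number \<open>\<tau>\<close>; the minimum makes the choice total.\<close>
  have "\<exists>T<m. \<forall>l<?q. t T l = min \<tau> k" for \<tau> by (rule t_surj) simp
  then obtain R where R: "\<And>\<tau>. R \<tau> < m" "\<And>\<tau> l. l < ?q \<Longrightarrow> t (R \<tau>) l = min \<tau> k" by metis
  define A where "A \<tau> = a (f (R \<tau>)) 0" for \<tau>
  define B where "B \<tau> = b (f (R \<tau>)) 0" for \<tau>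
  have AB: "a (f T) l = A (t T l)" "b (f T) l = B (t T l)" if "T < m" "l < ?q" for T l
    using ab[OF that(1) R(1) that(2), of 0] R(2)[of 0] t_le[of T l] by (auto simp: A_def B_def)
  define X where "X = {x. \<exists>\<tau>. 1 \<le> \<tau> \<and> \<tau> \<le> k \<and> A \<tau> = Suc x}"
  have gaps: "gaps n k A B X"
    unfolding gaps_def
  proof (intro conjI allI impI)
    show "A 0 = 0" using view(2)[OF R(1), of 0 0] R(2)[of 0 0] by (simp add: A_def)
    show "B k = n + 1" using view(4)[OF R(1), of 0 k] R(2)[of 0 k] by (simp add: B_def)
    show "A \<tau> < B \<tau>" for \<tau> using view(1)[OF R(1), of 0 \<tau>] by (simp add: A_def B_def)
    show "B \<tau> = A (Suc \<tau>)" if "\<tau> < k" for \<tau>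
      using next_gap[OF R(1) R(1), of 0 0 "Suc \<tau>" \<tau>] R(2)[of 0] that by (simp add: A_def B_def)
  qed (rule X_def)
  have "X \<subseteq> {x. x < n \<and> indeg n e x = 0}"
  proof
    fix x assume "x \<in> X"
    then obtain \<tau> where "1 \<le> \<tau>" "\<tau> \<le> k" "A \<tau> = Suc x" by (auto simp: X_def)
    then show "x \<in> {x. x < n \<and> indeg n e x = 0}"
      using view(3)[OF R(1), of 0 \<tau>] R(2)[of 0 \<tau>] by (auto simp: A_def)
  qed
  moreover have "card X = k" using gaps by (rule gaps_card)
  moreover define G where "G = g (f (R 0))"
  moreover define H where "H = h (f (R 0))"
  moreover have "\<forall>s. G s < n + 2 \<and> H s < n + 2" unfolding G_def H_def using gh_less by blast
  moreover have "claims_ok n c e d (\<lambda>_. True) (\<lambda>x. x \<in> X) (\<lambda>i j. \<exists>s<?q. G s = i \<and> H s = j)"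
  proof (rule claims_ok_cover[OF _ n])
    fix V assume V: "finite V" "card V \<le> ?q" "V \<subseteq> {..<n}"
    have "\<exists>\<tau>\<le>k. A \<tau> \<le> Suc x \<and> Suc x < B \<tau>" if "x \<in> V" for x
      using gaps_cover[OF gaps, of x] that V(3) by blast
    then obtain pos where pos: "\<And>x. x \<in> V \<Longrightarrow> pos x \<le> k \<and> A (pos x) \<le> Suc x \<and> Suc x < B (pos x)"
      by metis
    then obtain en where en: "\<And>l. en l \<le> k" "pos ` V \<subseteq> en ` {..<?q}"
      using enumerate_upto[OF V(1,2), of pos k] by blast
    \<comment> \<open>Some color lists the gaps around all of \<open>V\<close>, so its vertex has
      verified every condition whose cone lies in \<open>V\<close>.\<close>
    obtain T where T: "T < m" "\<forall>l<?q. t T l = en l" using t_surj[of en] en(1) by blast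
    let ?P = "\<lambda>x. \<exists>l\<in>{..<?q}. a (f T) l \<le> Suc x \<and> Suc x < b (f T) l"
    have w: "(\<lambda>i j. \<exists>s\<in>{..<?q}. g (f T) s = i \<and> h (f T) s = j) = (\<lambda>i j. \<exists>s<?q. G s = i \<and> H s = j)"
      using gh[OF T(1) R(1)[of 0]] by (auto simp: fun_eq_iff G_def H_def)
    have "claims_ok n c e d ?P (\<lambda>x. \<exists>l\<in>{..<?q}. a (f T) l = Suc x) (\<lambda>i j. \<exists>s<?q. G s = i \<and> H s = j)"
      using ok[OF T(1)] unfolding ok_def view_ok_def w by blast
    then have "claims_ok n c e d ?P (\<lambda>x. x \<in> X) (\<lambda>i j. \<exists>s<?q. G s = i \<and> H s = j)"
    proof (rule claims_ok_local)
      fix x assume "?P x" "x < n"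
      then obtain l where l: "l < ?q" "A (t T l) \<le> Suc x" "Suc x < B (t T l)" using AB[OF T(1)] by auto
      have iff: "x \<in> X \<longleftrightarrow> A (t T l) = Suc x" using gaps_member[OF gaps t_le l(2,3)] .
      show "(\<exists>l\<in>{..<?q}. a (f T) l = Suc x) \<longleftrightarrow> x \<in> X"
      proof
        assume "\<exists>l\<in>{..<?q}. a (f T) l = Suc x"
        then obtain l' where "A (t T l') = Suc x" using AB[OF T(1)] by auto
        then show "x \<in> X" using gaps_member[OF gaps t_le, of T l' x] gapsD(3)[OF gaps t_le, of T l'] by simp
      next
        assume "x \<in> X"
        then show "\<exists>l\<in>{..<?q}. a (f T) l = Suc x" using iff l(1) AB[OF T(1) l(1)] by auto
      qed
    qed (use n in auto)
    moreover have "\<forall>x\<in>V. ?P x"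
    proof
      fix x assume x: "x \<in> V"
      then obtain l where "l < ?q" "pos x = en l" using en(2) by blast
      then show "?P x" using pos[OF x] T AB[OF T(1)] by (intro bexI[of _ l]) auto
    qed
    ultimately show "\<exists>P. (\<forall>x\<in>V. P x) \<and>
        claims_ok n c e d P (\<lambda>x. x \<in> X) (\<lambda>i j. \<exists>s<?q. G s = i \<and> H s = j)" by blast
  qed
  ultimately show ?thesis by blast
qed

text \<open>The vertex of color \<open>T\<close> carries the actual gaps with the indices listed by
  \<open>T\<close>, so all views are excerpts of one global solution.\<close>

lemma claims_imp_views:
  assumes X: "X \<subseteq> {x. x < n \<and> indeg n e x = 0}" "card X = k"
    and GH: "\<And>s. G s < n + 2 \<and> H s < n + 2"
    and claims: "claims_ok n c e d (\<lambda>_. True) (\<lambda>x. x \<in> X) (\<lambda>i j. \<exists>s<(2::nat) ^ Suc d. G s = i \<and> H s = j)"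
  obtains f where "\<And>T. f T < N" "\<And>T T'. compat T (f T) T' (f T')"
proof -
  let ?q = "2 ^ Suc d :: nat"
  obtain A B where gaps: "gaps n k A B X" using gaps_exist[of X n k] X by blast
  \<comment> \<open>The ends of gaps reach \<open>n + 1\<close>, which is why entries range up to
    that value.\<close>
  have B_le: "B \<tau> \<le> n + 1" if "\<tau> \<le> k" for \<tau>
  proof (cases "\<tau> = k")
    case False
    then have "B \<tau> \<le> A k" using that gaps_mono[OF gaps] by simp
    also have "\<dots> \<le> n + 1" using gaps by (auto simp: gaps_def dest: spec[of _ k])
    finally show ?thesis .
  qed (use gaps in \<open>simp add: gaps_def\<close>)
  have A_le: "A \<tau> \<le> n" if "\<tau> \<le> k" for \<tau>
    using B_le[OF that] gaps that by (fastforce simp: gaps_def)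
  have "\<exists>v<N. \<forall>l<?q. a v l = A (t T l) \<and> b v l = B (t T l) \<and> g v l = G l \<and> h v l = H l" for T
    using GH A_le B_le t_le by (intro dec_surj) (auto simp: less_Suc_eq_le le_SucI)
  then obtain f where f: "\<And>T. f T < N" "\<And>T l. l < ?q \<Longrightarrow> a (f T) l = A (t T l) \<and> b (f T) l = B (t T l) \<and>
      g (f T) l = G l \<and> h (f T) l = H l" by metis
  have input: "A \<tau> \<noteq> 0 \<and> indeg n e (A \<tau> - 1) = 0" if "\<tau> \<noteq> 0" "\<tau> \<le> k" for \<tau>
  proof -
    have pos: "A \<tau> \<noteq> 0" using gaps_mono[OF gaps, of 0 \<tau>] gapsD(1)[OF gaps] gapsD(3)[OF gaps, of 0] that by auto
    then have "A \<tau> - 1 \<in> X" using gaps that by (auto simp: gaps_def intro!: exI[of _ \<tau>])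
    then show ?thesis using X pos by auto
  qed
  have "ok T (f T)" for T
  proof -
    have "claims_ok n c e d (\<lambda>x. \<exists>l\<in>{..<?q}. a (f T) l \<le> Suc x \<and> Suc x < b (f T) l)
       (\<lambda>x. \<exists>l\<in>{..<?q}. a (f T) l = Suc x) (\<lambda>i j. \<exists>s<?q. G s = i \<and> H s = j)"
    proof (rule claims_ok_local[OF claims])
      fix x assume "\<exists>l\<in>{..<?q}. a (f T) l \<le> Suc x \<and> Suc x < b (f T) l" "x < n"
      then obtain l where l: "l < ?q" "A (t T l) \<le> Suc x" "Suc x < B (t T l)" using f(2) by auto
      have "x \<in> X \<longleftrightarrow> A (t T l) = Suc x" using gaps_member[OF gaps t_le l(2,3)] .
      moreover have "x \<in> X" if "A (t T l') = Suc x" for l'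
      proof -
        have "A (t T l') < B (t T l')" using gaps t_le by (simp add: gaps_def)
        then show ?thesis using gaps_member[OF gaps t_le, of T l' x] that by simp
      qed
      ultimately show "x \<in> X \<longleftrightarrow> (\<exists>l\<in>{..<?q}. a (f T) l = Suc x)" using f(2) l(1) by force
    qed (use n in auto)
    moreover have "(\<lambda>i j. \<exists>s<?q. G s = i \<and> H s = j) = (\<lambda>i j. \<exists>s\<in>{..<?q}. g (f T) s = i \<and> h (f T) s = j)"
      using f(2)[of _ T] by (auto simp: fun_eq_iff)
    ultimately show ?thesis
      unfolding ok_def view_ok_def using f(2)[of _ T] gaps t_le[of T] input A_le[OF t_le]
      by (auto simp: gaps_def)
  qed
  moreover have "agree T (f T) T' (f T')" for T T'
  proof -
    have "B (t T l) = A (t T' l')" if "t T' l' = Suc (t T l)" for l l'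
      using gapsD(4)[OF gaps, of "t T l"] t_le[of T' l'] that by simp
    then show ?thesis
      unfolding agree_def views_agree_def using f(2)[of _ T] f(2)[of _ T'] by auto
  qed
  ultimately have "compat T (f T) T' (f T')" for T T' by (simp add: compat_iff)
  then show ?thesis using f(1) that by blast
qed

end

section \<open>Expressions computable in polynomial time\<close>

datatype expr = Var nat | Num nat | Plus expr expr | Minus expr expr | Bit expr | Sum expr expr

text \<open>
  Variables are de Bruijn indices, \<open>Sum s t\<close> binds the index 0 of \<open>t\<close>. Values of expressions, and
  hence the time for their evaluation, are bounded by polynomials in the values of the variables.
\<close>

primrec eval :: "expr \<Rightarrow> (nat \<Rightarrow> bool) \<Rightarrow> (nat \<Rightarrow> nat) \<Rightarrow> nat" where
  "eval (Var i) \<beta> \<rho> = \<rho> i"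
| "eval (Num c) \<beta> \<rho> = c"
| "eval (Plus s t) \<beta> \<rho> = eval s \<beta> \<rho> + eval t \<beta> \<rho>"
| "eval (Minus s t) \<beta> \<rho> = eval s \<beta> \<rho> - eval t \<beta> \<rho>"
| "eval (Bit t) \<beta> \<rho> = of_bool (\<beta> (eval t \<beta> \<rho>))"
| "eval (Sum s t) \<beta> \<rho> = (\<Sum>i<eval s \<beta> \<rho>. eval t \<beta> (case_nat i \<rho>))"

text \<open>As the base is at least 2, a sum of two powers fits into one power with a slightly
  larger exponent. Polynomial bounds can thus be tracked by exponents alone, without
  coefficients.\<close>

lemma power_add_le:
  assumes "x \<le> (M + 2) ^ a" "y \<le> (M + 2) ^ b"
  shows "x + y \<le> (M + 2 :: nat) ^ (a + b + 1)"
proof -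
  have "(M + 2) ^ a \<le> (M + 2) ^ (a + b)" "(M + 2) ^ b \<le> (M + 2) ^ (a + b)"
    by (simp_all add: power_increasing)
  then have "x + y \<le> 2 * (M + 2) ^ (a + b)" using assms by linarith
  also have "\<dots> \<le> (M + 2) * (M + 2) ^ (a + b)" by (rule mult_right_mono) simp_all
  finally show ?thesis by simp
qed

lemma power_mult_le:
  assumes "x \<le> (M + 2) ^ a" "y \<le> (M + 2) ^ b"
  shows "x * y \<le> (M + 2 :: nat) ^ (a + b)"
  using mult_mono[OF assms] by (simp add: power_add)

lemma const_le_power: "c \<le> (M + 2 :: nat) ^ c"
  by (rule order_trans[OF less_imp_le[OF less_exp] power_mono]) simp_all

lemma power_le_power:
  assumes "x \<le> (M + 2 :: nat) ^ a"
  shows "(M + x + 2) ^ b \<le> (M + 2) ^ ((a + 2) * b)"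
proof -
  have "(M + 2) + x \<le> (M + 2) ^ (1 + a + 1)" using assms by (intro power_add_le) simp_all
  then have "(M + x + 2) ^ b \<le> ((M + 2) ^ (a + 2)) ^ b" by (intro power_mono) (simp_all add: ac_simps)
  then show ?thesis by (simp only: power_mult)
qed

lemma eval_bound: "\<exists>C. \<forall>\<beta> \<rho> M. (\<forall>i. \<rho> i \<le> M) \<longrightarrow> eval t \<beta> \<rho> \<le> (M + 2) ^ C"
proof (induction t)
  case (Var i)
  show ?case by (intro exI[of _ 1]) (auto intro: le_SucI)
next
  case (Num c)
  show ?case by (intro exI[of _ c]) (simp add: const_le_power del: add_2_eq_Suc')
next
  case (Plus s t)
  then obtain a b where "\<forall>\<beta> \<rho> M. (\<forall>i. \<rho> i \<le> M) \<longrightarrow> eval s \<beta> \<rho> \<le> (M + 2) ^ a"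
    "\<forall>\<beta> \<rho> M. (\<forall>i. \<rho> i \<le> M) \<longrightarrow> eval t \<beta> \<rho> \<le> (M + 2) ^ b" by blast
  then show ?case unfolding eval.simps by (intro exI[of _ "a + b + 1"] allI impI power_add_le) blast+
next
  case (Minus s t)
  then obtain a where "\<forall>\<beta> \<rho> M. (\<forall>i. \<rho> i \<le> M) \<longrightarrow> eval s \<beta> \<rho> \<le> (M + 2) ^ a" by blast
  then show ?case
    unfolding eval.simps by (intro exI[of _ a] allI impI order_trans[OF diff_le_self]) blast
next
  case (Bit t)
  show ?case by (intro exI[of _ 0]) simp
next
  case (Sum s t)
  then obtain a b where a: "\<And>\<beta> \<rho> M. (\<forall>i. \<rho> i \<le> M) \<Longrightarrow> eval s \<beta> \<rho> \<le> (M + 2) ^ a"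
    and b: "\<And>\<beta> \<rho> M. (\<forall>i. \<rho> i \<le> M) \<Longrightarrow> eval t \<beta> \<rho> \<le> (M + 2) ^ b" by blast
  have "eval (Sum s t) \<beta> \<rho> \<le> (M + 2) ^ (a + (a + 2) * b)" if "\<forall>i. \<rho> i \<le> M" for \<beta> \<rho> M
  proof -
    let ?s = "eval s \<beta> \<rho>"
    \<comment> \<open>The bound variable may exceed \<open>M\<close>, but it stays below the value
      of \<open>s\<close>, which is itself polynomial.\<close>
    have "eval t \<beta> (case_nat i \<rho>) \<le> (M + ?s + 2) ^ b" if "i < ?s" for i
      using that \<open>\<forall>i. \<rho> i \<le> M\<close> by (intro b) (auto split: nat.split intro: trans_le_add1)
    then have "eval (Sum s t) \<beta> \<rho> \<le> (\<Sum>i<?s. (M + ?s + 2) ^ b)"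
      unfolding eval.simps by (intro sum_mono) simp
    also have "\<dots> = ?s * (M + ?s + 2) ^ b" by simp
    also have "\<dots> \<le> (M + 2) ^ (a + (a + 2) * b)"
      using a[OF that] by (intro power_mult_le power_le_power)
    finally show ?thesis .
  qed
  then show ?case by blast
qed

section \<open>Running times as upper bounds\<close>

definition run :: "prog \<Rightarrow> state \<Rightarrow> nat \<Rightarrow> state \<Rightarrow> bool" where
  "run p s B s' \<longleftrightarrow> (\<exists>T\<le>B. exec p s T s')"

lemma run_mono: "run p s B s' \<Longrightarrow> B \<le> B' \<Longrightarrow> run p s B' s'"
  unfolding run_def by (meson order_trans)

lemma run_Const: "run (Set_Const x c) (R, A) 1 (R(x := c), A)"
  and run_Add: "run (Add x y z) (R, A) 1 (R(x := R y + R z), A)"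
  and run_Sub: "run (Sub x y z) (R, A) 1 (R(x := R y - R z), A)"
  and run_Load: "run (Load x a y) (R, A) 1 (R(x := A a (R y)), A)"
  and run_Store: "run (Store a x y) (R, A) 1 (R, A(a := (A a)(R x := R y)))"
  unfolding run_def by (blast intro: exec.intros)+

lemma run_Seq: "run p s B s' \<Longrightarrow> run q s' B' s'' \<Longrightarrow> run (Seq p q) s (B + B') s''"
  unfolding run_def by (meson add_mono exec_Seq)

lemma run_Cond:
  "(R x \<noteq> 0 \<Longrightarrow> run p (R, A) B s') \<Longrightarrow> (R x = 0 \<Longrightarrow> run q (R, A) B s') \<Longrightarrow>
     run (Cond x p q) (R, A) (B + 1) s'"
  unfolding run_def by (cases "R x = 0") (meson add_le_mono1 exec_Cond_true exec_Cond_false)+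

text \<open>For counting loops: the register \<open>x\<close> holds the number of rounds still to
  come, which yields both termination and the time bound.\<close>

lemma run_While:
  assumes init: "Inv 0 s"
    and body: "\<And>j s. j < m \<Longrightarrow> Inv j s \<Longrightarrow> \<exists>s'. run p s B s' \<and> Inv (Suc j) s'"
    and count: "\<And>j s. Inv j s \<Longrightarrow> fst s x = m - j"
  obtains s' where "run (While x p) s (m * (B + 1) + 1) s'" "Inv m s'"
proof -
  have "\<exists>s'. run (While x p) s (l * (B + 1) + 1) s' \<and> Inv m s'" if "Inv (m - l) s" "l \<le> m" for l s
    using that
  proof (induction l arbitrary: s)
    case 0
    obtain R A where s: "s = (R, A)" by fastforce
    have "R x = 0" using count[of m s] 0 by (simp add: s)
    then have "run (While x p) s 1 s"
      unfolding s run_def using exec_While_false by blast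
    then show ?case using 0 by (intro exI[of _ s]) simp
  next
    case (Suc l)
    obtain R A where s: "s = (R, A)" by fastforce
    have "R x \<noteq> 0" using count[OF Suc.prems(1)] Suc.prems(2) by (simp add: s)
    obtain s1 where s1: "run p s B s1" "Inv (Suc (m - Suc l)) s1"
      using body[OF _ Suc.prems(1)] Suc.prems(2) by auto
    then have "Inv (m - l) s1" using Suc.prems(2) by (simp add: Suc_diff_Suc)
    then obtain s2 where s2: "run (While x p) s1 (l * (B + 1) + 1) s2" "Inv m s2"
      using Suc.IH Suc.prems(2) by (meson Suc_leD)
    obtain T T' where T: "T \<le> B" "exec p s T s1" "T' \<le> l * (B + 1) + 1" "exec (While x p) s1 T' s2"
      using s1(1) s2(1) unfolding run_def by blast
    have "exec (While x p) s (T + T' + 1) s2"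
      using exec_While_true \<open>R x \<noteq> 0\<close> T(2,4) unfolding s by blast
    then have "run (While x p) s (Suc l * (B + 1) + 1) s2"
      unfolding run_def using T(1,3) by (intro exI[of _ "T + T' + 1"]) simp
    then show ?case using s2(2) by blast
  qed
  from this[of m s] show ?thesis using init that by auto
qed

text \<open>A stack discipline: \<open>\<sigma>\<close> places the variables in registers, those
  below \<open>d\<close> are preserved, \<open>d\<close> receives the result and everything above is
  scratch. \<open>M\<close> bounds only the variables, so the time does not depend on garbage in
  other registers.\<close>

definition computes :: "prog \<Rightarrow> nat \<Rightarrow> (nat \<Rightarrow> nat) \<Rightarrow> nat \<Rightarrow> expr \<Rightarrow> bool" where
  "computes p C \<sigma> d t \<longleftrightarrow> (\<forall>R A M. (\<forall>i. R (\<sigma> i) \<le> M) \<longrightarrow>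
    (\<exists>R'. run p (R, A) ((M + 2) ^ C) (R', A) \<and> (\<forall>x<d. R' x = R x) \<and>
       R' d = eval t (\<lambda>j. A 0 j \<noteq> 0) (\<lambda>i. R (\<sigma> i))))"

lemma computesD:
  assumes "computes p C \<sigma> d t" "\<forall>i. R (\<sigma> i) \<le> M"
  obtains R' where "run p (R, A) ((M + 2) ^ C) (R', A)" "\<forall>x<d. R' x = R x"
    "R' d = eval t (\<lambda>j. A 0 j \<noteq> 0) (\<lambda>i. R (\<sigma> i))"
  using assms(1)[unfolded computes_def, rule_format, of R M A] assms(2) that by blast

lemma computes_binary:
  assumes p: "computes p a \<sigma> d s" and q: "computes q b \<sigma> (Suc d) t" and \<sigma>: "\<And>i. \<sigma> i < d"
    and r: "\<And>R A. run r (R, A) 1 (R(d := f (R d) (R (Suc d))), A)"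
    and u: "\<And>\<beta> \<rho>. eval u \<beta> \<rho> = f (eval s \<beta> \<rho>) (eval t \<beta> \<rho>)"
  shows "computes (Seq (Seq p q) r) (a + b + 1 + 0 + 1) \<sigma> d u"
  unfolding computes_def
proof (intro allI impI)
  fix R and A :: "nat \<Rightarrow> nat \<Rightarrow> nat" and M assume M: "\<forall>i. R (\<sigma> i) \<le> (M::nat)"
  let ?\<beta> = "\<lambda>j. A 0 j \<noteq> (0::nat)"
  obtain R1 where R1: "run p (R, A) ((M + 2) ^ a) (R1, A)" "\<forall>x<d. R1 x = R x"
    "R1 d = eval s ?\<beta> (\<lambda>i. R (\<sigma> i))" by (rule computesD[OF p M])
  have \<sigma>1: "R1 (\<sigma> i) = R (\<sigma> i)" for i using R1(2) \<sigma> by blast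
  obtain R2 where R2: "run q (R1, A) ((M + 2) ^ b) (R2, A)" "\<forall>x<Suc d. R2 x = R1 x"
    "R2 (Suc d) = eval t ?\<beta> (\<lambda>i. R (\<sigma> i))"
    by (rule computesD[OF q, of R1 M A]) (use M in \<open>simp_all add: \<sigma>1\<close>)
  have "run (Seq (Seq p q) r) (R, A) ((M + 2) ^ (a + b + 1 + 0 + 1)) (R2(d := f (R2 d) (R2 (Suc d))), A)"
    by (rule run_mono[OF run_Seq[OF run_Seq[OF R1(1) R2(1)] r]]) (intro power_add_le; simp)
  then show "\<exists>R'. run (Seq (Seq p q) r) (R, A) ((M + 2) ^ (a + b + 1 + 0 + 1)) (R', A) \<and>
      (\<forall>x<d. R' x = R x) \<and> R' d = eval u ?\<beta> (\<lambda>i. R (\<sigma> i))"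
    using R1 R2 u by (intro exI[of _ "R2(d := f (R2 d) (R2 (Suc d)))"] conjI) auto
qed

lemma compile:
  assumes "\<And>i. \<sigma> i < d"
  shows "\<exists>p C. computes p C \<sigma> d t"
  using assms
proof (induction t arbitrary: \<sigma> d)
  case (Var i)
  \<comment> \<open>A register is copied by adding it to zero.\<close>
  let ?p = "Seq (Set_Const d 0) (Add d d (\<sigma> i))"
  have "computes ?p 1 \<sigma> d (Var i)"
    unfolding computes_def
  proof (intro allI impI)
    fix R A M
    have "run ?p (R, A) (1 + 1) (R(d := R (\<sigma> i)), A)"
      using run_Seq[OF run_Const[of d 0 R A] run_Add[of d d "\<sigma> i"]] Var[of i] by simp
    then have "run ?p (R, A) ((M + 2) ^ 1) (R(d := R (\<sigma> i)), A)" by (rule run_mono) simp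
    then show "\<exists>R'. run ?p (R, A) ((M + 2) ^ 1) (R', A) \<and> (\<forall>x<d. R' x = R x) \<and>
        R' d = eval (Var i) (\<lambda>j. A 0 j \<noteq> 0) (\<lambda>i. R (\<sigma> i))"
      by (intro exI[of _ "R(d := R (\<sigma> i))"]) simp
  qed
  then show ?case by blast
next
  case (Num c)
  have "computes (Set_Const d c) 0 \<sigma> d (Num c)"
    unfolding computes_def
  proof (intro allI impI)
    fix R A M
    show "\<exists>R'. run (Set_Const d c) (R, A) ((M + 2) ^ 0) (R', A) \<and> (\<forall>x<d. R' x = R x) \<and>
        R' d = eval (Num c) (\<lambda>j. A 0 j \<noteq> 0) (\<lambda>i. R (\<sigma> i))"
      using run_Const[of d c R A] by (intro exI[of _ "R(d := c)"]) simp
  qed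
  then show ?case by blast
next
  case (Plus s t)
  have "\<sigma> i < Suc d" for i using Plus.prems[of i] by simp
  from Plus.IH(1)[of \<sigma> d, OF Plus.prems] Plus.IH(2)[of \<sigma> "Suc d", OF this] obtain p a q b where
    "computes p a \<sigma> d s" "computes q b \<sigma> (Suc d) t" by blast
  from computes_binary[OF this Plus.prems, of "Add d d (Suc d)" "(+)" "Plus s t"]
  show ?case using run_Add by auto
next
  case (Minus s t)
  have "\<sigma> i < Suc d" for i using Minus.prems[of i] by simp
  from Minus.IH(1)[of \<sigma> d, OF Minus.prems] Minus.IH(2)[of \<sigma> "Suc d", OF this] obtain p a q b where
    "computes p a \<sigma> d s" "computes q b \<sigma> (Suc d) t" by blast
  from computes_binary[OF this Minus.prems, of "Sub d d (Suc d)" "(-)" "Minus s t"]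
  show ?case using run_Sub by auto
next
  case (Bit t)
  from Bit.IH[of \<sigma> d, OF Bit.prems] obtain p a where p: "computes p a \<sigma> d t" by blast
  let ?p = "Seq (Seq p (Load d 0 d)) (Cond d (Set_Const d 1) (Set_Const d 0))"
  show ?case unfolding computes_def
  proof (intro exI[of _ ?p] exI[of _ "a + 0 + 1 + 1 + 1"] allI impI)
    fix R and A :: "nat \<Rightarrow> nat \<Rightarrow> nat" and M assume M: "\<forall>i. R (\<sigma> i) \<le> (M::nat)"
    let ?\<beta> = "\<lambda>j. A 0 j \<noteq> (0::nat)"
    obtain R1 where R1: "run p (R, A) ((M + 2) ^ a) (R1, A)" "\<forall>x<d. R1 x = R x"
      "R1 d = eval t ?\<beta> (\<lambda>i. R (\<sigma> i))" by (rule computesD[OF p M])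
    let ?R2 = "R1(d := A 0 (R1 d))" and ?R3 = "R1(d := of_bool (A 0 (R1 d) \<noteq> 0))"
    have "run (Cond d (Set_Const d 1) (Set_Const d 0)) (?R2, A) (1 + 1) (?R3, A)"
      using run_Const[of d 1 ?R2 A] run_Const[of d 0 ?R2 A] by (intro run_Cond) auto
    then have "run ?p (R, A) ((M + 2) ^ (a + 0 + 1 + 1 + 1)) (?R3, A)"
      by (rule run_mono[OF run_Seq[OF run_Seq[OF R1(1) run_Load]]])
        (intro power_add_le; simp)
    then show "\<exists>R'. run ?p (R, A) ((M + 2) ^ (a + 0 + 1 + 1 + 1)) (R', A) \<and>
        (\<forall>x<d. R' x = R x) \<and> R' d = eval (Bit t) ?\<beta> (\<lambda>i. R (\<sigma> i))"
      using R1 by (intro exI[of _ "?R3"] conjI) auto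
  qed
next
  case (Sum s t)
  let ?\<sigma> = "case_nat (d + 2) \<sigma>"
  have "?\<sigma> i < d + 3" for i using Sum.prems[of "i - 1"] by (cases i) auto
  from Sum.IH(1)[of \<sigma> d, OF Sum.prems] Sum.IH(2)[of ?\<sigma> "d + 3", OF this] obtain p a q b where
    p: "computes p a \<sigma> d s" and q: "computes q b ?\<sigma> (d + 3) t" by blast
  obtain e where e: "\<And>\<beta> \<rho> M. (\<forall>i. \<rho> i \<le> M) \<Longrightarrow> eval s \<beta> \<rho> \<le> (M + 2) ^ e"
    using eval_bound by blast
  \<comment> \<open>\<open>d\<close> counts the remaining rounds, \<open>d + 1\<close> collects the
    sum, \<open>d + 2\<close> is the bound variable, and \<open>d + 3\<close> receives the summand
    and afterwards the constant 1.\<close>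
  let ?body = "Seq (Seq (Seq (Seq q (Add (d + 1) (d + 1) (d + 3))) (Set_Const (d + 3) 1))
      (Add (d + 2) (d + 2) (d + 3))) (Sub d d (d + 3))"
  let ?loop = "Seq (Seq (Seq (Seq p (Set_Const (d + 1) 0)) (Set_Const (d + 2) 0)) (While d ?body))
      (Add d d (d + 1))"
  \<comment> \<open>The exponents mirror the times they bound: \<open>power_add_le\<close>
    contributes 1 for each sum, a single machine step has exponent 0, and 4 bounds the four extra
    steps of the body.\<close>
  let ?B = "(e + 2) * b + 4 + 1"
  let ?C = "a + 0 + 1 + 0 + 1 + (e + (?B + 0 + 1) + 0 + 1) + 1 + 0 + 1"
  show ?case unfolding computes_def
  proof (intro exI[of _ ?loop] exI[of _ ?C] allI impI)
    fix R and A :: "nat \<Rightarrow> nat \<Rightarrow> nat" and M assume M: "\<forall>i. R (\<sigma> i) \<le> (M::nat)"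
    let ?\<beta> = "\<lambda>j. A 0 j \<noteq> (0::nat)" and ?\<rho> = "\<lambda>i. R (\<sigma> i)"
    let ?m = "eval s ?\<beta> ?\<rho>" and ?t = "\<lambda>j. eval t ?\<beta> (case_nat j ?\<rho>)"
    obtain R1 where R1: "run p (R, A) ((M + 2) ^ a) (R1, A)" "\<forall>x<d. R1 x = R x" "R1 d = ?m"
      by (rule computesD[OF p M])
    define Inv where "Inv j s \<longleftrightarrow> (\<exists>R'. s = (R', A) \<and> (\<forall>x<d. R' x = R x) \<and> R' d = ?m - j \<and>
      R' (d + 1) = (\<Sum>i<j. ?t i) \<and> R' (d + 2) = j)" for j and s :: state
    have m: "?m \<le> (M + 2) ^ e" using M by (rule e)
    have body: "\<exists>s'. run ?body s ((M + 2) ^ ?B) s' \<and> Inv (Suc j) s'" if jm: "j < ?m" and inv: "Inv j s" for j s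
    proof -
      obtain R' where R': "s = (R', A)" "\<forall>x<d. R' x = R x" "R' d = ?m - j"
        "R' (d + 1) = (\<Sum>i<j. ?t i)" "R' (d + 2) = j" using inv unfolding Inv_def by blast
      have env: "R' (?\<sigma> i) = case_nat j ?\<rho> i" for i
        using R' Sum.prems by (cases i) auto
      have "\<forall>i. R' (?\<sigma> i) \<le> M + ?m"
        unfolding env using M jm by (auto split: nat.split intro: trans_le_add1)
      then obtain R2 where R2: "run q (R', A) ((M + ?m + 2) ^ b) (R2, A)"
        "\<forall>x<d + 3. R2 x = R' x" "R2 (d + 3) = ?t j"
        by (rule computesD[OF q, of R' "M + ?m" A]) (simp add: env)
      let ?R3 = "R2(d + 1 := R2 (d + 1) + R2 (d + 3))"
      let ?R4 = "?R3(d + 3 := 1)"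
      let ?R5 = "?R4(d + 2 := ?R4 (d + 2) + ?R4 (d + 3))"
      let ?R6 = "?R5(d := ?R5 d - ?R5 (d + 3))"
      have "run ?body s ((M + ?m + 2) ^ b + 1 + 1 + 1 + 1) (?R6, A)"
        unfolding R'(1)
        by (rule run_Seq[OF run_Seq[OF run_Seq[OF run_Seq[OF R2(1) run_Add] run_Const] run_Add] run_Sub])
      moreover have "(M + ?m + 2) ^ b + 1 + 1 + 1 + 1 \<le> (M + 2) ^ ?B"
        using power_add_le[OF power_le_power[OF m, of b] const_le_power[of 4 M]] by simp
      ultimately have "run ?body s ((M + 2) ^ ?B) (?R6, A)" by (rule run_mono)
      moreover have "Inv (Suc j) (?R6, A)"
        unfolding Inv_def using R' R2 jm by (intro exI[of _ ?R6]) auto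
      ultimately show ?thesis by blast
    qed
    let ?R2 = "R1(d + 1 := 0, d + 2 := 0)"
    have "Inv 0 (?R2, A)" unfolding Inv_def using R1 by (intro exI[of _ ?R2]) auto
    then obtain s' where s': "run (While d ?body) (?R2, A) (?m * ((M + 2) ^ ?B + 1) + 1) s'" "Inv ?m s'"
      by (rule run_While[where Inv = Inv and m = ?m and x = d and p = ?body and B = "(M + 2) ^ ?B"])
        (use body in \<open>auto simp: Inv_def\<close>)
    obtain R' where R': "s' = (R', A)" "\<forall>x<d. R' x = R x" "R' d = 0"
      "R' (d + 1) = (\<Sum>i<?m. ?t i)" using s'(2) unfolding Inv_def by auto
    have "run ?loop (R, A) ((M + 2) ^ a + 1 + 1 + (?m * ((M + 2) ^ ?B + 1) + 1) + 1)
        (R'(d := R' d + R' (d + 1)), A)"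
      by (rule run_Seq[OF run_Seq[OF run_Seq[OF run_Seq[OF R1(1) run_Const] run_Const]
            s'(1)[unfolded R'(1)]] run_Add])
    moreover have "(M + 2) ^ a + 1 + 1 + (?m * ((M + 2) ^ ?B + 1) + 1) + 1 \<le> (M + 2) ^ ?C"
      by (intro power_add_le power_mult_le m order_refl) simp_all
    ultimately have "run ?loop (R, A) ((M + 2) ^ ?C) (R'(d := R' d + R' (d + 1)), A)"
      by (rule run_mono)
    then show "\<exists>R'. run ?loop (R, A) ((M + 2) ^ ?C) (R', A) \<and> (\<forall>x<d. R' x = R x) \<and>
        R' d = eval (Sum s t) ?\<beta> ?\<rho>"
      using R' by (intro exI[of _ "R'(d := R' d + R' (d + 1))"] conjI) auto
  qed
qed

section \<open>Closure properties of definable functions and predicates\<close>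

definition definable :: "((nat \<Rightarrow> bool) \<Rightarrow> (nat \<Rightarrow> nat) \<Rightarrow> nat) \<Rightarrow> bool" where
  "definable f \<longleftrightarrow> (\<exists>t. \<forall>\<beta> \<rho>. eval t \<beta> \<rho> = f \<beta> \<rho>)"

definition definable_pred :: "((nat \<Rightarrow> bool) \<Rightarrow> (nat \<Rightarrow> nat) \<Rightarrow> bool) \<Rightarrow> bool" where
  "definable_pred P \<longleftrightarrow> definable (\<lambda>\<beta> \<rho>. of_bool (P \<beta> \<rho>))"

lemma definable_var: "definable (\<lambda>\<beta> \<rho>. \<rho> i)"
  unfolding definable_def by (rule exI[of _ "Var i"]) simp

lemma definable_const: "definable (\<lambda>\<beta> \<rho>. c)"
  unfolding definable_def by (rule exI[of _ "Num c"]) simp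

lemma definable_add: "definable f \<Longrightarrow> definable g \<Longrightarrow> definable (\<lambda>\<beta> \<rho>. f \<beta> \<rho> + g \<beta> \<rho>)"
  unfolding definable_def by (metis eval.simps(3))

lemma definable_diff: "definable f \<Longrightarrow> definable g \<Longrightarrow> definable (\<lambda>\<beta> \<rho>. f \<beta> \<rho> - g \<beta> \<rho>)"
  unfolding definable_def by (metis eval.simps(4))

lemma definable_bit: "definable f \<Longrightarrow> definable_pred (\<lambda>\<beta> \<rho>. \<beta> (f \<beta> \<rho>))"
  unfolding definable_def definable_pred_def by (metis eval.simps(5))

text \<open>The binder in semantic form, a pattern shared by all rules with bound variables: in the
  body, variable 0 is the bound one and the others are shifted by one.\<close>

lemma definable_sum:
  assumes "definable f" "definable (\<lambda>\<beta> \<rho>. g \<beta> (\<lambda>i. \<rho> (Suc i)) (\<rho> 0))"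
  shows "definable (\<lambda>\<beta> \<rho>. \<Sum>i<f \<beta> \<rho>. g \<beta> \<rho> i)"
proof -
  obtain s t where "\<forall>\<beta> \<rho>. eval s \<beta> \<rho> = f \<beta> \<rho>" "\<forall>\<beta> \<rho>. eval t \<beta> \<rho> = g \<beta> (\<lambda>i. \<rho> (Suc i)) (\<rho> 0)"
    using assms unfolding definable_def by (elim exE)
  then show ?thesis unfolding definable_def by (intro exI[of _ "Sum s t"]) simp
qed

primrec rename_vars :: "(nat \<Rightarrow> nat) \<Rightarrow> expr \<Rightarrow> expr" where
  "rename_vars r (Var i) = Var (r i)"
| "rename_vars r (Num c) = Num c"
| "rename_vars r (Plus s t) = Plus (rename_vars r s) (rename_vars r t)"
| "rename_vars r (Minus s t) = Minus (rename_vars r s) (rename_vars r t)"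
| "rename_vars r (Bit t) = Bit (rename_vars r t)"
| "rename_vars r (Sum s t) = Sum (rename_vars r s) (rename_vars (case_nat 0 (\<lambda>i. Suc (r i))) t)"

lemma eval_rename_vars: "eval (rename_vars r t) \<beta> \<rho> = eval t \<beta> (\<lambda>i. \<rho> (r i))"
proof (induction t arbitrary: r \<rho>)
  case (Sum s t)
  have "(\<lambda>j. case_nat i \<rho> (case_nat 0 (\<lambda>i. Suc (r i)) j)) = case_nat i (\<lambda>i. \<rho> (r i))" for i
    by (auto simp: fun_eq_iff split: nat.split)
  then show ?case by (simp add: Sum)
qed simp_all

lemma definable_rename: "definable f \<Longrightarrow> definable (\<lambda>\<beta> \<rho>. f \<beta> (\<lambda>i. \<rho> (r i)))"
  unfolding definable_def by (metis eval_rename_vars)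

lemma definable_mult:
  assumes "definable f" "definable g"
  shows "definable (\<lambda>\<beta> \<rho>. f \<beta> \<rho> * g \<beta> \<rho>)"
  using definable_sum[OF assms(1), of "\<lambda>\<beta> \<rho> i. g \<beta> \<rho>"] definable_rename[OF assms(2), of Suc] by simp

lemma definable_power: "definable f \<Longrightarrow> definable (\<lambda>\<beta> \<rho>. f \<beta> \<rho> ^ c)"
  by (induction c) (auto intro: definable_const definable_mult)

lemma pred_not:
  assumes "definable_pred P"
  shows "definable_pred (\<lambda>\<beta> \<rho>. \<not> P \<beta> \<rho>)"
proof -
  have "of_bool (\<not> b) = 1 - (of_bool b :: nat)" for b by simp
  then show ?thesis
    using definable_diff[OF definable_const[of 1] assms[unfolded definable_pred_def]]
    unfolding definable_pred_def by (simp only:)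
qed

lemma pred_conj: "definable_pred P \<Longrightarrow> definable_pred Q \<Longrightarrow> definable_pred (\<lambda>\<beta> \<rho>. P \<beta> \<rho> \<and> Q \<beta> \<rho>)"
  unfolding definable_pred_def of_bool_conj by (rule definable_mult)

lemma pred_disj:
  assumes "definable_pred P" "definable_pred Q"
  shows "definable_pred (\<lambda>\<beta> \<rho>. P \<beta> \<rho> \<or> Q \<beta> \<rho>)"
  using pred_not[OF pred_conj[OF assms[THEN pred_not]]] by simp

lemma pred_imp:
  assumes "definable_pred P" "definable_pred Q"
  shows "definable_pred (\<lambda>\<beta> \<rho>. P \<beta> \<rho> \<longrightarrow> Q \<beta> \<rho>)"
  using pred_disj[OF pred_not[OF assms(1)] assms(2)] by (simp only: imp_conv_disj)

lemma pred_iff: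
  assumes "definable_pred P" "definable_pred Q"
  shows "definable_pred (\<lambda>\<beta> \<rho>. P \<beta> \<rho> \<longleftrightarrow> Q \<beta> \<rho>)"
  using pred_conj[OF pred_imp[OF assms] pred_imp[OF assms(2,1)]] by (simp only: iff_conv_conj_imp)

lemma pred_if:
  assumes "definable_pred P" "definable_pred Q" "definable_pred R"
  shows "definable_pred (\<lambda>\<beta> \<rho>. if P \<beta> \<rho> then Q \<beta> \<rho> else R \<beta> \<rho>)"
  using pred_conj[OF pred_imp[OF assms(1,2)] pred_imp[OF pred_not[OF assms(1)] assms(3)]]
  by (simp only: if_bool_eq_conj)

lemma pred_const: "definable_pred (\<lambda>\<beta> \<rho>. b)"
  unfolding definable_pred_def by (rule definable_const)

lemma pred_less:
  assumes "definable f" "definable g"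
  shows "definable_pred (\<lambda>\<beta> \<rho>. f \<beta> \<rho> < g \<beta> \<rho>)"
proof -
  \<comment> \<open>Two truncated subtractions from 1 extract the sign of
    \<open>y - x\<close>.\<close>
  have "of_bool (x < y) = 1 - (1 - (y - x))" for x y :: nat by auto
  then show ?thesis
    unfolding definable_pred_def by (simp only:) (intro definable_diff definable_const assms)
qed

lemma pred_le:
  assumes "definable f" "definable g"
  shows "definable_pred (\<lambda>\<beta> \<rho>. f \<beta> \<rho> \<le> g \<beta> \<rho>)"
  using pred_not[OF pred_less[OF assms(2,1)]] by (simp add: not_less)

lemma pred_eq:
  assumes "definable f" "definable g"
  shows "definable_pred (\<lambda>\<beta> \<rho>. f \<beta> \<rho> = g \<beta> \<rho>)"
  using pred_conj[OF pred_le[OF assms] pred_le[OF assms(2,1)]] by (simp add: eq_iff)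

lemma pred_ex:
  assumes "definable f" "definable_pred (\<lambda>\<beta> \<rho>. P \<beta> (\<lambda>i. \<rho> (Suc i)) (\<rho> 0))"
  shows "definable_pred (\<lambda>\<beta> \<rho>. \<exists>i<f \<beta> \<rho>. P \<beta> \<rho> i)"
proof -
  have ex: "(\<exists>i<m. Q i) \<longleftrightarrow> 0 < (\<Sum>i<m. of_bool (Q i) :: nat)" for m and Q :: "nat \<Rightarrow> bool"
    by (induction m) (auto simp: less_Suc_eq)
  have "definable (\<lambda>\<beta> \<rho>. \<Sum>i<f \<beta> \<rho>. of_bool (P \<beta> \<rho> i))"
    by (rule definable_sum[OF assms(1) assms(2)[unfolded definable_pred_def]])
  from pred_less[OF definable_const[of 0] this] show ?thesis by (simp only: ex)
qed

lemma pred_all: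
  assumes "definable f" "definable_pred (\<lambda>\<beta> \<rho>. P \<beta> (\<lambda>i. \<rho> (Suc i)) (\<rho> 0))"
  shows "definable_pred (\<lambda>\<beta> \<rho>. \<forall>i<f \<beta> \<rho>. P \<beta> \<rho> i)"
  using pred_not[OF pred_ex[of f "\<lambda>\<beta> \<rho> i. \<not> P \<beta> \<rho> i", OF assms(1) pred_not[OF assms(2)]]] by simp

text \<open>In contrast to \<open>pred_all\<close> the bound is a fixed number: the conjunction is
  written out, so \<open>P i\<close> may depend on \<open>i\<close> arbitrarily, for instance
  through exponents.\<close>

lemma pred_Ball:
  fixes q :: nat
  assumes "\<And>i. i < q \<Longrightarrow> definable_pred (P i)"
  shows "definable_pred (\<lambda>\<beta> \<rho>. \<forall>i\<in>{..<q}. P i \<beta> \<rho>)"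
  using assms
proof (induction q)
  case (Suc q)
  then show ?case using pred_conj[of "\<lambda>\<beta> \<rho>. \<forall>i\<in>{..<q}. P i \<beta> \<rho>" "P q"]
    by (simp add: lessThan_Suc conj_commute)
qed (simp add: pred_const)

lemma pred_Bex:
  fixes q :: nat
  assumes "\<And>i. i < q \<Longrightarrow> definable_pred (P i)"
  shows "definable_pred (\<lambda>\<beta> \<rho>. \<exists>i\<in>{..<q}. P i \<beta> \<rho>)"
  using pred_not[OF pred_Ball[of q "\<lambda>i \<beta> \<rho>. \<not> P i \<beta> \<rho>"]] pred_not assms by simp

lemma definable_card:
  assumes "definable f" "definable_pred (\<lambda>\<beta> \<rho>. P \<beta> (\<lambda>i. \<rho> (Suc i)) (\<rho> 0))"
  shows "definable (\<lambda>\<beta> \<rho>. card {i. i < f \<beta> \<rho> \<and> P \<beta> \<rho> i})"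
proof -
  have "card {i. i < x \<and> Q i} = (\<Sum>i<x. of_bool (Q i))" for x and Q :: "nat \<Rightarrow> bool"
    using sum.inter_filter[of "{..<x}" "\<lambda>_. 1::nat" Q]
    by (simp add: of_bool_def lessThan_def cong: conj_cong)
  then show ?thesis
    using definable_sum[OF assms(1) assms(2)[unfolded definable_pred_def]] by simp
qed

lemma definable_div:
  assumes "definable f" "definable g"
  shows "definable (\<lambda>\<beta> \<rho>. f \<beta> \<rho> div g \<beta> \<rho>)"
proof -
  have "x div y = card {i. i < x \<and> 0 < y \<and> (i + 1) * y \<le> x}" for x y :: nat
  proof (cases "y = 0")
    case False
    have "i < x div y \<longleftrightarrow> (i + 1) * y \<le> x" for i
      using less_eq_div_iff_mult_less_eq[of y "i + 1" x] False by (simp add: Suc_le_eq)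
    moreover have "i < x" if "(i + 1) * y \<le> x" for i
      using that False by (cases y) auto
    ultimately have "{i. i < x \<and> 0 < y \<and> (i + 1) * y \<le> x} = {..<x div y}"
      using False by auto
    then show ?thesis by simp
  qed simp
  then show ?thesis
    by (simp only:) (intro definable_card pred_conj pred_less pred_le definable_mult definable_add
      definable_const definable_var definable_rename[OF assms(1), of Suc] definable_rename[OF assms(2), of Suc] assms)
qed

lemma definable_mod:
  assumes "definable f" "definable g"
  shows "definable (\<lambda>\<beta> \<rho>. f \<beta> \<rho> mod g \<beta> \<rho>)"
  unfolding modulo_nat_def by (intro definable_diff definable_mult definable_div assms)

text \<open>Substitution by a bounded quantifier with one admissible value. It reduces arguments to
  variables, which are merely shifted under a binder, whereas an arbitrary \<open>a\<close> would
  have to be renamed there.\<close>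

lemma pred_let:
  assumes "definable_pred (\<lambda>\<beta> \<rho>. P \<beta> (\<lambda>i. \<rho> (Suc i)) (\<rho> 0))" "definable a"
  shows "definable_pred (\<lambda>\<beta> \<rho>. P \<beta> \<rho> (a \<beta> \<rho>))"
proof -
  have "definable_pred (\<lambda>\<beta> \<rho>. \<exists>x<a \<beta> \<rho> + 1. x = a \<beta> \<rho> \<and> P \<beta> \<rho> x)"
    by (intro pred_ex pred_conj pred_eq assms definable_add definable_const definable_var
      definable_rename[OF assms(2), of Suc])
  then show ?thesis by simp
qed

lemma definable_let:
  assumes "definable (\<lambda>\<beta> \<rho>. g \<beta> (\<lambda>i. \<rho> (Suc i)) (\<rho> 0))" "definable a"
  shows "definable (\<lambda>\<beta> \<rho>. g \<beta> \<rho> (a \<beta> \<rho>))"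
proof -
  have "definable (\<lambda>\<beta> \<rho>. \<Sum>x<a \<beta> \<rho> + 1. of_bool (x = a \<beta> \<rho>) * g \<beta> \<rho> x)"
    by (intro definable_sum definable_mult assms definable_add definable_const definable_var
      definable_rename[OF assms(2), of Suc] pred_eq[unfolded definable_pred_def])
  moreover have "(\<Sum>x<a \<beta> \<rho> + 1. of_bool (x = a \<beta> \<rho>) * g \<beta> \<rho> x) = g \<beta> \<rho> (a \<beta> \<rho>)" for \<beta> \<rho>
    by (simp add: sum.delta of_bool_def if_distrib[of "\<lambda>x. x * _"] cong: if_cong)
  ultimately show ?thesis by simp
qed

lemma pred_rename: "definable_pred f \<Longrightarrow> definable_pred (\<lambda>\<beta> \<rho>. f \<beta> (\<lambda>i. \<rho> (r i)))"
  unfolding definable_pred_def by (rule definable_rename)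

lemma definable_comp1:
  assumes "definable (\<lambda>\<beta> \<rho>. f \<beta> (\<rho> 0))" "definable a"
  shows "definable (\<lambda>\<beta> \<rho>. f \<beta> (a \<beta> \<rho>))"
  using assms by (rule definable_let)

lemma pred_comp1:
  assumes "definable_pred (\<lambda>\<beta> \<rho>. f \<beta> (\<rho> 0))" "definable a"
  shows "definable_pred (\<lambda>\<beta> \<rho>. f \<beta> (a \<beta> \<rho>))"
  using assms by (rule pred_let)

lemma definable_comp2:
  assumes "definable (\<lambda>\<beta> \<rho>. f \<beta> (\<rho> 0) (\<rho> 1))" "definable a" "definable b"
  shows "definable (\<lambda>\<beta> \<rho>. f \<beta> (a \<beta> \<rho>) (b \<beta> \<rho>))"
proof (rule definable_let[OF _ assms(2)])
  show "definable (\<lambda>\<beta> \<rho>. f \<beta> (\<rho> 0) (b \<beta> (\<lambda>i. \<rho> (Suc i))))"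
  proof (rule definable_let[of "\<lambda>\<beta> \<rho> y. f \<beta> (\<rho> 0) y"])
    show "definable (\<lambda>\<beta> \<rho>. f \<beta> (\<rho> (Suc 0)) (\<rho> 0))"
      using definable_rename[OF assms(1), of "\<lambda>i. 1 - i"] by simp
  qed (rule definable_rename[OF assms(3)])
qed

lemma pred_comp2:
  assumes "definable_pred (\<lambda>\<beta> \<rho>. f \<beta> (\<rho> 0) (\<rho> 1))" "definable a" "definable b"
  shows "definable_pred (\<lambda>\<beta> \<rho>. f \<beta> (a \<beta> \<rho>) (b \<beta> \<rho>))"
  using definable_comp2[of "\<lambda>\<beta> x y. of_bool (f \<beta> x y)" a b] assms unfolding definable_pred_def by blast

lemma pred_comp3:
  assumes "definable_pred (\<lambda>\<beta> \<rho>. f \<beta> (\<rho> 0) (\<rho> 1) (\<rho> 2))" "definable a" "definable b" "definable c"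
  shows "definable_pred (\<lambda>\<beta> \<rho>. f \<beta> (a \<beta> \<rho>) (b \<beta> \<rho>) (c \<beta> \<rho>))"
proof (rule pred_let[OF _ assms(2)])
  show "definable_pred (\<lambda>\<beta> \<rho>. f \<beta> (\<rho> 0) (b \<beta> (\<lambda>i. \<rho> (Suc i))) (c \<beta> (\<lambda>i. \<rho> (Suc i))))"
  proof (rule pred_let[of "\<lambda>\<beta> \<rho> y. f \<beta> (\<rho> 0) y (c \<beta> (\<lambda>i. \<rho> (Suc i)))"])
    show "definable_pred (\<lambda>\<beta> \<rho>. f \<beta> (\<rho> (Suc 0)) (\<rho> 0) (c \<beta> (\<lambda>i. \<rho> (Suc (Suc i)))))"
    proof (rule pred_let[of "\<lambda>\<beta> \<rho> z. f \<beta> (\<rho> (Suc 0)) (\<rho> 0) z"])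
      show "definable_pred (\<lambda>\<beta> \<rho>. f \<beta> (\<rho> (Suc (Suc 0))) (\<rho> (Suc 0)) (\<rho> 0))"
        \<comment> \<open>The nested substitutions introduce the arguments in reverse order.\<close>
        using pred_rename[OF assms(1), of "\<lambda>i. 2 - i"] by (simp add: numeral_2_eq_2)
    qed (rule definable_rename[OF assms(4)])
  qed (rule definable_rename[OF assms(3)])
qed

named_theorems definable_intros
lemmas [definable_intros] = definable_var definable_const definable_add definable_diff definable_bit
  definable_sum definable_mult definable_power pred_not pred_conj pred_disj pred_imp pred_iff pred_if
  pred_less pred_le pred_eq pred_ex pred_all pred_Ball pred_Bex definable_card definable_div definable_mod

lemma computesI:
  assumes "definable f" "\<And>i. \<sigma> i < d"
  obtains p C where "\<And>R A M. (\<forall>i. R (\<sigma> i) \<le> M) \<Longrightarrow> \<exists>R'. run p (R, A) ((M + 2) ^ C) (R', A) \<and>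
    (\<forall>x<d. R' x = R x) \<and> R' d = f (\<lambda>j. A 0 j \<noteq> 0) (\<lambda>i. R (\<sigma> i))"
proof -
  obtain t where t: "\<forall>\<beta> \<rho>. eval t \<beta> \<rho> = f \<beta> \<rho>" using assms(1) by (auto simp: definable_def)
  obtain p C where "computes p C \<sigma> d t" using compile[of \<sigma> d t] assms(2) by blast
  then show ?thesis using that[of p C] t unfolding computes_def by auto
qed

lemma definable_bound:
  assumes "definable f"
  shows "\<exists>C. \<forall>\<beta> \<rho> M. (\<forall>i. \<rho> i \<le> M) \<longrightarrow> f \<beta> \<rho> \<le> (M + 2) ^ C"
proof -
  obtain t where t: "\<forall>\<beta> \<rho>. eval t \<beta> \<rho> = f \<beta> \<rho>" using assms(1) by (auto simp: definable_def)
  then show ?thesis using eval_bound[of t] by simp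
qed

text \<open>
  The output is first written to array 1, as array 0 holds the input, and then copied. Nothing is
  assumed about the initial contents of the memory.
\<close>

lemma transducer:
  assumes len: "definable len" and par: "definable par" and out: "definable_pred out"
  obtains p C where "\<And>R A. \<exists>s. run p (R, A) ((R 0 + R 1 + 2) ^ C) s \<and>
    output_of s = (map (\<lambda>i. out (\<lambda>j. A 0 j \<noteq> 0) (case_nat i (case_nat (R 0) (\<lambda>_. R 1))))
        [0..<len (\<lambda>j. A 0 j \<noteq> 0) (case_nat (R 0) (\<lambda>_. R 1))],
      par (\<lambda>j. A 0 j \<noteq> 0) (case_nat (R 0) (\<lambda>_. R 1)))"
proof -
  \<comment> \<open>Registers 0 and 1 keep the input length and parameter, 2 and 3 get the new
    length and parameter, 4 counts the remaining rounds, 5 is the current position, and the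
    registers from 6 on are scratch.\<close>
  let ?\<sigma> = "case_nat 0 (\<lambda>_. 1) :: nat \<Rightarrow> nat" and ?\<sigma>' = "case_nat 5 (case_nat 0 (\<lambda>_. 1)) :: nat \<Rightarrow> nat"
  obtain p1 a where p1: "\<And>R A M. (\<forall>i. R (?\<sigma> i) \<le> M) \<Longrightarrow> \<exists>R'. run p1 (R, A) ((M + 2) ^ a) (R', A) \<and>
    (\<forall>x<2. R' x = R x) \<and> R' 2 = len (\<lambda>j. A 0 j \<noteq> 0) (\<lambda>i. R (?\<sigma> i))"
    by (rule computesI[OF len, of ?\<sigma> 2]) (auto split: nat.split)
  obtain p2 b where p2: "\<And>R A M. (\<forall>i. R (?\<sigma> i) \<le> M) \<Longrightarrow> \<exists>R'. run p2 (R, A) ((M + 2) ^ b) (R', A) \<and>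
    (\<forall>x<3. R' x = R x) \<and> R' 3 = par (\<lambda>j. A 0 j \<noteq> 0) (\<lambda>i. R (?\<sigma> i))"
    by (rule computesI[OF par, of ?\<sigma> 3]) (auto split: nat.split)
  obtain p3 c where p3: "\<And>R A M. (\<forall>i. R (?\<sigma>' i) \<le> M) \<Longrightarrow> \<exists>R'. run p3 (R, A) ((M + 2) ^ c) (R', A) \<and>
    (\<forall>x<6. R' x = R x) \<and> R' 6 = of_bool (out (\<lambda>j. A 0 j \<noteq> 0) (\<lambda>i. R (?\<sigma>' i)))"
    by (rule computesI[OF out[unfolded definable_pred_def], of ?\<sigma>' 6]) (auto split: nat.split)
  obtain e where e: "\<And>\<beta> \<rho> M. (\<forall>i. \<rho> i \<le> M) \<Longrightarrow> len \<beta> \<rho> \<le> (M + 2) ^ e"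
    using definable_bound[OF len] by blast
  let ?step = "\<lambda>p. Seq (Seq (Seq p (Set_Const 6 1)) (Add 5 5 6)) (Sub 4 4 6)"
  let ?loop = "\<lambda>p. Seq (Seq (Seq (Set_Const 5 0) (Set_Const 4 0)) (Add 4 4 2)) (While 4 (?step p))"
  let ?q = "Seq p3 (Store 1 5 6)" and ?q' = "Seq (Load 6 1 5) (Store 0 5 6)"
  let ?p = "Seq (Seq (Seq (Seq (Seq (Seq p1 p2) (?loop ?q)) (?loop ?q')) (Set_Const 4 0)) (Add 0 4 2)) (Add 1 4 3)"
  let ?B = "(e + 2) * c + 4 + 1"
  let ?L = "3 + (e + (?B + 0 + 1) + 0 + 1) + 1"
  let ?C = "a + b + 1 + ?L + 1 + ?L + 1 + 0 + 1 + 0 + 1 + 0 + 1"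
  have "\<exists>s. run ?p (R, A) ((R 0 + R 1 + 2) ^ ?C) s \<and>
    output_of s = (map (\<lambda>i. out (\<lambda>j. A 0 j \<noteq> 0) (case_nat i (case_nat (R 0) (\<lambda>_. R 1))))
        [0..<len (\<lambda>j. A 0 j \<noteq> 0) (case_nat (R 0) (\<lambda>_. R 1))],
      par (\<lambda>j. A 0 j \<noteq> 0) (case_nat (R 0) (\<lambda>_. R 1)))" for R and A :: "nat \<Rightarrow> nat \<Rightarrow> nat"
  proof -
    let ?M = "R 0 + R 1" and ?\<beta> = "\<lambda>j. A 0 j \<noteq> (0::nat)" and ?\<rho> = "case_nat (R 0) (\<lambda>_. R 1) :: nat \<Rightarrow> nat"
    let ?n = "len ?\<beta> ?\<rho>"
    define bt where "bt i = out ?\<beta> (case_nat i ?\<rho>)" for i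
    have n: "?n \<le> (?M + 2) ^ e" by (rule e) (simp split: nat.split)
    have \<sigma>: "(\<lambda>i. R' (?\<sigma> i)) = ?\<rho>" if "R' 0 = R 0" "R' 1 = R 1" for R'
      using that by (auto simp: fun_eq_iff split: nat.split)
    have \<rho>M: "\<forall>i. R' (?\<sigma> i) \<le> ?M" if "R' 0 = R 0" "R' 1 = R 1" for R'
      using that by (auto split: nat.split)
    obtain R1 where R1: "run p1 (R, A) ((?M + 2) ^ a) (R1, A)" "\<forall>x<2. R1 x = R x" "R1 2 = ?n"
      using p1[OF \<rho>M[of R], of A] \<sigma>[of R] by auto
    obtain R2 where R2: "run p2 (R1, A) ((?M + 2) ^ b) (R2, A)" "\<forall>x<3. R2 x = R1 x" "R2 3 = par ?\<beta> ?\<rho>"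
      using p2[OF \<rho>M[of R1], of A] \<sigma>[of R1] R1(2) by auto
    let ?k = "par ?\<beta> ?\<rho>"
    define Frame where "Frame R' \<longleftrightarrow> R' 0 = R 0 \<and> R' 1 = R 1 \<and> R' 2 = ?n \<and> R' 3 = ?k"
      for R' :: "nat \<Rightarrow> nat"
    \<comment> \<open>Serves both the writing and the copying loop; \<open>I j\<close> describes the
      arrays after \<open>j\<close> rounds.\<close>
    have loop: "\<exists>R'' A''. run (?loop p) (R', A') ((?M + 2) ^ ?L) (R'', A'') \<and> Frame R'' \<and> I ?n A''"
      if R': "Frame R'" and I0: "I 0 A'"
        and step: "\<And>j R' A'. j < ?n \<Longrightarrow> Frame R' \<Longrightarrow> R' 5 = j \<Longrightarrow> I j A' \<Longrightarrow> \<exists>R'' A''.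
          run p (R', A') ((?M + ?n + 2) ^ c + 1) (R'', A'') \<and> (\<forall>x<6. R'' x = R' x) \<and> I (Suc j) A''"
      for R' A' p and I :: "nat \<Rightarrow> (nat \<Rightarrow> nat \<Rightarrow> nat) \<Rightarrow> bool"
    proof -
      define Inv where "Inv j s \<longleftrightarrow> Frame (fst s) \<and> fst s 5 = j \<and> fst s 4 = ?n - j \<and> I j (snd s)"
        for j and s :: state
      have body: "\<exists>s'. run (?step p) s ((?M + 2) ^ ?B) s' \<and> Inv (Suc j) s'"
        if jn: "j < ?n" and Inv: "Inv j s" for j s
      proof -
        obtain R1 A1 where s: "s = (R1, A1)" by fastforce
        have inv: "Frame R1" "R1 5 = j" "R1 4 = ?n - j" "I j A1" using Inv by (auto simp: s Inv_def)
        obtain R2 A2 where R2: "run p (R1, A1) ((?M + ?n + 2) ^ c + 1) (R2, A2)" "\<forall>x<6. R2 x = R1 x"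
          "I (Suc j) A2" using step[OF jn inv(1,2,4)] by blast
        let ?R3 = "R2(6 := 1)"
        let ?R4 = "?R3(5 := ?R3 5 + ?R3 6)"
        let ?R5 = "?R4(4 := ?R4 4 - ?R4 6)"
        have "run (?step p) s ((?M + ?n + 2) ^ c + 1 + 1 + 1 + 1) (?R5, A2)"
          unfolding s by (rule run_Seq[OF run_Seq[OF run_Seq[OF R2(1) run_Const] run_Add] run_Sub])
        moreover have "(?M + ?n + 2) ^ c + 1 + 1 + 1 + 1 \<le> (?M + 2) ^ ?B"
          using power_add_le[OF power_le_power[OF n, of c] const_le_power[of 4 ?M]] by simp
        ultimately have "run (?step p) s ((?M + 2) ^ ?B) (?R5, A2)" by (rule run_mono)
        moreover have "Inv (Suc j) (?R5, A2)"
          using inv R2(2,3) unfolding Inv_def Frame_def by simp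
        ultimately show ?thesis by blast
      qed
      let ?R3 = "R'(5 := 0, 4 := 0)"
      let ?R4 = "?R3(4 := ?R3 4 + ?R3 2)"
      have "Inv 0 (?R4, A')" using R' I0 by (simp add: Inv_def Frame_def)
      then obtain s' where s': "run (While 4 (?step p)) (?R4, A') (?n * ((?M + 2) ^ ?B + 1) + 1) s'" "Inv ?n s'"
        by (rule run_While[where Inv = Inv and m = ?n and x = 4 and p = "?step p" and B = "(?M + 2) ^ ?B"])
          (use body in \<open>auto simp: Inv_def\<close>)
      have "run (?loop p) (R', A') (1 + 1 + 1 + (?n * ((?M + 2) ^ ?B + 1) + 1)) s'"
        by (rule run_Seq[OF run_Seq[OF run_Seq[OF run_Const run_Const] run_Add] s'(1)])
      moreover have "1 + 1 + 1 + (?n * ((?M + 2) ^ ?B + 1) + 1) \<le> (?M + 2) ^ ?L"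
        by (intro power_add_le[OF order_trans[OF _ const_le_power]] power_add_le power_mult_le n order_refl)
          simp_all
      ultimately have "run (?loop p) (R', A') ((?M + 2) ^ ?L) s'" by (rule run_mono)
      then show ?thesis using s'(2) by (cases s') (auto simp: Inv_def)
    qed
    have "Frame R2" using R1 R2 by (simp add: Frame_def)
    then have "\<exists>R'' A''. run (?loop ?q) (R2, A) ((?M + 2) ^ ?L) (R'', A'') \<and> Frame R'' \<and>
        A'' 0 = A 0 \<and> (\<forall>i<?n. A'' 1 i = of_bool (bt i))"
    proof (rule loop[where I = "\<lambda>j A''. A'' 0 = A 0 \<and> (\<forall>i<j. A'' 1 i = of_bool (bt i))"])
      fix j R' and A' :: "nat \<Rightarrow> nat \<Rightarrow> nat"
      assume *: "j < ?n" "Frame R'" "R' 5 = j" "A' 0 = A 0 \<and> (\<forall>i<j. A' 1 i = of_bool (bt i))"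
      have env: "(\<lambda>i. R' (?\<sigma>' i)) = case_nat j ?\<rho>"
        using * by (auto simp: fun_eq_iff Frame_def split: nat.split)
      have "\<forall>i. R' (?\<sigma>' i) \<le> ?M + ?n"
        using *(1,2,3) by (auto simp: Frame_def split: nat.split)
      from p3[OF this, of A'] obtain R3 where R3: "run p3 (R', A') ((?M + ?n + 2) ^ c) (R3, A')"
        "\<forall>x<6. R3 x = R' x" "R3 6 = of_bool (bt j)"
        unfolding env bt_def using *(4) by auto
      have "run ?q (R', A') ((?M + ?n + 2) ^ c + 1) (R3, A'(1 := (A' 1)(R3 5 := R3 6)))"
        by (rule run_Seq[OF R3(1) run_Store])
      then show "\<exists>R'' A''. run ?q (R', A') ((?M + ?n + 2) ^ c + 1) (R'', A'') \<and> (\<forall>x<6. R'' x = R' x) \<and>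
          A'' 0 = A 0 \<and> (\<forall>i<Suc j. A'' 1 i = of_bool (bt i))"
        using R3 * by (intro exI[of _ R3] exI[of _ "A'(1 := (A' 1)(R3 5 := R3 6))"]) (auto simp: less_Suc_eq)
    qed simp
    then obtain R3 A3 where R3: "run (?loop ?q) (R2, A) ((?M + 2) ^ ?L) (R3, A3)" "Frame R3"
      "\<forall>i<?n. A3 1 i = of_bool (bt i)" by blast
    have "\<exists>R'' A''. run (?loop ?q') (R3, A3) ((?M + 2) ^ ?L) (R'', A'') \<and> Frame R'' \<and>
        A'' 1 = A3 1 \<and> (\<forall>i<?n. A'' 0 i = of_bool (bt i))"
    proof (rule loop[OF R3(2), where I = "\<lambda>j A''. A'' 1 = A3 1 \<and> (\<forall>i<j. A'' 0 i = of_bool (bt i))"])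
      fix j R' and A' :: "nat \<Rightarrow> nat \<Rightarrow> nat"
      assume *: "j < ?n" "Frame R'" "R' 5 = j" "A' 1 = A3 1 \<and> (\<forall>i<j. A' 0 i = of_bool (bt i))"
      let ?R4 = "R'(6 := A' 1 (R' 5))"
      have "run ?q' (R', A') (1 + 1) (?R4, A'(0 := (A' 0)(?R4 5 := ?R4 6)))"
        by (rule run_Seq[OF run_Load run_Store])
      then have "run ?q' (R', A') ((?M + ?n + 2) ^ c + 1) (?R4, A'(0 := (A' 0)(?R4 5 := ?R4 6)))"
        by (rule run_mono) simp
      then show "\<exists>R'' A''. run ?q' (R', A') ((?M + ?n + 2) ^ c + 1) (R'', A'') \<and> (\<forall>x<6. R'' x = R' x) \<and>
          A'' 1 = A3 1 \<and> (\<forall>i<Suc j. A'' 0 i = of_bool (bt i))"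
        using R3(3) * by (intro exI[of _ ?R4] exI[of _ "A'(0 := (A' 0)(?R4 5 := ?R4 6))"]) (auto simp: less_Suc_eq)
    qed simp
    then obtain R4 A4 where R4: "run (?loop ?q') (R3, A3) ((?M + 2) ^ ?L) (R4, A4)" "Frame R4"
      "\<forall>i<?n. A4 0 i = of_bool (bt i)" by blast
    let ?R5 = "R4(4 := 0)"
    let ?R6 = "?R5(0 := ?R5 4 + ?R5 2)"
    let ?R7 = "?R6(1 := ?R6 4 + ?R6 3)"
    have "run ?p (R, A) ((?M + 2) ^ a + (?M + 2) ^ b + (?M + 2) ^ ?L + (?M + 2) ^ ?L + 1 + 1 + 1) (?R7, A4)"
      by (rule run_Seq[OF run_Seq[OF run_Seq[OF run_Seq[OF run_Seq[OF run_Seq[OF R1(1) R2(1)] R3(1)]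
            R4(1)] run_Const] run_Add] run_Add])
    moreover have "(?M + 2) ^ a + (?M + 2) ^ b + (?M + 2) ^ ?L + (?M + 2) ^ ?L + 1 + 1 + 1 \<le> (?M + 2) ^ ?C"
      by (intro power_add_le order_refl) simp_all
    ultimately have "run ?p (R, A) ((?M + 2) ^ ?C) (?R7, A4)" by (rule run_mono)
    moreover have "output_of (?R7, A4) = (map bt [0..<?n], ?k)"
      using R4(2,3) by (auto simp: output_of_def Frame_def)
    ultimately show ?thesis unfolding bt_def by blast
  qed
  then show ?thesis by (rule that)
qed

section \<open>Running programs in separate parts of the memory\<close>

primrec rename_prog :: "(nat \<Rightarrow> nat) \<Rightarrow> (nat \<Rightarrow> nat) \<Rightarrow> prog \<Rightarrow> prog" where
  "rename_prog r a (Set_Const x c) = Set_Const (r x) c"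
| "rename_prog r a (Add x y z) = Add (r x) (r y) (r z)"
| "rename_prog r a (Sub x y z) = Sub (r x) (r y) (r z)"
| "rename_prog r a (Load x b y) = Load (r x) (a b) (r y)"
| "rename_prog r a (Store b x y) = Store (a b) (r x) (r y)"
| "rename_prog r a (Seq p q) = Seq (rename_prog r a p) (rename_prog r a q)"
| "rename_prog r a (Cond x p q) = Cond (r x) (rename_prog r a p) (rename_prog r a q)"
| "rename_prog r a (While x p) = While (r x) (rename_prog r a p)"

definition simulates :: "(nat \<Rightarrow> nat) \<Rightarrow> (nat \<Rightarrow> nat) \<Rightarrow> state \<Rightarrow> state \<Rightarrow> bool" where
  "simulates r a s s' \<longleftrightarrow> (\<forall>x. fst s' (r x) = fst s x) \<and> (\<forall>b. snd s' (a b) = snd s b)"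

definition unchanged :: "(nat \<Rightarrow> nat) \<Rightarrow> (nat \<Rightarrow> nat) \<Rightarrow> state \<Rightarrow> state \<Rightarrow> bool" where
  "unchanged r a s s' \<longleftrightarrow> (\<forall>x. x \<notin> range r \<longrightarrow> fst s' x = fst s x) \<and> (\<forall>b. b \<notin> range a \<longrightarrow> snd s' b = snd s b)"

text \<open>Injective renamings keep different cells apart, so the run is copied step by step. Cells
  outside their ranges survive, in particular the results of other programs.\<close>

lemma exec_rename_prog:
  assumes "exec p s T s1" "inj r" "inj a" "simulates r a s s'"
  shows "\<exists>s1'. exec (rename_prog r a p) s' T s1' \<and> simulates r a s1 s1' \<and> unchanged r a s' s1'"
  using assms(1,4)
proof (induction arbitrary: s' rule: exec.induct)
  case (exec_Const x c R A)
  then show ?case using exec.exec_Const[of "r x" c "fst s'" "snd s'"] assms(2)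
    by (intro exI[of _ "((fst s')(r x := c), snd s')"])
      (auto simp: simulates_def unchanged_def inj_eq)
next
  case (exec_Add x y z R A)
  then show ?case using exec.exec_Add[of "r x" "r y" "r z" "fst s'" "snd s'"] assms(2)
    by (intro exI[of _ "((fst s')(r x := fst s' (r y) + fst s' (r z)), snd s')"])
      (auto simp: simulates_def unchanged_def inj_eq)
next
  case (exec_Sub x y z R A)
  then show ?case using exec.exec_Sub[of "r x" "r y" "r z" "fst s'" "snd s'"] assms(2)
    by (intro exI[of _ "((fst s')(r x := fst s' (r y) - fst s' (r z)), snd s')"])
      (auto simp: simulates_def unchanged_def inj_eq)
next
  case (exec_Load x b y R A)
  then show ?case using exec.exec_Load[of "r x" "a b" "r y" "fst s'" "snd s'"] assms(2)
    by (intro exI[of _ "((fst s')(r x := snd s' (a b) (fst s' (r y))), snd s')"])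
      (auto simp: simulates_def unchanged_def inj_eq)
next
  case (exec_Store b x y R A)
  then show ?case using exec.exec_Store[of "a b" "r x" "r y" "fst s'" "snd s'"] assms(3)
    by (intro exI[of _ "(fst s', (snd s')(a b := (snd s' (a b))(fst s' (r x) := fst s' (r y))))"])
      (auto simp: simulates_def unchanged_def inj_eq)
next
  case (exec_Seq p s T s1 q T' s2)
  obtain s1' where 1: "exec (rename_prog r a p) s' T s1'" "simulates r a s1 s1'" "unchanged r a s' s1'"
    using exec_Seq.IH(1)[OF exec_Seq.prems] by blast
  obtain s2' where 2: "exec (rename_prog r a q) s1' T' s2'" "simulates r a s2 s2'" "unchanged r a s1' s2'"
    using exec_Seq.IH(2)[OF 1(2)] by blast
  show ?case using exec.exec_Seq[OF 1(1) 2(1)] 1 2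
    by (intro exI[of _ s2']) (auto simp: unchanged_def)
next
  case (exec_Cond_true R x p A T s1 q)
  then obtain s1' where "exec (rename_prog r a p) s' T s1'" "simulates r a s1 s1'" "unchanged r a s' s1'"
    by blast
  moreover have "fst s' (r x) \<noteq> 0" using exec_Cond_true by (simp add: simulates_def)
  ultimately show ?case using exec.exec_Cond_true[of "fst s'" "r x" _ "snd s'"] by fastforce
next
  case (exec_Cond_false R x q A T s1 p)
  then obtain s1' where "exec (rename_prog r a q) s' T s1'" "simulates r a s1 s1'" "unchanged r a s' s1'"
    by blast
  moreover have "fst s' (r x) = 0" using exec_Cond_false by (simp add: simulates_def)
  ultimately show ?case using exec.exec_Cond_false[of "fst s'" "r x" _ "snd s'"] by fastforce
next
  case (exec_While_false R x p A)
  then have "fst s' (r x) = 0" by (simp add: simulates_def)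
  then have "exec (While (r x) (rename_prog r a p)) (fst s', snd s') 1 (fst s', snd s')"
    by (rule exec.exec_While_false)
  then show ?case using exec_While_false.prems by (intro exI[of _ s']) (auto simp: unchanged_def)
next
  case (exec_While_true R x p A T s1 T' s2)
  have x: "fst s' (r x) \<noteq> 0" using exec_While_true by (simp add: simulates_def)
  obtain s1' where 1: "exec (rename_prog r a p) s' T s1'" "simulates r a s1 s1'" "unchanged r a s' s1'"
    using exec_While_true.IH(1)[OF exec_While_true.prems] by blast
  obtain s2' where 2: "exec (rename_prog r a (While x p)) s1' T' s2'" "simulates r a s2 s2'"
    "unchanged r a s1' s2'"
    using exec_While_true.IH(2)[OF 1(2)] by blast
  have "exec (While (r x) (rename_prog r a p)) (fst s', snd s') (T + T' + 1) s2'"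
    using x 1(1) 2(1) by (intro exec.exec_While_true) simp_all
  then show ?case using 1 2 by (intro exI[of _ s2']) (auto simp: unchanged_def)
qed

text \<open>Provides the computable bounds for the composed reduction. Nothing is known about the
  memory used by the programs for \<open>f\<close> and \<open>g\<close>, so each gets a part of its
  own.\<close>

lemma computable_poly:
  assumes "computable f" "computable g"
  shows "computable (\<lambda>k. (f k + g k + 2) ^ C)"
proof -
  obtain p q where p: "\<And>k. \<exists>T s. exec p (input_state ([], k)) T s \<and> snd (output_of s) = f k"
    and q: "\<And>k. \<exists>T s. exec q (input_state ([], k)) T s \<and> snd (output_of s) = g k"
    using assms unfolding computable_def by blast
  let ?\<sigma> = "case_nat 4 (\<lambda>_. 5) :: nat \<Rightarrow> nat"
  have "definable (\<lambda>\<beta> \<rho>. (\<rho> 0 + \<rho> 1 + 2) ^ C)" by (intro definable_intros)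
  then obtain h D where h: "\<And>R A M. (\<forall>i. R (?\<sigma> i) \<le> M) \<Longrightarrow> \<exists>R'. run h (R, A) ((M + 2) ^ D) (R', A) \<and>
    (\<forall>x<6. R' x = R x) \<and> R' 6 = (R (?\<sigma> 0) + R (?\<sigma> 1) + 2) ^ C"
    by (rule computesI[of _ ?\<sigma> 6]) (auto split: nat.split)
  \<comment> \<open>Even registers from 2 on for \<open>p\<close>, odd ones from 3 on for
    \<open>q\<close>, so that 0 and 1 stay free. Register 1, which holds parameter and result,
    becomes 4 and 5, respectively.\<close>
  let ?r = "\<lambda>x::nat. 2 * x + 2" and ?a = "\<lambda>x::nat. 2 * x"
  let ?r' = "\<lambda>x::nat. 2 * x + 3" and ?a' = "\<lambda>x::nat. 2 * x + 1"
  let ?p = "Seq (Seq (Seq (Seq (Seq (Seq (Add 4 4 1) (Add 5 5 1)) (rename_prog ?r ?a p))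
    (rename_prog ?r' ?a' q)) h) (Set_Const 7 0)) (Add 1 6 7)"
  have "\<exists>T s. exec ?p (input_state ([], k)) T s \<and> snd (output_of s) = (f k + g k + 2) ^ C" for k
  proof -
    let ?s = "(\<lambda>_. 0)(0 := 0, 1 := k, 4 := k, 5 := k) :: nat \<Rightarrow> nat" and ?A = "\<lambda>_ _. 0 :: nat"
    have input: "input_state ([], k) = ((\<lambda>_. 0)(0 := 0, 1 := k), ?A)"
      by (auto simp: input_state_def fun_eq_iff)
    have init: "exec (Seq (Add 4 4 1) (Add 5 5 1)) (input_state ([], k)) (1 + 1) (?s, ?A)"
      unfolding input
      using exec_Seq[OF exec_Add[of 4 4 1 "(\<lambda>_. 0)(0 := 0, 1 := k)" ?A] exec_Add[of 5 5 1]] by simp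
    have disjoint: "?r' x \<notin> range ?r" "?a' x \<notin> range ?a" "?r x \<notin> range ?r'" for x
      by (rule notI, elim rangeE, presburger)+
    obtain T1 s1 where s1: "exec p (input_state ([], k)) T1 s1" "fst s1 1 = f k"
      using p[of k] by (auto simp: output_of_def split: prod.splits)
    have inj: "inj ?r" "inj ?a" "inj ?r'" "inj ?a'" by (auto simp: inj_def)
    have sim: "simulates ?r ?a (input_state ([], k)) (?s, ?A)"
      unfolding input by (auto simp: simulates_def)
    obtain s1' where s1': "exec (rename_prog ?r ?a p) (?s, ?A) T1 s1'" "simulates ?r ?a s1 s1'"
      "unchanged ?r ?a (?s, ?A) s1'"
      using exec_rename_prog[OF s1(1) inj(1,2) sim] by blast
    obtain T2 s2 where s2: "exec q (input_state ([], k)) T2 s2" "fst s2 1 = g k"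
      using q[of k] by (auto simp: output_of_def split: prod.splits)
    have "fst s1' (?r' x) = ?s (?r' x)" "snd s1' (?a' x) = ?A (?a' x)" for x
      using s1'(3) disjoint(1,2)[of x] unfolding unchanged_def fst_conv snd_conv by blast+
    then have sim': "simulates ?r' ?a' (input_state ([], k)) s1'"
      unfolding input simulates_def by auto
    obtain s2' where s2': "exec (rename_prog ?r' ?a' q) s1' T2 s2'" "simulates ?r' ?a' s2 s2'"
      "unchanged ?r' ?a' s1' s2'"
      using exec_rename_prog[OF s2(1) inj(3,4) sim'] by blast
    have "fst s2' (?r' 1) = g k" using s2'(2) s2(2) unfolding simulates_def by metis
    then have g: "fst s2' 5 = g k" by simp
    have "fst s2' (?r 1) = fst s1' (?r 1)" 
      using s2'(3) disjoint(3)[of 1] unfolding unchanged_def by blast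
    moreover have "fst s1' (?r 1) = f k" using s1'(2) s1(2) unfolding simulates_def by metis
    ultimately have f: "fst s2' 4 = f k" by simp
    have "\<forall>i. fst s2' (?\<sigma> i) \<le> f k + g k" using f g by (auto split: nat.split)
    from h[OF this, of "snd s2'"] obtain T3 R3 where R3: "exec h s2' T3 (R3, snd s2')"
      "R3 6 = (f k + g k + 2) ^ C" using f g by (auto simp: run_def)
    have "exec ?p (input_state ([], k)) (1 + 1 + T1 + T2 + T3 + 1 + 1)
        ((R3(7 := 0))(1 := (R3(7 := 0)) 6 + (R3(7 := 0)) 7), snd s2')"
      by (rule exec_Seq[OF exec_Seq[OF exec_Seq[OF exec_Seq[OF exec_Seq[OF init s1'(1)] s2'(1)] R3(1)]
            exec_Const] exec_Add])
    then show ?thesis using R3(2) by (intro exI conjI) (assumption, simp add: output_of_def)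
  qed
  then show ?thesis unfolding computable_def by blast
qed

section \<open>The reduction\<close>

definition leading_ones :: "(nat \<Rightarrow> bool) \<Rightarrow> nat \<Rightarrow> nat" where
  "leading_ones \<beta> L = card {x. x < L \<and> (\<forall>y<x + 1. \<beta> y)}"

definition node_bit :: "(nat \<Rightarrow> bool) \<Rightarrow> nat \<Rightarrow> nat \<Rightarrow> bool" where
  "node_bit \<beta> n i \<longleftrightarrow> i < n \<and> \<beta> (n + 1 + i)"

definition wire_bit :: "(nat \<Rightarrow> bool) \<Rightarrow> nat \<Rightarrow> nat \<Rightarrow> nat \<Rightarrow> bool" where
  "wire_bit \<beta> n i j \<longleftrightarrow> i < n \<and> j < n \<and> \<beta> (2 * n + 1 + (i * n + j))"

text \<open>The part of membership in \<open>WCS 1 d\<close> that does not depend on an assignment,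
  in terms of bits and bounded quantifiers; depth and weft are expressed as in
  \<open>depth_iff\<close> and \<open>weft_iff\<close>.\<close>

definition is_code :: "nat \<Rightarrow> (nat \<Rightarrow> bool) \<Rightarrow> nat \<Rightarrow> nat \<Rightarrow> bool" where
  "is_code d \<beta> L n \<longleftrightarrow> 0 < n \<and> L = 2 * n + 1 + n * n \<and> (\<forall>y<n. \<beta> y) \<and> \<not> \<beta> n \<and>
     (\<forall>i<n. \<forall>j<n. wire_bit \<beta> n i j \<longrightarrow> i < j) \<and>
     \<not> (\<exists>i<n. steps n (wire_bit \<beta> n) (Suc d) i (n - 1)) \<and> \<not> deep n (wire_bit \<beta> n) d"

text \<open>Tuples are numbers in base \<open>b\<close>; the offset \<open>p\<close> selects one of
  several tuples stored in the same number.\<close>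

definition digits :: "nat \<Rightarrow> nat \<Rightarrow> nat \<Rightarrow> nat \<Rightarrow> nat" where
  "digits b p v l = v div b ^ (p + l) mod b"

text \<open>One color for each tuple of \<open>2 ^ Suc d\<close> gap indices up to \<open>k\<close>.
  The additional one, whose digits repeat a tuple, ensures two colors even for
  \<open>k = 0\<close>.\<close>

definition num_views :: "nat \<Rightarrow> nat \<Rightarrow> nat" where
  "num_views d k = (k + 1) ^ 2 ^ Suc d + 1"

definition num_copies :: "nat \<Rightarrow> nat \<Rightarrow> nat" where
  "num_copies d k = 2 * (num_views d k * num_views d k) + 1"

definition new_edges :: "nat \<Rightarrow> nat \<Rightarrow> nat" where
  "new_edges d k = num_views d k * num_copies d k + num_views d k * num_views d k"

text \<open>The power counts the values with four tuples of entries below \<open>n + 2\<close>. The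
  rest pads the domain beyond twice the budget with values whose relevant digits repeat.\<close>

definition num_values :: "nat \<Rightarrow> nat \<Rightarrow> nat \<Rightarrow> nat" where
  "num_values d n k = (n + 2) ^ (4 * 2 ^ Suc d) + (2 * new_edges d k + 1)"

definition num_leaves :: "nat \<Rightarrow> nat \<Rightarrow> nat \<Rightarrow> nat" where
  "num_leaves d n k = num_views d k * num_values d n k"

definition center :: "nat \<Rightarrow> nat \<Rightarrow> nat \<Rightarrow> nat" where
  "center d n k = num_leaves d n k + num_views d k * num_copies d k"

definition color :: "nat \<Rightarrow> nat \<Rightarrow> nat \<Rightarrow> nat \<Rightarrow> nat" where
  "color d n k x = (if x < num_leaves d n k then x div num_values d n k
     else (x - num_leaves d n k) div num_copies d k)"

text \<open>A leaf carries its color as quotient and its value as remainder. Words that are no codes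
  are rejected here: then no leaves are joined, and with at least two colors there is no
  clique.\<close>

definition leaf_edge :: "nat \<Rightarrow> (nat \<Rightarrow> bool) \<Rightarrow> nat \<Rightarrow> nat \<Rightarrow> nat \<Rightarrow> nat \<Rightarrow> nat \<Rightarrow> bool" where
  "leaf_edge d \<beta> L n k x y \<longleftrightarrow> is_code d \<beta> L n \<and>
     compatible n (node_bit \<beta> n) (wire_bit \<beta> n) d k (digits (k + 1) 0)
       (digits (n + 2) 0) (digits (n + 2) (2 ^ Suc d)) (digits (n + 2) (2 * 2 ^ Suc d))
       (digits (n + 2) (3 * 2 ^ Suc d))
       (x div num_values d n k) (x mod num_values d n k) (y div num_values d n k) (y mod num_values d n k)"

definition hop_edge :: "nat \<Rightarrow> (nat \<Rightarrow> bool) \<Rightarrow> nat \<Rightarrow> nat \<Rightarrow> nat \<Rightarrow> nat \<Rightarrow> nat \<Rightarrow> bool" where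
  "hop_edge d \<beta> L n k x y \<longleftrightarrow>
     gadget_adj (num_leaves d n k) (center d n k) (leaf_edge d \<beta> L n k) (color d n k) x y"

definition star_edge :: "nat \<Rightarrow> nat \<Rightarrow> nat \<Rightarrow> nat \<Rightarrow> nat \<Rightarrow> bool" where
  "star_edge d n k x y \<longleftrightarrow> (x < num_leaves d n k \<and> y = center d n k) \<or>
     (y < num_leaves d n k \<and> x = center d n k)"

definition pair_bit :: "(nat \<Rightarrow> nat \<Rightarrow> bool) \<Rightarrow> (nat \<Rightarrow> nat \<Rightarrow> bool) \<Rightarrow> nat \<Rightarrow> nat \<Rightarrow> bool" where
  "pair_bit r r' n x \<longleftrightarrow> (if x < n + 1 then x < n
     else if x - (n + 1) < n * n then r ((x - (n + 1)) div n) ((x - (n + 1)) mod n)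
     else r' ((x - (n + 1 + n * n)) div n) ((x - (n + 1 + n * n)) mod n))"

section \<open>Definability of the constructed word\<close>

lemma definable_Suc: "definable f \<Longrightarrow> definable (\<lambda>\<beta> \<rho>. Suc (f \<beta> \<rho>))"
  using definable_add[OF _ definable_const[of 1]] by simp

lemma pred_Bex_atMost:
  fixes q :: nat
  shows "(\<And>i. i \<le> q \<Longrightarrow> definable_pred (P i)) \<Longrightarrow> definable_pred (\<lambda>\<beta> \<rho>. \<exists>i\<in>{..q}. P i \<beta> \<rho>)"
  unfolding lessThan_Suc_atMost[symmetric] by (rule pred_Bex) simp

lemma definable_if:
  assumes "definable_pred P" "definable f" "definable g"
  shows "definable (\<lambda>\<beta> \<rho>. if P \<beta> \<rho> then f \<beta> \<rho> else g \<beta> \<rho>)"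
proof -
  have "(if b then x else y) = of_bool b * x + of_bool (\<not> b) * y" for b and x y :: nat by simp
  then show ?thesis
    by (simp only:) (intro definable_add definable_mult assms pred_not[OF assms(1), unfolded definable_pred_def]
      assms(1)[unfolded definable_pred_def])
qed

lemmas [definable_intros] = definable_Suc pred_Bex_atMost definable_if pred_const

lemma definable_leading_ones:
  "definable a \<Longrightarrow> definable (\<lambda>\<beta> \<rho>. leading_ones \<beta> (a \<beta> \<rho>))"
  by (rule definable_comp1) (unfold leading_ones_def, intro definable_intros)

lemma pred_node_bit:
  "definable a \<Longrightarrow> definable b \<Longrightarrow> definable_pred (\<lambda>\<beta> \<rho>. node_bit \<beta> (a \<beta> \<rho>) (b \<beta> \<rho>))"
  unfolding node_bit_def by (intro definable_intros)

lemma pred_wire_bit: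
  "definable a \<Longrightarrow> definable b \<Longrightarrow> definable f \<Longrightarrow>
     definable_pred (\<lambda>\<beta> \<rho>. wire_bit \<beta> (a \<beta> \<rho>) (b \<beta> \<rho>) (f \<beta> \<rho>))"
  unfolding wire_bit_def by (intro definable_intros)

lemmas [definable_intros] = definable_leading_ones pred_node_bit pred_wire_bit

lemma definable_indeg:
  "definable a \<Longrightarrow> definable b \<Longrightarrow>
     definable (\<lambda>\<beta> \<rho>. indeg (a \<beta> \<rho>) (wire_bit \<beta> (a \<beta> \<rho>)) (b \<beta> \<rho>))"
  by (rule definable_comp2) (unfold indeg_def, intro definable_intros)

lemma pred_steps:
  "definable a \<Longrightarrow> definable b \<Longrightarrow> definable f \<Longrightarrow>
     definable_pred (\<lambda>\<beta> \<rho>. steps (a \<beta> \<rho>) (wire_bit \<beta> (a \<beta> \<rho>)) r (b \<beta> \<rho>) (f \<beta> \<rho>))"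
proof (induction r arbitrary: a b f)
  case 0
  then show ?case unfolding steps.simps by (intro definable_intros)
next
  case (Suc r)
  show ?case
    by (rule pred_comp3[OF _ Suc.prems]) (unfold steps.simps, intro definable_intros Suc.IH)
qed

lemmas [definable_intros] = definable_indeg pred_steps

lemma pred_live:
  "definable a \<Longrightarrow> definable b \<Longrightarrow>
     definable_pred (\<lambda>\<beta> \<rho>. live (a \<beta> \<rho>) (wire_bit \<beta> (a \<beta> \<rho>)) d (b \<beta> \<rho>))"
  unfolding live_def by (intro definable_intros)

lemma pred_deep:
  "definable a \<Longrightarrow> definable_pred (\<lambda>\<beta> \<rho>. deep (a \<beta> \<rho>) (wire_bit \<beta> (a \<beta> \<rho>)) d)"
  by (rule pred_comp1) (unfold deep_def, intro definable_intros)

lemmas [definable_intros] = pred_live pred_deep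

lemma pred_is_code:
  "definable a \<Longrightarrow> definable b \<Longrightarrow> definable_pred (\<lambda>\<beta> \<rho>. is_code d \<beta> (a \<beta> \<rho>) (b \<beta> \<rho>))"
  by (rule pred_comp2) (unfold is_code_def, intro definable_intros)

lemma definable_digits:
  "definable a \<Longrightarrow> definable b \<Longrightarrow> definable (\<lambda>\<beta> \<rho>. digits (a \<beta> \<rho>) p (b \<beta> \<rho>) l)"
  unfolding digits_def by (intro definable_intros)

lemmas [definable_intros] = pred_is_code definable_digits

lemma pred_teval:
  "definable a \<Longrightarrow> definable b \<Longrightarrow> definable f \<Longrightarrow>
     definable_pred (\<lambda>\<beta> \<rho>. teval (a \<beta> \<rho>) (node_bit \<beta> (a \<beta> \<rho>)) (wire_bit \<beta> (a \<beta> \<rho>))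
       (\<lambda>x. \<exists>l\<in>{..<q}. digits (a \<beta> \<rho> + 2) o1 (b \<beta> \<rho>) l = Suc x)
       (\<lambda>i j. \<exists>s\<in>{..<q}. digits (a \<beta> \<rho> + 2) o2 (b \<beta> \<rho>) s = i \<and> digits (a \<beta> \<rho> + 2) o3 (b \<beta> \<rho>) s = j)
       l (f \<beta> \<rho>))"
proof (induction l arbitrary: a b f)
  case 0
  then show ?case unfolding teval.simps by (intro definable_intros)
next
  case (Suc l)
  show ?case
    by (rule pred_comp3[OF _ Suc.prems]) (unfold teval.simps, intro definable_intros Suc.IH)
qed

text \<open>Expressions have no sets as values, but quantification over the cone unfolds into
  bounded quantifiers.\<close>

lemma ball_cone_Suc:
  "(\<forall>x\<in>cone n e (Suc l) i. P x) \<longleftrightarrow>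
     (if indeg n e i = 0 then P i
      else if indeg n e i \<le> 2 then \<forall>j<n. e j i \<longrightarrow> (\<forall>x\<in>cone n e l j. P x) else True)"
  by auto

lemma pred_cone:
  "definable a \<Longrightarrow> definable b \<Longrightarrow> definable f \<Longrightarrow>
     definable_pred (\<lambda>\<beta> \<rho>. \<forall>x\<in>cone (a \<beta> \<rho>) (wire_bit \<beta> (a \<beta> \<rho>)) l (f \<beta> \<rho>).
       \<exists>l\<in>{..<q}. digits (a \<beta> \<rho> + 2) o1 (b \<beta> \<rho>) l \<le> Suc x \<and> Suc x < digits (a \<beta> \<rho> + 2) o2 (b \<beta> \<rho>) l)"
proof (induction l arbitrary: a b f)
  case 0
  then show ?case by (simp add: pred_const)
next
  case (Suc l)
  show ?case
    by (rule pred_comp3[OF _ Suc.prems]) (unfold ball_cone_Suc, intro definable_intros Suc.IH)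
qed

lemma pred_claims_ok:
  assumes "definable a" "definable b"
  shows "definable_pred (\<lambda>\<beta> \<rho>. claims_ok (a \<beta> \<rho>) (node_bit \<beta> (a \<beta> \<rho>)) (wire_bit \<beta> (a \<beta> \<rho>)) d
       (\<lambda>x. \<exists>l\<in>{..<q}. digits (a \<beta> \<rho> + 2) o1 (b \<beta> \<rho>) l \<le> Suc x \<and> Suc x < digits (a \<beta> \<rho> + 2) o2 (b \<beta> \<rho>) l)
       (\<lambda>x. \<exists>l\<in>{..<q}. digits (a \<beta> \<rho> + 2) o1 (b \<beta> \<rho>) l = Suc x)
       (\<lambda>i j. \<exists>s\<in>{..<q}. digits (a \<beta> \<rho> + 2) o3 (b \<beta> \<rho>) s = i \<and> digits (a \<beta> \<rho> + 2) o4 (b \<beta> \<rho>) s = j))"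
  by (rule pred_comp2[OF _ assms]) (unfold claims_ok_def, intro definable_intros pred_teval pred_cone)

lemma pred_view_ok:
  assumes "definable n" "definable k" "definable T" "definable v"
  shows "definable_pred (\<lambda>\<beta> \<rho>. view_ok (n \<beta> \<rho>) (node_bit \<beta> (n \<beta> \<rho>)) (wire_bit \<beta> (n \<beta> \<rho>)) d (k \<beta> \<rho>)
    (digits (k \<beta> \<rho> + 1) o0 (T \<beta> \<rho>)) (digits (n \<beta> \<rho> + 2) o1 (v \<beta> \<rho>)) (digits (n \<beta> \<rho> + 2) o2 (v \<beta> \<rho>))
    (digits (n \<beta> \<rho> + 2) o3 (v \<beta> \<rho>)) (digits (n \<beta> \<rho> + 2) o4 (v \<beta> \<rho>)))"
  unfolding view_ok_def by (intro definable_intros pred_claims_ok assms)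

lemma pred_views_agree:
  assumes "definable n" "definable k" "definable T" "definable v" "definable T'" "definable v'"
  shows "definable_pred (\<lambda>\<beta> \<rho>. views_agree d
    (digits (k \<beta> \<rho> + 1) o0 (T \<beta> \<rho>)) (digits (n \<beta> \<rho> + 2) o1 (v \<beta> \<rho>)) (digits (n \<beta> \<rho> + 2) o2 (v \<beta> \<rho>))
    (digits (n \<beta> \<rho> + 2) o3 (v \<beta> \<rho>)) (digits (n \<beta> \<rho> + 2) o4 (v \<beta> \<rho>))
    (digits (k \<beta> \<rho> + 1) o0 (T' \<beta> \<rho>)) (digits (n \<beta> \<rho> + 2) o1 (v' \<beta> \<rho>)) (digits (n \<beta> \<rho> + 2) o2 (v' \<beta> \<rho>))
    (digits (n \<beta> \<rho> + 2) o3 (v' \<beta> \<rho>)) (digits (n \<beta> \<rho> + 2) o4 (v' \<beta> \<rho>)))"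
  unfolding views_agree_def by (intro definable_intros assms)

lemma
  assumes "definable k"
  shows definable_num_views: "definable (\<lambda>\<beta> \<rho>. num_views d (k \<beta> \<rho>))"
    and definable_num_copies: "definable (\<lambda>\<beta> \<rho>. num_copies d (k \<beta> \<rho>))"
    and definable_new_edges: "definable (\<lambda>\<beta> \<rho>. new_edges d (k \<beta> \<rho>))"
  unfolding new_edges_def num_copies_def num_views_def by (intro definable_intros assms)+

lemma
  assumes "definable n" "definable k"
  shows definable_num_values: "definable (\<lambda>\<beta> \<rho>. num_values d (n \<beta> \<rho>) (k \<beta> \<rho>))"
    and definable_num_leaves: "definable (\<lambda>\<beta> \<rho>. num_leaves d (n \<beta> \<rho>) (k \<beta> \<rho>))"
    and definable_center: "definable (\<lambda>\<beta> \<rho>. center d (n \<beta> \<rho>) (k \<beta> \<rho>))"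
  unfolding center_def num_leaves_def num_values_def
  by (intro definable_intros definable_num_views definable_num_copies definable_new_edges assms)+

lemmas definable_sizes = definable_num_copies definable_num_values definable_num_leaves definable_center

lemma definable_color:
  "definable n \<Longrightarrow> definable k \<Longrightarrow> definable a \<Longrightarrow>
     definable (\<lambda>\<beta> \<rho>. color d (n \<beta> \<rho>) (k \<beta> \<rho>) (a \<beta> \<rho>))"
  unfolding color_def by (intro definable_intros definable_sizes)

lemma pred_leaf_edge:
  assumes "definable L" "definable n" "definable k" "definable a" "definable b"
  shows "definable_pred (\<lambda>\<beta> \<rho>. leaf_edge d \<beta> (L \<beta> \<rho>) (n \<beta> \<rho>) (k \<beta> \<rho>) (a \<beta> \<rho>) (b \<beta> \<rho>))"
  unfolding leaf_edge_def compatible_def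
  by (intro pred_conj pred_is_code pred_view_ok pred_views_agree definable_div definable_mod
    definable_num_values assms)

lemma pred_hop_edge:
  assumes "definable L" "definable n" "definable k" "definable a" "definable b"
  shows "definable_pred (\<lambda>\<beta> \<rho>. hop_edge d \<beta> (L \<beta> \<rho>) (n \<beta> \<rho>) (k \<beta> \<rho>) (a \<beta> \<rho>) (b \<beta> \<rho>))"
  unfolding hop_edge_def gadget_adj_def
  by (intro definable_intros definable_color pred_leaf_edge definable_sizes assms)

lemma pred_star_edge:
  assumes "definable n" "definable k" "definable a" "definable b"
  shows "definable_pred (\<lambda>\<beta> \<rho>. star_edge d (n \<beta> \<rho>) (k \<beta> \<rho>) (a \<beta> \<rho>) (b \<beta> \<rho>))"
  unfolding star_edge_def by (intro definable_intros definable_sizes assms)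

definition out_length :: "nat \<Rightarrow> (nat \<Rightarrow> bool) \<Rightarrow> nat \<Rightarrow> nat \<Rightarrow> nat" where
  "out_length d \<beta> L k = (let N = center d (leading_ones \<beta> L) k + 1 in N + 1 + N * N + N * N)"

definition out_bit :: "nat \<Rightarrow> (nat \<Rightarrow> bool) \<Rightarrow> nat \<Rightarrow> nat \<Rightarrow> nat \<Rightarrow> bool" where
  "out_bit d \<beta> L k x = (let n = leading_ones \<beta> L in
     pair_bit (star_edge d n k) (hop_edge d \<beta> L n k) (center d n k + 1) x)"

lemma definable_out_length: "definable (\<lambda>\<beta> \<rho>. out_length d \<beta> (\<rho> 0) (\<rho> 1))"
  unfolding out_length_def Let_def by (intro definable_intros definable_sizes)

lemma pred_out_bit: "definable_pred (\<lambda>\<beta> \<rho>. out_bit d \<beta> (\<rho> 1) (\<rho> 2) (\<rho> 0))"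
  unfolding out_bit_def Let_def pair_bit_def
  by (intro definable_intros definable_sizes pred_star_edge pred_hop_edge)

section \<open>Reading and comparing the codes\<close>

lemma length_matrix: "length (matrix n r) = n * n"
  by (simp add: matrix_def length_concat sum_list_triv comp_def)

lemma row_column_less: "i < m \<Longrightarrow> j < n \<Longrightarrow> i * n + j < m * (n :: nat)"
  using mult_le_mono1[of "Suc i" m n] by simp

lemma nth_concat_rows:
  "i < m \<Longrightarrow> j < n \<Longrightarrow> concat (map (\<lambda>i. map (r i) [0..<n]) [0..<m]) ! (i * n + j) = r i j"
proof (induction m)
  case (Suc m)
  have len: "length (concat (map (\<lambda>i. map (r i) [0..<n]) [0..<m])) = m * n"
    by (simp add: length_concat sum_list_triv comp_def)
  show ?case
  proof (cases "i = m")
    case True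
    then show ?thesis using Suc.prems len by (simp add: nth_append)
  next
    case False
    then have "i < m" using Suc.prems by simp
    then have "i * n + j < m * n" using Suc.prems(2) by (rule row_column_less)
    then show ?thesis using Suc False len by (simp add: nth_append)
  qed
qed simp

lemma nth_matrix: "i < n \<Longrightarrow> j < n \<Longrightarrow> matrix n r ! (i * n + j) = r i j"
  unfolding matrix_def using nth_concat_rows[of i n j n r] by simp

lemma row_column:
  fixes n x :: nat
  assumes "x < n * n" obtains i j where "i < n" "j < n" "x = i * n + j"
proof -
  have "0 < n" using assms by (cases n) auto
  then have "x div n < n" "x mod n < n" "x = x div n * n + x mod n"
    using assms by (simp_all add: less_mult_imp_div_less)
  then show ?thesis by (rule that)
qed

lemma nth_matrix': "x < n * n \<Longrightarrow> matrix n r ! x = r (x div n) (x mod n)"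
  by (erule row_column) (simp add: nth_matrix)

lemma matrix_eqD: "matrix n r = matrix n r' \<Longrightarrow> i < n \<Longrightarrow> j < n \<Longrightarrow> r i j = r' i j"
  using nth_matrix by metis

lemma nth_unary: "x \<le> n \<Longrightarrow> (unary n @ w) ! x \<longleftrightarrow> x < n"
  by (auto simp: unary_def nth_append)

lemma length_unary: "length (unary n) = n + 1"
  by (simp add: unary_def)

text \<open>The unary code ends at the first \<open>False\<close>, so it can be split off from any
  continuation.\<close>

lemma unary_append_eq:
  assumes "unary n @ w = unary n' @ w'"
  shows "n = n' \<and> w = w'"
proof -
  have "takeWhile id (unary n @ w) = replicate n True" for n w
    unfolding unary_def by (induction n) auto
  then have "n = n'" using assms by (metis length_replicate)
  then show ?thesis using assms by simp
qed

lemma pair_code_inject: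
  assumes "graph_pair_code n G H = graph_pair_code n' G' H'"
    and "G \<subseteq> all_edges n" "H \<subseteq> all_edges n" "G' \<subseteq> all_edges n'" "H' \<subseteq> all_edges n'"
  shows "n = n' \<and> G = G' \<and> H = H'"
proof -
  have u: "unary n @ (matrix n (\<lambda>i j. {i, j} \<in> G) @ matrix n (\<lambda>i j. {i, j} \<in> H)) =
      unary n' @ (matrix n' (\<lambda>i j. {i, j} \<in> G') @ matrix n' (\<lambda>i j. {i, j} \<in> H'))"
    using assms(1) by (simp add: graph_pair_code_def)
  have n: "n = n'" using unary_append_eq[OF u] by blast
  have eq: "matrix n (\<lambda>i j. {i, j} \<in> G) = matrix n (\<lambda>i j. {i, j} \<in> G')"
    "matrix n (\<lambda>i j. {i, j} \<in> H) = matrix n (\<lambda>i j. {i, j} \<in> H')"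
    using unary_append_eq[OF u] n by (simp_all add: length_matrix)
  have sub: "X \<subseteq> Y" if X: "X \<subseteq> all_edges n" and "matrix n (\<lambda>i j. {i, j} \<in> X) = matrix n (\<lambda>i j. {i, j} \<in> Y)" for X Y
  proof
    fix x assume "x \<in> X"
    then have "x \<subseteq> {..<n}" "card x = 2" using X by (auto simp: all_edges_def)
    then obtain i j where "x = {i, j}" "i < n" "j < n" by (auto simp: card_2_iff)
    then show "x \<in> Y" using matrix_eqD[OF that(2), of i j] \<open>x \<in> X\<close> by simp
  qed
  have "G = G'" "H = H'"
    using sub[OF assms(2) eq(1)] sub[OF _ eq(1)[symmetric]] sub[OF assms(3) eq(2)]
      sub[OF _ eq(2)[symmetric]] assms(4,5) n by auto
  then show ?thesis using n by simp
qed

text \<open>The problem asks for some decoding of the word; as the code is injective on edge sets of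
  simple graphs, it is the given pair.\<close>

lemma dilation_augmentation_iff:
  assumes "G \<subseteq> all_edges n" "H \<subseteq> all_edges n"
  shows "(graph_pair_code n G H, k) \<in> dilation_augmentation X t \<longleftrightarrow>
    X n G \<and> (\<exists>S \<subseteq> all_edges n - G. card S \<le> k \<and> dilation_at_most t n (G \<union> S) H)"
proof
  assume "(graph_pair_code n G H, k) \<in> dilation_augmentation X t"
  then obtain n' G' H' where "graph_pair_code n G H = graph_pair_code n' G' H'"
    "G' \<subseteq> all_edges n'" "H' \<subseteq> all_edges n'" "X n' G'"
    "\<exists>S \<subseteq> all_edges n' - G'. card S \<le> k \<and> dilation_at_most t n' (G' \<union> S) H'"
    unfolding dilation_augmentation_def by auto
  moreover from this have "n = n' \<and> G = G' \<and> H = H'" using assms by (intro pair_code_inject)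
  ultimately show "X n G \<and> (\<exists>S \<subseteq> all_edges n - G. card S \<le> k \<and> dilation_at_most t n (G \<union> S) H)"
    by simp
next
  assume "X n G \<and> (\<exists>S \<subseteq> all_edges n - G. card S \<le> k \<and> dilation_at_most t n (G \<union> S) H)"
  then show "(graph_pair_code n G H, k) \<in> dilation_augmentation X t"
    unfolding dilation_augmentation_def using assms by blast
qed

lemma pair_code_bits:
  assumes "\<And>i j. i < n \<Longrightarrow> j < n \<Longrightarrow> {i, j} \<in> G \<longleftrightarrow> r i j"
    and "\<And>i j. i < n \<Longrightarrow> j < n \<Longrightarrow> {i, j} \<in> H \<longleftrightarrow> r' i j"
  shows "graph_pair_code n G H = map (pair_bit r r' n) [0..<n + 1 + n * n + n * n]"
proof (rule nth_equalityI)
  show "length (graph_pair_code n G H) = length (map (pair_bit r r' n) [0..<n + 1 + n * n + n * n])"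
    by (simp add: graph_pair_code_def length_unary length_matrix)
next
  fix x assume "x < length (graph_pair_code n G H)"
  then have x: "x < n + 1 + n * n + n * n"
    by (simp add: graph_pair_code_def length_unary length_matrix)
  have div_mod: "y div n < n" "y mod n < n" if "y < n * n" for y
    using that by (cases n; simp add: less_mult_imp_div_less)+
  consider "x < n + 1" | "n + 1 \<le> x" "x - (n + 1) < n * n"
    | "n + 1 + n * n \<le> x" "x - (n + 1 + n * n) < n * n" using x by linarith
  then have "graph_pair_code n G H ! x = pair_bit r r' n x"
  proof cases
    case 1
    then show ?thesis using nth_unary[of x n] by (simp add: graph_pair_code_def pair_bit_def)
  next
    case 2
    then show ?thesis using div_mod[OF 2(2)]
      by (simp add: graph_pair_code_def pair_bit_def nth_append length_unary length_matrix nth_matrix' assms)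
  next
    case 3
    then show ?thesis using div_mod[OF 3(2)]
      by (simp add: graph_pair_code_def pair_bit_def nth_append length_unary length_matrix nth_matrix' assms diff_diff_left)
  qed
  then show "graph_pair_code n G H ! x = map (pair_bit r r' n) [0..<n + 1 + n * n + n * n] ! x"
    using x by (simp del: upt_Suc)
qed

lemma leading_ones_eq:
  assumes "n < L" "\<forall>y<n. \<beta> y" "\<not> \<beta> n"
  shows "leading_ones \<beta> L = n"
proof -
  have "(\<forall>y<x + 1. \<beta> y) \<longleftrightarrow> x < n" for x
  proof
    assume "\<forall>y<x + 1. \<beta> y"
    then show "x < n" using assms(3) by (meson less_add_one not_less order.strict_trans1)
  qed (use assms(2) in auto)
  then have "{x. x < L \<and> (\<forall>y<x + 1. \<beta> y)} = {..<n}" using assms(1) by auto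
  then show ?thesis by (simp add: leading_ones_def)
qed

text \<open>Circuit codes are uniquely readable: the unary prefix determines \<open>n\<close>, and
  the bits after it determine \<open>C\<close> and \<open>E\<close>. So the unknown circuit behind a
  word is the one that the bits of \<open>\<beta>\<close> describe.\<close>

lemma WCS_iff:
  fixes \<beta> L d
  defines "n \<equiv> leading_ones \<beta> L"
  defines "C \<equiv> {i. i < n \<and> node_bit \<beta> n i}" and "E \<equiv> {(i, j). wire_bit \<beta> n i j}"
  shows "(map \<beta> [0..<L], k) \<in> WCS 1 d \<longleftrightarrow> is_code d \<beta> L n \<and>
    (\<exists>v. valuation n C E v \<and> v (n - 1) \<and> card {i \<in> inputs n E. v i} = k)"
proof
  assume "(map \<beta> [0..<L], k) \<in> WCS 1 d"
  then have "\<exists>n' C' E'. map \<beta> [0..<L] = circuit_code n' C' E' \<and> circuit n' C' E' \<and>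
      weft_at_most n' E' 1 \<and> depth_at_most n' E' d \<and>
      (\<exists>v. valuation n' C' E' v \<and> v (n' - 1) \<and> card {i \<in> inputs n' E'. v i} = k)"
    by (simp add: WCS_def)
  then obtain n' C' E' v where w: "map \<beta> [0..<L] = circuit_code n' C' E'" and circ: "circuit n' C' E'"
    and wd: "weft_at_most n' E' 1" "depth_at_most n' E' d"
    and v: "valuation n' C' E' v" "v (n' - 1)" "card {i \<in> inputs n' E'. v i} = k"
    by (elim exE conjE)
  have L: "L = 2 * n' + 1 + n' * n'"
    using arg_cong[OF w, of length] by (simp add: circuit_code_def length_unary length_matrix)
  have \<beta>: "\<beta> x = circuit_code n' C' E' ! x" if "x < L" for x using w that by (metis nth_map_upt add_0 diff_zero)
  have ones: "\<beta> x \<longleftrightarrow> x < n'" if "x \<le> n'" for x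
    using \<beta>[of x] that L by (simp add: circuit_code_def nth_unary)
  have n: "n = n'" unfolding n_def using ones L by (intro leading_ones_eq) auto
  have "node_bit \<beta> n i \<longleftrightarrow> i \<in> C'" if "i < n" for i
    using that \<beta>[of "n + 1 + i"] L
    by (simp add: n node_bit_def circuit_code_def nth_append length_unary)
  then have C: "C = C'" unfolding C_def using circ n by (auto simp: circuit_def)
  have wire: "wire_bit \<beta> n i j \<longleftrightarrow> (i, j) \<in> E'" if "i < n" "j < n" for i j
  proof -
    have ij: "i * n + j < n * n" using that by (rule row_column_less)
    then have "2 * n + 1 + (i * n + j) < L" using L n by simp
    then have "\<beta> (2 * n + 1 + (i * n + j)) \<longleftrightarrow> circuit_code n C' E' ! (2 * n + 1 + (i * n + j))"
      using \<beta> n by simp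
    also have "2 * n + 1 + (i * n + j) = n + 1 + (n + (i * n + j))" by simp
    also have "circuit_code n C' E' ! (n + 1 + (n + (i * n + j))) \<longleftrightarrow>
        matrix n (\<lambda>i j. (i, j) \<in> E') ! (i * n + j)"
      by (simp add: circuit_code_def nth_append length_unary)
    also have "\<dots> \<longleftrightarrow> (i, j) \<in> E'" using that by (simp add: nth_matrix)
    finally show ?thesis using that by (simp add: wire_bit_def mult_2 add.assoc)
  qed
  have "E = E'"
  proof -
    have "(i, j) \<in> E \<longleftrightarrow> (i, j) \<in> E'" for i j
    proof (cases "i < n \<and> j < n")
      case True
      then show ?thesis using wire by (simp add: E_def)
    next
      case False
      moreover have "(i, j) \<in> E' \<Longrightarrow> i < n \<and> j < n" using circ n by (auto simp: circuit_def)
      ultimately show ?thesis by (auto simp: E_def wire_bit_def)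
    qed
    then show ?thesis by auto
  qed
  interpret graded_circuit n "node_bit \<beta> n" "wire_bit \<beta> n"
    using circ \<open>E = E'\<close> n by unfold_locales (auto simp: circuit_def E_def)
  have "is_code d \<beta> L n"
    using wd ones L edge pos depth_iff[of d] weft_iff[of d] \<open>E = E'\<close> n
    unfolding is_code_def E_def by auto
  then show "is_code d \<beta> L n \<and>
    (\<exists>v. valuation n C E v \<and> v (n - 1) \<and> card {i \<in> inputs n E. v i} = k)"
    using v C \<open>E = E'\<close> n by auto
next
  assume R: "is_code d \<beta> L n \<and>
    (\<exists>v. valuation n C E v \<and> v (n - 1) \<and> card {i \<in> inputs n E. v i} = k)"
  then have code: "is_code d \<beta> L n" by blast
  interpret graded_circuit n "node_bit \<beta> n" "wire_bit \<beta> n"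
    using code by unfold_locales (auto simp: is_code_def wire_bit_def)
  have depth: "depth_at_most n E d" using code depth_iff[of d] unfolding is_code_def E_def by blast
  then have weft: "weft_at_most n E 1" using code weft_iff[of d] unfolding is_code_def E_def by blast
  have circ: "circuit n C E" using circuit unfolding C_def E_def .
  have "map \<beta> [0..<L] = circuit_code n C E"
  proof (rule nth_equalityI)
    show "length (map \<beta> [0..<L]) = length (circuit_code n C E)"
      using code by (simp add: is_code_def circuit_code_def length_unary length_matrix)
  next
    fix x assume "x < length (map \<beta> [0..<L])"
    then have x: "x < 2 * n + 1 + n * n" "x < L" using code by (auto simp: is_code_def)
    consider "x \<le> n" | i where "i < n" "x = n + 1 + i"
      | y where "y < n * n" "x = 2 * n + 1 + y"
    proof -
      have "x \<le> n \<or> (x - (n + 1) < n \<and> x = n + 1 + (x - (n + 1))) \<or>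
          (x - (2 * n + 1) < n * n \<and> x = 2 * n + 1 + (x - (2 * n + 1)))" using x(1) by linarith
      then show ?thesis using that by blast
    qed
    then have "circuit_code n C E ! x = \<beta> x"
    proof cases
      case 1
      then show ?thesis using code nth_unary[OF 1]
        by (cases "x = n") (auto simp: is_code_def circuit_code_def)
    next
      case 2
      then show ?thesis
        by (simp add: circuit_code_def nth_append length_unary C_def node_bit_def)
    next
      case 3
      from 3(1) obtain i j where ij: "i < n" "j < n" "y = i * n + j" by (rule row_column)
      have "circuit_code n C E ! x = matrix n (\<lambda>i j. (i, j) \<in> E) ! y"
        using 3 by (simp add: circuit_code_def nth_append length_unary)
      also have "\<dots> = wire_bit \<beta> n i j" using ij by (simp add: nth_matrix E_def)
      also have "\<dots> = \<beta> x" using ij 3(2) by (simp add: wire_bit_def)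
      finally show ?thesis .
    qed
    then show "map \<beta> [0..<L] ! x = circuit_code n C E ! x" using x by simp
  qed
  then show "(map \<beta> [0..<L], k) \<in> WCS 1 d"
    using R circ weft depth unfolding WCS_def by blast
qed

section \<open>Numbers as tuples, and the instances of the two locales\<close>

lemma digits_less: "0 < b \<Longrightarrow> digits b p v l < b"
  by (simp add: digits_def)

lemma digits_surj:
  fixes b :: nat and f :: "nat \<Rightarrow> nat"
  assumes "\<And>i. i < D \<Longrightarrow> f i < b"
  shows "\<exists>v<b ^ D. \<forall>i<D. v div b ^ i mod b = f i"
  using assms
proof (induction D arbitrary: f)
  case (Suc D)
  obtain v where v: "v < b ^ D" "\<forall>i<D. v div b ^ i mod b = f (Suc i)"
    using Suc.IH[of "\<lambda>i. f (Suc i)"] Suc.prems by auto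
  have f0: "f 0 < b" using Suc.prems by simp
  have "f 0 + b * v < b * (v + 1)" using f0 by simp
  also have "\<dots> \<le> b * b ^ D" using v(1) by (intro mult_le_mono2) simp
  finally have "f 0 + b * v < b ^ Suc D" by simp
  moreover have "(f 0 + b * v) div b ^ i mod b = f i" if "i < Suc D" for i
    using that v(2) f0 by (cases i) (auto simp: div_mult2_eq)
  ultimately show ?case by blast
qed simp

lemma card_block:
  fixes a :: nat assumes "0 < a" shows "card {x. p \<le> x \<and> (x - p) div a = i} = a"
proof -
  have "{x. p \<le> x \<and> (x - p) div a = i} = {p + i * a..<p + i * a + a}"
  proof (rule set_eqI)
    fix x
    have "(x - p) div a = i \<longleftrightarrow> i * a \<le> x - p \<and> x - p < i * a + a"
      using assms div_nat_eqI[of a i "x - p"] div_times_less_eq_dividend[of "x - p" a]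
        dividend_less_div_times[of a "x - p"] by (auto simp: ac_simps)
    moreover have "p \<le> x \<and> i * a \<le> x - p \<and> x - p < i * a + a \<longleftrightarrow> p + i * a \<le> x \<and> x < p + i * a + a"
      by linarith
    ultimately show "x \<in> {x. p \<le> x \<and> (x - p) div a = i} \<longleftrightarrow> x \<in> {p + i * a..<p + i * a + a}" by simp
  qed
  then show ?thesis by simp
qed

lemma clique_gadget_instance:
  "clique_gadget (num_leaves d n k) (center d n k) (num_views d k) (leaf_edge d \<beta> L n k) (color d n k)"
proof
  let ?s = "num_leaves d n k" and ?c = "center d n k" and ?m = "num_views d k"
    and ?N = "num_values d n k" and ?M = "num_copies d k"
  have s: "?s = ?m * ?N" by (simp add: num_leaves_def)
  have c: "?c = ?s + ?m * ?M" by (simp add: center_def)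
  have N: "2 * new_edges d k < ?N" "0 < ?N" by (simp_all add: num_values_def)
  have M: "0 < ?M" by (simp add: num_copies_def)
  show "?s \<le> ?c" by (simp add: c)
  show "color d n k x < ?m" if "x < ?c" for x
    using that by (auto simp: color_def c s less_mult_imp_div_less)
  show "leaf_edge d \<beta> L n k y x" if "leaf_edge d \<beta> L n k x y" for x y
    using that by (auto simp: leaf_edge_def compatible_def)
  show "2 \<le> ?m" by (simp add: num_views_def)
  show "card {p. ?s \<le> p \<and> p < ?c \<and> color d n k p = i} = 2 * (?m * ?m) + 1" if "i < ?m" for i
  proof -
    have "p < ?c" if "?s \<le> p" "(p - ?s) div ?M = i" for p
    proof -
      have "p - ?s < ?m * ?M"
        using that \<open>i < ?m\<close> M by (metis div_less_iff_less_mult)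
      then show ?thesis using that c by linarith
    qed
    then have "{p. ?s \<le> p \<and> p < ?c \<and> color d n k p = i} = {p. ?s \<le> p \<and> (p - ?s) div ?M = i}"
      by (auto simp: color_def)
    also have "card \<dots> = ?M" using M by (rule card_block)
    finally show ?thesis by (simp add: num_copies_def)
  qed
  show "2 * (?m * (2 * (?m * ?m) + 1) + ?m * ?m) < card {x. x < ?s \<and> color d n k x = i}"
    if "i < ?m" for i
  proof -
    have "x < ?s" if "x div ?N = i" for x
      using that \<open>i < ?m\<close> N(2) unfolding s by (metis div_less_iff_less_mult)
    then have "{x. x < ?s \<and> color d n k x = i} = {x. 0 \<le> x \<and> (x - 0) div ?N = i}"
      by (auto simp: color_def)
    also have "card \<dots> = ?N" using N(2) by (rule card_block)
    finally show ?thesis using N(1) by (simp add: new_edges_def num_copies_def)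
  qed
qed

lemma views_instance:
  assumes "0 < n"
  shows "views n d k (num_views d k) (num_values d n k) (digits (k + 1) 0)
    (digits (n + 2) 0) (digits (n + 2) (2 ^ Suc d)) (digits (n + 2) (2 * 2 ^ Suc d))
    (digits (n + 2) (3 * 2 ^ Suc d))"
proof
  let ?q = "2 ^ Suc d :: nat"
  show "0 < n" by (rule assms)
  show "2 \<le> num_views d k" by (simp add: num_views_def)
  show "digits (k + 1) 0 T l \<le> k" for T l using digits_less[of "k + 1" 0 T l] by simp
  show "\<exists>T<num_views d k. \<forall>l<?q. digits (k + 1) 0 T l = f l" if f: "\<And>l. f l \<le> k" for f
  proof -
    obtain T where "T < (k + 1) ^ ?q" "\<forall>l<?q. T div (k + 1) ^ l mod (k + 1) = f l"
      using digits_surj[of ?q f "k + 1"] f by (auto simp: less_Suc_eq_le)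
    then show ?thesis by (intro exI[of _ T]) (simp add: digits_def num_views_def)
  qed
  show "\<exists>v<num_values d n k. \<forall>l<?q. digits (n + 2) 0 v l = f0 l \<and> digits (n + 2) ?q v l = f1 l \<and>
      digits (n + 2) (2 * ?q) v l = f2 l \<and> digits (n + 2) (3 * ?q) v l = f3 l"
    if f: "\<And>l. f0 l < n + 2 \<and> f1 l < n + 2 \<and> f2 l < n + 2 \<and> f3 l < n + 2" for f0 f1 f2 f3
  proof -
    \<comment> \<open>The four tuples are concatenated into one sequence of
      \<open>4 * 2 ^ Suc d\<close> digits.\<close>
    define F where "F i = (if i < ?q then f0 i else if i < 2 * ?q then f1 (i - ?q)
      else if i < 3 * ?q then f2 (i - 2 * ?q) else f3 (i - 3 * ?q))" for i
    have "F i < n + 2" for i using f by (simp add: F_def)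
    then obtain v where v: "v < (n + 2) ^ (4 * ?q)" "\<forall>i<4 * ?q. v div (n + 2) ^ i mod (n + 2) = F i"
      using digits_surj[of "4 * ?q" F "n + 2"] by blast
    have dig: "digits (n + 2) p v l = F (p + l)" if "p + l < 4 * ?q" for p l
      using v(2) that by (simp add: digits_def)
    have "digits (n + 2) 0 v l = f0 l \<and> digits (n + 2) ?q v l = f1 l \<and>
      digits (n + 2) (2 * ?q) v l = f2 l \<and> digits (n + 2) (3 * ?q) v l = f3 l" if "l < ?q" for l
      using dig[of 0 l] dig[of ?q l] dig[of "2 * ?q" l] dig[of "3 * ?q" l] that
      unfolding F_def by simp
    then show ?thesis using v(1) by (intro exI[of _ v]) (simp add: num_values_def)
  qed
  show "digits (n + 2) (2 * ?q) v l < n + 2 \<and> digits (n + 2) (3 * ?q) v l < n + 2" for v l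
    by (simp add: digits_less)
qed

text \<open>Choosing a leaf of each color amounts to choosing a value \<open>f T\<close> for each
  color \<open>T\<close>, by quotient and remainder; then the claims link compatible values with
  satisfying assignments of weight \<open>k\<close>.\<close>

lemma leaf_clique_iff:
  fixes \<beta> L d k
  defines "n \<equiv> leading_ones \<beta> L"
  shows "(\<exists>u. (\<forall>i<num_views d k. u i < num_leaves d n k \<and> color d n k (u i) = i) \<and>
      (\<forall>i<num_views d k. \<forall>j<num_views d k. i \<noteq> j \<longrightarrow> leaf_edge d \<beta> L n k (u i) (u j))) \<longleftrightarrow>
    (map \<beta> [0..<L], k) \<in> WCS 1 d" (is "?clique \<longleftrightarrow> _")
proof -
  let ?m = "num_views d k" and ?N = "num_values d n k" and ?C = "{i. i < n \<and> node_bit \<beta> n i}"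
    and ?E = "{(i, j). wire_bit \<beta> n i j}" and ?q = "2 ^ Suc d :: nat"
  let ?compat = "compatible n (node_bit \<beta> n) (wire_bit \<beta> n) d k (digits (k + 1) 0)
    (digits (n + 2) 0) (digits (n + 2) ?q) (digits (n + 2) (2 * ?q)) (digits (n + 2) (3 * ?q))"
  have N: "0 < ?N" by (simp add: num_values_def)
  have m: "2 \<le> ?m" by (simp add: num_views_def)
  have "?clique \<longleftrightarrow> is_code d \<beta> L n \<and>
    (\<exists>f. (\<forall>T<?m. f T < ?N) \<and> (\<forall>T<?m. \<forall>T'<?m. T \<noteq> T' \<longrightarrow> ?compat T (f T) T' (f T')))"
    (is "_ \<longleftrightarrow> _ \<and> ?views")
  proof (intro iffI conjI)
    assume ?clique
    then obtain u where u: "\<And>i. i < ?m \<Longrightarrow> u i < num_leaves d n k \<and> color d n k (u i) = i"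
      "\<And>i j. i < ?m \<Longrightarrow> j < ?m \<Longrightarrow> i \<noteq> j \<Longrightarrow> leaf_edge d \<beta> L n k (u i) (u j)" by blast
    \<comment> \<open>Colors 0 and 1 exist, and the edge between their leaves includes
      \<open>is_code\<close>.\<close>
    show "is_code d \<beta> L n" using u(2)[of 0 1] m by (simp add: leaf_edge_def)
    have "u T div ?N = T" if "T < ?m" for T using u(1)[OF that] by (simp add: color_def split: if_splits)
    then show ?views
      using u(2) N by (intro exI[of _ "\<lambda>T. u T mod ?N"]) (auto simp: leaf_edge_def)
  next
    assume *: "is_code d \<beta> L n \<and> ?views"
    then obtain f where f: "\<And>T. T < ?m \<Longrightarrow> f T < ?N"
      "\<And>T T'. T < ?m \<Longrightarrow> T' < ?m \<Longrightarrow> T \<noteq> T' \<Longrightarrow> ?compat T (f T) T' (f T')" by blast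
    have "T * ?N + f T < num_leaves d n k" "(T * ?N + f T) div ?N = T" "(T * ?N + f T) mod ?N = f T"
      if "T < ?m" for T
      using row_column_less[OF that f(1)[OF that]] f(1)[OF that] by (simp_all add: num_leaves_def)
    then show ?clique
      using f(2) * by (intro exI[of _ "\<lambda>T. T * ?N + f T"]) (auto simp: leaf_edge_def color_def)
  qed
  also have "\<dots> \<longleftrightarrow> is_code d \<beta> L n \<and>
    (\<exists>v. valuation n ?C ?E v \<and> v (n - 1) \<and> card {i \<in> inputs n ?E. v i} = k)"
  proof (rule conj_cong[OF refl])
    assume code: "is_code d \<beta> L n"
    interpret graded_circuit n "node_bit \<beta> n" "wire_bit \<beta> n"
      using code by unfold_locales (auto simp: is_code_def wire_bit_def)
    interpret views n d k ?m ?N "node_bit \<beta> n" "wire_bit \<beta> n" "digits (k + 1) 0"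
      "digits (n + 2) 0" "digits (n + 2) ?q" "digits (n + 2) (2 * ?q)" "digits (n + 2) (3 * ?q)"
      using pos by (rule views_instance)
    have depth: "depth_at_most n ?E d" using code depth_iff[of d] unfolding is_code_def by blast
    then have weft: "weft_at_most n ?E 1" using code weft_iff[of d] unfolding is_code_def by blast
    show "?views \<longleftrightarrow> (\<exists>v. valuation n ?C ?E v \<and> v (n - 1) \<and> card {i \<in> inputs n ?E. v i} = k)"
      unfolding satisfiable_iff_claims[OF depth weft]
    proof
      assume ?views
      then obtain f where "\<And>T T'. T < ?m \<Longrightarrow> T' < ?m \<Longrightarrow> T \<noteq> T' \<Longrightarrow> ?compat T (f T) T' (f T')" by blast
      from views_imp_claims[OF this]
      show "\<exists>X g h. X \<subseteq> {x. x < n \<and> indeg n (wire_bit \<beta> n) x = 0} \<and> card X = k \<and>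
        (\<forall>s. g s < n + 2 \<and> h s < n + 2) \<and> claims_ok n (node_bit \<beta> n) (wire_bit \<beta> n) d (\<lambda>_. True)
          (\<lambda>x. x \<in> X) (\<lambda>i j. \<exists>s<?q. g s = i \<and> h s = j)" .
    next
      assume "\<exists>X g h. X \<subseteq> {x. x < n \<and> indeg n (wire_bit \<beta> n) x = 0} \<and> card X = k \<and>
        (\<forall>s. g s < n + 2 \<and> h s < n + 2) \<and> claims_ok n (node_bit \<beta> n) (wire_bit \<beta> n) d (\<lambda>_. True)
          (\<lambda>x. x \<in> X) (\<lambda>i j. \<exists>s<?q. g s = i \<and> h s = j)"
      then obtain X g h where X: "X \<subseteq> {x. x < n \<and> indeg n (wire_bit \<beta> n) x = 0}" "card X = k"
        and gh: "\<forall>s. g s < n + 2 \<and> h s < n + 2"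
        and ok: "claims_ok n (node_bit \<beta> n) (wire_bit \<beta> n) d (\<lambda>_. True)
          (\<lambda>x. x \<in> X) (\<lambda>i j. \<exists>s<?q. g s = i \<and> h s = j)" by (elim exE conjE)
      obtain f where "\<And>T. f T < ?N" "\<And>T T'. ?compat T (f T) T' (f T')"
        using claims_imp_views[OF X _ ok] gh by blast
      then show ?views by blast
    qed
  qed
  also have "\<dots> \<longleftrightarrow> (map \<beta> [0..<L], k) \<in> WCS 1 d"
    using WCS_iff[of \<beta> L k d] unfolding n_def by blast
  finally show ?thesis .
qed

section \<open>Correctness and composition with a given reduction\<close>

lemma reduction_correct:
  "(map (out_bit d \<beta> L k) [0..<out_length d \<beta> L k], new_edges d k) \<in> dilation_augmentation star_forest 3 \<longleftrightarrow>
    (map \<beta> [0..<L], k) \<in> WCS 1 d"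
proof -
  define n where "n = leading_ones \<beta> L"
  let ?c = "center d n k"
  interpret clique_gadget "num_leaves d n k" ?c "num_views d k" "leaf_edge d \<beta> L n k" "color d n k"
    by (rule clique_gadget_instance)
  have "graph_pair_code (?c + 1) G \<Gamma> =
      map (pair_bit (star_edge d n k) (hop_edge d \<beta> L n k) (?c + 1))
        [0..<(?c + 1) + 1 + (?c + 1) * (?c + 1) + (?c + 1) * (?c + 1)]"
    by (rule pair_code_bits) (simp_all add: star_edge_def hop_edge_def)
  also have "\<dots> = map (out_bit d \<beta> L k) [0..<out_length d \<beta> L k]"
    by (simp add: out_bit_def[abs_def] out_length_def n_def Let_def del: upt_Suc)
  finally have code: "map (out_bit d \<beta> L k) [0..<out_length d \<beta> L k] = graph_pair_code (?c + 1) G \<Gamma>" ..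
  have budget: "budget = new_edges d k" by (simp add: budget_def new_edges_def num_copies_def)
  show ?thesis
    unfolding code dilation_augmentation_iff[OF G_edges \<Gamma>_edges]
    using star_forest_G augmentation_iff_clique leaf_clique_iff[of d k \<beta> L] unfolding budget n_def
    by blast
qed

text \<open>The transducer is appended to the program of the given reduction and starts on whatever
  memory that leaves behind. Its input is short because \<open>fpt_reducible\<close> charges for the
  length of the output, and its parameter is at most \<open>g k\<close>; the new parameter depends
  on the latter only.\<close>

lemma WCS_reducible:
  assumes "P \<le>\<^sub>f\<^sub>p\<^sub>t WCS 1 d"
  shows "P \<le>\<^sub>f\<^sub>p\<^sub>t dilation_augmentation star_forest 3"
proof -
  obtain p f g c where f: "computable f" and g: "computable g"
    and p: "\<And>w k. \<exists>T s w' k'. exec p (input_state (w, k)) T s \<and> output_of s = (w', k') \<and>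
        T + length w' \<le> f k * (length w + 1) ^ c \<and> k' \<le> g k \<and> ((w, k) \<in> P \<longleftrightarrow> (w', k') \<in> WCS 1 d)"
    using assms unfolding fpt_reducible_def by blast
  have def_len: "definable (\<lambda>\<beta> \<rho>. out_length d \<beta> (\<rho> 0) (\<rho> 1))" by (rule definable_out_length)
  have def_par: "definable (\<lambda>\<beta> \<rho>. new_edges d (\<rho> 1))"
    by (intro definable_new_edges definable_var)
  obtain q C where q: "\<And>R A. \<exists>s. run q (R, A) ((R 0 + R 1 + 2) ^ C) s \<and>
    output_of s = (map (out_bit d (\<lambda>j. A 0 j \<noteq> 0) (R 0) (R 1)) [0..<out_length d (\<lambda>j. A 0 j \<noteq> 0) (R 0) (R 1)],
      new_edges d (R 1))"
    by (rule transducer[OF def_len def_par pred_out_bit[of d]], rule that) (simp add: numeral_2_eq_2)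
  obtain D where "\<forall>\<beta> (\<rho> :: nat \<Rightarrow> nat) M. (\<forall>i. \<rho> i \<le> M) \<longrightarrow> out_length d \<beta> (\<rho> 0) (\<rho> 1) \<le> (M + 2) ^ D"
    using definable_bound[OF def_len] ..
  from this[rule_format, of "case_nat L (\<lambda>_. k)" "L + k" for L k]
  have D: "out_length d \<beta> L k \<le> (L + k + 2) ^ D" for \<beta> L k by (auto split: nat.split)
  obtain D' where "\<forall>(\<beta> :: nat \<Rightarrow> bool) (\<rho> :: nat \<Rightarrow> nat) M. (\<forall>i. \<rho> i \<le> M) \<longrightarrow> new_edges d (\<rho> 1) \<le> (M + 2) ^ D'"
    using definable_bound[OF def_par] ..
  from this[rule_format, of "\<lambda>_. k" k for k]
  have D': "new_edges d k \<le> (k + 2) ^ D'" for k by simp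
  \<comment> \<open>The exponents 1, \<open>C\<close> and \<open>D\<close> belong to the time of
    \<open>p\<close>, the time of \<open>q\<close> and the length of the output;
    \<open>power_add_le\<close> joins them.\<close>
  let ?e = "1 + C + 1 + D + 1"
  let ?f = "\<lambda>k. (f k + g k + 2) ^ ?e" and ?g = "\<lambda>k. (f k + g k + 2) ^ D'"
  have main: "\<exists>T s w' k'. exec (Seq p q) (input_state (w, k)) T s \<and> output_of s = (w', k') \<and>
      T + length w' \<le> ?f k * (length w + 1) ^ (c * ?e) \<and> k' \<le> ?g k \<and>
      ((w, k) \<in> P \<longleftrightarrow> (w', k') \<in> dilation_augmentation star_forest 3)" for w k
  proof -
    obtain T s w1 k1 where s: "exec p (input_state (w, k)) T s" "output_of s = (w1, k1)"
      "T + length w1 \<le> f k * (length w + 1) ^ c" "k1 \<le> g k" "(w, k) \<in> P \<longleftrightarrow> (w1, k1) \<in> WCS 1 d"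
      using p by blast
    obtain R A where RA: "s = (R, A)" by fastforce
    define \<beta> where "\<beta> = (\<lambda>j. A 0 j \<noteq> 0)"
    have w1: "w1 = map \<beta> [0..<R 0]" "k1 = R 1"
      using s(2) by (auto simp: RA output_of_def \<beta>_def)
    let ?L = "R 0" and ?M = "f k * (length w + 1) ^ c + g k"
    let ?w = "map (out_bit d \<beta> ?L k1) [0..<out_length d \<beta> ?L k1]"
    obtain s' T' where s': "exec q s T' s'" "T' \<le> (?L + k1 + 2) ^ C" "output_of s' = (?w, new_edges d k1)"
      using q[of R A] unfolding run_def RA \<beta>_def w1(2) by blast
    have L: "?L \<le> f k * (length w + 1) ^ c" "T \<le> f k * (length w + 1) ^ c"
      using s(3) by (auto simp: w1)
    have "T + T' + length ?w \<le> (?M + 2) ^ ?e"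
    proof (intro power_add_le)
      show "T \<le> (?M + 2) ^ 1" using L by simp
      have *: "(?L + k1 + 2) ^ E \<le> (?M + 2) ^ E" for E using L(1) s(4) by (intro power_mono) simp_all
      show "T' \<le> (?M + 2) ^ C" using s'(2) * by (rule order_trans)
      show "length ?w \<le> (?M + 2) ^ D" using order_trans[OF D *] by simp
    qed
    \<comment> \<open>Separates the parameter from the length of the word by absorbing the summand
      \<open>g k + 2\<close> into the factor of the parameter.\<close>
    also have "\<dots> \<le> ((f k + g k + 2) * (length w + 1) ^ c) ^ ?e"
    proof (rule power_mono)
      have "(g k + 2) * 1 \<le> (g k + 2) * (length w + 1) ^ c" by (intro mult_le_mono2) simp
      then show "?M + 2 \<le> (f k + g k + 2) * (length w + 1) ^ c" by (simp add: algebra_simps)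
    qed simp
    also have "\<dots> = ?f k * (length w + 1) ^ (c * ?e)" by (simp only: power_mult_distrib power_mult)
    finally have time: "T + T' + length ?w \<le> ?f k * (length w + 1) ^ (c * ?e)" .
    have "new_edges d k1 \<le> (k1 + 2) ^ D'" by (rule D')
    also have "\<dots> \<le> ?g k" using s(4) by (intro power_mono) simp_all
    finally have par: "new_edges d k1 \<le> ?g k" .
    have "(w, k) \<in> P \<longleftrightarrow> (?w, new_edges d k1) \<in> dilation_augmentation star_forest 3"
      unfolding reduction_correct using s(5) w1(1) by simp
    then show ?thesis using exec_Seq[OF s(1) s'(1)] s'(3) time par by blast
  qed
  show ?thesis
    unfolding fpt_reducible_def
    by (rule exI[of _ "Seq p q"], rule exI[of _ ?f], rule exI[of _ ?g], rule exI[of _ "c * ?e"],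
      intro conjI allI computable_poly f g main)
qed

theorem theorem32: "W_hard 1 (dilation_augmentation star_forest 3)"
  unfolding W_hard_def W_def using WCS_reducible by blast

end
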